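(* Let $B:=(3,\{00,11,22\})$, that is, $B$ is the pattern consisting of three isolated loops. Then $\lambda_{6,4}=40/3^4$, the $(6,4)$-edge-inducibility problem is perfectly $B$-stable, and the unique maximizer of $\lambda_{6,4}(B(\mathbf{a}))$ over $\mathbf{a}\in\mathbb{S}_3$ is $\mathbf{a}=(1/3,1/3,1/3)$.
   Context: Graphs are finite and simple. $[m]:=\{0,\dots,m-1\}$, $ij$ abbreviates the unordered pair $\{i,j\}$ (with $ii$ denoting a loop at $i$), and $(m,E)$ denotes the graph/pattern with vertex set $[m]$ and edge set $E$. Edge-inducibility: for non-negative integers $\kappa,\ell$ and a graph $G$ with $n\ge\kappa$ vertices, $\lambda_{\kappa,\ell}(G)$ is the number of $\kappa$-subsets of $V(G)$ that span exactly $\ell$ edges of $G$, divided by $\binom{n}{\kappa}$. Further, $\lambda_{\kappa,\ell}(n):=\max\{\lambda_{\kappa,\ell}(G): G \text{ is an } n\text{-vertex graph}\}$ and $\lambda_{\kappa,\ell}:=\lim_{n\to\infty}\lambda_{\kappa,\ell}(n)$ (the limit exists). A pattern $B$ is a graph in which loops on some vertices are additionally allowed (no multiple edges). A pattern automorphism is a bijection $f:V(B)\to V(B)$ such that for all $u,w\in V(B)$ (including $u=w$) $\{u,w\}\in E(B)$ iff $\{f(u),f(w)\}\in E(B)$. For a pattern $B$ with vertex set $[m]$ and pairwise disjoint finite sets $V_0,\dots,V_{m-1}$ (some possibly empty), the blowup $B(V_0,\dots,V_{m-1})$ is the (loopless) graph on $V_0\cup\dots\cup V_{m-1}$ in which distinct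 $x\in V_i$, $y\in V_j$ are adjacent iff $\{i,j\}\in E(B)$ (so $V_i$ is a clique if $i$ has a loop, and an independent set otherwise). $B()$ denotes the family of all blowups of $B$. $\mathbb{S}_m:=\{(x_0,\dots,x_{m-1})\in\mathbb{R}^m: x_0+\dots+x_{m-1}=1,\ x_i\ge 0 \text{ for all } i\}$. For $\mathbf{x}\in\mathbb{S}_m$, $\lambda_{\kappa,\ell}(B(\mathbf{x}))$ is the limit as $n\to\infty$ of $\lambda_{\kappa,\ell}(B(V_0,\dots,V_{m-1}))$ where $|V_i|=(x_i+o(1))n$ for each $i\in[m]$. A maximizer is an $\mathbf{x}\in\mathbb{S}_m$ at which this function attains its maximum over $\mathbb{S}_m$. The edit distance $\delta_{\mathrm{edit}}(G,H)$ between graphs of the same order is the minimum of $|E(G)\bigtriangleup f(E(H))|$ over bijections $f:V(H)\to V(G)$, and $\delta_{\mathrm{edit}}(G,B())$ is the minimum of $\delta_{\mathrm{edit}}(G,H)$ over $H\in B()$ with the same number of vertices as $G$. The $(\kappa,\ell)$-problem is perfectly $B$-stable if there is $C>0$ such that every graph $G$ of order $n\ge C$ satisfies $\delta_{\mathrm{edit}}(G,B())\le C\,(\lambda_{\kappa,\ell}(n)-\lambda_{\kappa,\ell}(G))\,n^2$. *)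

theory Defs
  imports Complex_Main "HOL-Library.Disjoint_Sets"
begin

type_synonym 'a graph = "'a set \<times> 'a set set"

definition graph :: "'a graph \<Rightarrow> bool" where
  "graph G \<longleftrightarrow> finite (fst G) \<and> snd G \<subseteq> {{x, y} | x y. x \<in> fst G \<and> y \<in> fst G \<and> x \<noteq> y}"

definition graph_order :: "'a graph \<Rightarrow> nat" where
  "graph_order G = card (fst G)"

definition edge_density :: "nat \<Rightarrow> nat \<Rightarrow> 'a graph \<Rightarrow> real" where
  "edge_density k l G =
     real (card {A. A \<subseteq> fst G \<and> card A = k \<and> card {e \<in> snd G. e \<subseteq> A} = l})
       / real (graph_order G choose k)"

text \<open>Every finite graph is isomorphic to one whose vertices are natural numbers, so statements
  about all graphs are made for graphs over \<^typ>\<open>nat\<close>. The set below is finite and nonempty: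
  all its elements are fractions in the unit interval with denominator \<open>n choose k\<close>.\<close>

definition max_edge_density :: "nat \<Rightarrow> nat \<Rightarrow> nat \<Rightarrow> real" where
  "max_edge_density k l n =
     Max {edge_density k l G | G :: nat graph. graph G \<and> graph_order G = n}"

definition edge_inducibility :: "nat \<Rightarrow> nat \<Rightarrow> real" where
  "edge_inducibility k l = lim (\<lambda>n. max_edge_density k l n)"

text \<open>A pattern \<open>(m, E)\<close> has vertex set \<open>{..<m}\<close>. Its edges are the sets \<open>{i, j}\<close> with
  \<open>i, j < m\<close>; a loop at \<open>i\<close> is the singleton \<open>{i, i} = {i}\<close>.\<close>

type_synonym pattern = "nat \<times> nat set set"

definition three_loops :: pattern where
  "three_loops = (3, {{0, 0}, {1, 1}, {2, 2}})"

definition blowup_parts :: "pattern \<Rightarrow> (nat \<Rightarrow> 'a set) \<Rightarrow> bool" where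
  "blowup_parts B V \<longleftrightarrow> (\<forall>i<fst B. finite (V i)) \<and> disjoint_family_on V {..<fst B}"

definition blowup :: "pattern \<Rightarrow> (nat \<Rightarrow> 'a set) \<Rightarrow> 'a graph" where
  "blowup B V =
     (\<Union>i<fst B. V i,
      {{x, y} | x y i j. i < fst B \<and> j < fst B \<and> x \<in> V i \<and> y \<in> V j \<and> x \<noteq> y \<and> {i, j} \<in> snd B})"

definition blowups :: "pattern \<Rightarrow> 'a graph set" where
  "blowups B = {blowup B V | V. blowup_parts B V}"

text \<open>Points of the simplex are lists of length \<open>m\<close>.\<close>

definition simplex :: "nat \<Rightarrow> real list set" where
  "simplex m = {x. length x = m \<and> (\<Sum>i<m. x ! i) = 1 \<and> (\<forall>i<m. x ! i \<ge> 0)}"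

text \<open>The limit is required along every sequence of blowups with \<open>|V\<^sub>i| = (x\<^sub>i + o(1)) n\<close>. For
  \<open>x\<close> in the simplex such sequences exist, so there is at most one limit \<open>L\<close>.\<close>

definition has_blowup_density :: "nat \<Rightarrow> nat \<Rightarrow> pattern \<Rightarrow> real list \<Rightarrow> real \<Rightarrow> bool" where
  "has_blowup_density k l B x L \<longleftrightarrow>
     (\<forall>V :: nat \<Rightarrow> nat \<Rightarrow> nat set.
        (\<forall>n. blowup_parts B (V n)) \<longrightarrow>
        (\<forall>i<fst B. (\<lambda>n. real (card (V n i)) / real n) \<longlonglongrightarrow> x ! i) \<longrightarrow>
        (\<lambda>n. edge_density k l (blowup B (V n))) \<longlonglongrightarrow> L)"

definition blowup_density :: "nat \<Rightarrow> nat \<Rightarrow> pattern \<Rightarrow> real list \<Rightarrow> real" where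
  "blowup_density k l B x = (THE L. has_blowup_density k l B x L)"

definition maximizer :: "nat \<Rightarrow> nat \<Rightarrow> pattern \<Rightarrow> real list \<Rightarrow> bool" where
  "maximizer k l B x \<longleftrightarrow>
     x \<in> simplex (fst B) \<and>
     (\<forall>y\<in>simplex (fst B). blowup_density k l B y \<le> blowup_density k l B x)"

text \<open>Both infima below are of sets of natural numbers, hence minima whenever the set is nonempty.\<close>

definition edit_distance :: "'a graph \<Rightarrow> 'b graph \<Rightarrow> nat" where
  "edit_distance G H =
     Inf {card (sym_diff (snd G) ((`) f ` snd H)) | f. bij_betw f (fst H) (fst G)}"

definition edit_distance_blowups :: "nat graph \<Rightarrow> pattern \<Rightarrow> nat" where
  "edit_distance_blowups G B =
     Inf {edit_distance G H | H :: nat graph. H \<in> blowups B \<and> graph_order H = graph_order G}"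

definition perfectly_stable :: "nat \<Rightarrow> nat \<Rightarrow> pattern \<Rightarrow> bool" where
  "perfectly_stable k l B \<longleftrightarrow>
     (\<exists>C>0. \<forall>G :: nat graph. graph G \<longrightarrow> real (graph_order G) \<ge> C \<longrightarrow>
        real (edit_distance_blowups G B)
          \<le> C * (max_edge_density k l (graph_order G) - edge_density k l G) * (real (graph_order G))\<^sup>2)"

end

theory Submission
  imports Defs
begin

text \<open>
  The upper bound is a sum-of-squares certificate, and the stability is read off from its slack.

  To every 4-set \<open>T\<close> of vertices belongs a quadratic form \<open>kernel r T y z\<close>, which depends on how the
  vertices \<open>y\<close> and \<open>z\<close> attach to \<open>T\<close> and is positive semidefinite in \<open>(y, z)\<close>. For every 6-set \<open>S\<close>, the
  values of these forms at the splittings of \<open>S\<close> into a 4-set and an ordered pair add up to a number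
  \<open>k(S)\<close> with \<open>97200 [S spans 4 edges] + k(S) + [S is not a cluster] \<le> 48000\<close> (\<open>certificate\<close>). Here a
  cluster is a disjoint union of at most three cliques. Summing over all \<open>S\<close>, the forms contribute a
  nonnegative number up to \<open>O(n^5)\<close> for the diagonal terms \<open>y = z\<close>. This gives the density bound
  \<open>48000 / 97200 = 40/81\<close> and, for a nearly extremal graph, few 6-sets that are not clusters
  (\<open>global_bound\<close>). Three cliques of equal size attain the density asymptotically.

  For perfect stability let \<open>d\<close> be the least number of wrong (ordered) pairs of a graph with respect to a
  partition of the vertices into three classes, and take a graph that maximises the number of good 6-sets
  plus a small multiple of \<open>n^4 d\<close>. Such a maximiser is nearly extremal, so almost all of its
  6-sets are clusters, and a random 4-set containing three independent vertices then defines a partition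
  with \<open>o(n^2)\<close> wrong pairs (\<open>partition_of_few_bad\<close>). Replacing a vertex by a twin of another one cannot
  increase the maximised quantity, so all vertices lie in about equally many good 6-sets. The certificate summed
  over the 6-sets through one vertex then shows that each vertex lies in few non-clusters (\<open>local_bound\<close>),
  and in an optimal partition this forces each vertex to have few wrong pairs (\<open>wdeg_small\<close>). But
  then correcting a single wrong pair creates at least \<open>n^4/2000\<close> more good 6-sets than it destroys, up
  to a smaller error (\<open>flip_gain\<close>). Hence the maximiser has no wrong pair, that is,
  \<open>d = 0\<close> (\<open>penalised_maximum_is_partitioned\<close>). Comparing an arbitrary graph with this maximiser bounds its
  distance from a blowup linearly by its deficit (\<open>partitioned_beats_by_distance\<close>).

  The density of the blowups is a symmetric polynomial of the class proportions, whose only maximum on the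
  simplex is at the centre (\<open>sym_poly_bound\<close>).

  Graphs are symmetric irreflexive relations up to the last part.
\<close>

section \<open>The sum-of-squares certificate\<close>

definition tdeg :: "('a \<Rightarrow> 'a \<Rightarrow> bool) \<Rightarrow> 'a set \<Rightarrow> 'a \<Rightarrow> nat" where
  "tdeg r T v = card {u \<in> T. r v u}"

definition num_deg :: "('a \<Rightarrow> 'a \<Rightarrow> bool) \<Rightarrow> 'a set \<Rightarrow> nat \<Rightarrow> nat" where
  "num_deg r T d = card {v \<in> T. tdeg r T v = d}"

definition nbr_deg :: "('a \<Rightarrow> 'a \<Rightarrow> bool) \<Rightarrow> 'a set \<Rightarrow> 'a \<Rightarrow> nat \<Rightarrow> nat" where
  "nbr_deg r T y d = card {v \<in> T. tdeg r T v = d \<and> r y v}"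

text \<open>The linear forms of the certificate, one family for each isomorphism type of the graph on \<open>T\<close> (the empty
  graph, a single edge, a path on three vertices, a triangle, a star, a complete graph). The argument lists how many
  neighbours the attached vertex has among the vertices of \<open>T\<close> of each occurring degree, in increasing order.
  In each of these types the vertices of equal degree are equivalent under automorphisms, so
  this data describes the attachment up to symmetry. The coefficients come from solving a semidefinite
  program numerically and rounding.\<close>

definition form_E4 :: "nat \<Rightarrow> int" where
  "form_E4 p = (if p = 0 then -2 else if p = 1 then 1 else if p = 2 then 1 else if p = 3 then 3 else 5)"
definition form_K4 :: "nat \<Rightarrow> int" where
  "form_K4 p = (if p = 4 then 2 else if p = 0 then -1 else 0)"
definition form_K13 :: "nat \<times> nat \<Rightarrow> int" where
  "form_K13 p = (if p = (0,0) then -1 else if p = (0,1) then 1 else if p = (1,0) then 1 else if p = (2,0) then -1 else 0)"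
definition form_K3_1 :: "nat \<times> nat \<Rightarrow> int" where
  "form_K3_1 p = (if p = (0,3) then 1 else if p = (0,0) then -1 else 0)"
definition form_K3_2 :: "nat \<times> nat \<Rightarrow> int" where
  "form_K3_2 p = (if p = (1,0) then 1 else if p = (0,0) then -1 else 0)"
definition form_P3_1 :: "nat \<times> nat \<times> nat \<Rightarrow> int" where
  "form_P3_1 p = (if p = (0,0,0) then 8 else if p = (0,0,1) then 1 else if p = (0,1,0) then -1
     else if p = (0,1,1) then -5 else if p = (0,2,0) then -6 else if p = (0,2,1) then 1
     else if p = (1,0,1) then -9 else if p = (1,1,0) then -5 else if p = (1,2,0) then 1 else 0)"
definition form_P3_2 :: "nat \<times> nat \<times> nat \<Rightarrow> int" where
  "form_P3_2 p = (if p = (0,0,1) then -4 else if p = (0,1,0) then -4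
     else if p = (0,1,1) then 2 else if p = (0,2,0) then -2 else if p = (0,2,1) then -1
     else if p = (1,0,0) then 9 else if p = (1,0,1) then 2 else if p = (1,1,0) then -1 else if p = (1,2,0) then 2 else 0)"
definition form_K2_1 :: "nat \<times> nat \<Rightarrow> int" where "form_K2_1 p = (if p = (0,1) then 1 else 0)"
definition form_K2_2 :: "nat \<times> nat \<Rightarrow> int" where "form_K2_2 p = (if p = (1,1) then 1 else 0)"
definition form_K2_3 :: "nat \<times> nat \<Rightarrow> int" where "form_K2_3 p = (if p = (2,0) then 1 else 0)"
definition form_K2_4 :: "nat \<times> nat \<Rightarrow> int" where
  "form_K2_4 p = (if p = (1,0) then 1 else if p = (0,2) then -2 else 0)"
definition form_K2_5 :: "nat \<times> nat \<Rightarrow> int" where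
  "form_K2_5 p = (if p = (0,0) then 2 else if p = (1,2) then -1 else if p = (2,1) then -2 else 0)"

definition gram_K2 :: "nat \<times> nat \<Rightarrow> nat \<times> nat \<Rightarrow> int" where
  "gram_K2 p q = 
     form_K2_1 p * (8380 * form_K2_1 q - 3914 * form_K2_2 q - 11071 * form_K2_3 q + 1262 * form_K2_4 q - 27 * form_K2_5 q)
   + form_K2_2 p * (- 3914 * form_K2_1 q + 3321 * form_K2_2 q + 6727 * form_K2_3 q - 2550 * form_K2_4 q - 761 * form_K2_5 q)
   + form_K2_3 p * (- 11071 * form_K2_1 q + 6727 * form_K2_2 q + 22929 * form_K2_3 q - 2877 * form_K2_4 q - 3057 * form_K2_5 q)
   + form_K2_4 p * (1262 * form_K2_1 q - 2550 * form_K2_2 q - 2877 * form_K2_3 q + 2900 * form_K2_4 q + 728 * form_K2_5 q)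
   + form_K2_5 p * (- 27 * form_K2_1 q - 761 * form_K2_2 q - 3057 * form_K2_3 q + 728 * form_K2_4 q + 1191 * form_K2_5 q)"
definition gram_P3 :: "nat \<times> nat \<times> nat \<Rightarrow> nat \<times> nat \<times> nat \<Rightarrow> int" where
  "gram_P3 p q = form_P3_1 p * (145 * form_P3_1 q + 28 * form_P3_2 q) + form_P3_2 p * (28 * form_P3_1 q + 68 * form_P3_2 q)"
definition gram_K3 :: "nat \<times> nat \<Rightarrow> nat \<times> nat \<Rightarrow> int" where
  "gram_K3 p q = form_K3_1 p * (2800 * form_K3_1 q + 2950 * form_K3_2 q) + form_K3_2 p * (2950 * form_K3_1 q + 4000 * form_K3_2 q)"


text \<open>The first argument counts the vertices of \<open>T\<close> by degree, which identifies the type; the next two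
  describe the attachments of \<open>y\<close> and \<open>z\<close>, and the last one counts the common neighbours among the
  isolated vertices of \<open>T\<close>. The term with the factor 900 is the square of the form that is antisymmetric
  under exchanging the two isolated vertices; the number of common neighbours is needed to express it.\<close>

definition gram :: "(nat \<Rightarrow> nat) \<Rightarrow> (nat \<Rightarrow> nat) \<Rightarrow> (nat \<Rightarrow> nat) \<Rightarrow> nat \<Rightarrow> int" where
  "gram n p q m =
     (if n 0 = 4 then 397 * form_E4 (p 0) * form_E4 (q 0)
      else if n 0 = 2 then gram_K2 (p 0, p 1) (q 0, q 1)
        + (if p 1 = 0 \<and> q 1 = 0 then 900 * (2 * int m - int (p 0) * int (q 0)) else 0)
      else if n 0 = 1 \<and> n 2 = 1 then gram_P3 (p 0, p 1, p 2) (q 0, q 1, q 2)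
      else if n 0 = 1 \<and> n 2 = 3 then gram_K3 (p 0, p 2) (q 0, q 2)
      else if n 1 = 3 \<and> n 3 = 1 then 4324 * form_K13 (p 1, p 3) * form_K13 (q 1, q 3)
      else if n 3 = 4 then 400 * form_K4 (p 3) * form_K4 (q 3)
      else 0)"

definition kernel :: "('a \<Rightarrow> 'a \<Rightarrow> bool) \<Rightarrow> 'a set \<Rightarrow> 'a \<Rightarrow> 'a \<Rightarrow> int" where
  "kernel r T y z = gram (num_deg r T) (nbr_deg r T y) (nbr_deg r T z)
     (card {v \<in> T. tdeg r T v = 0 \<and> r y v \<and> r z v})"

definition kernel_sum :: "('a \<Rightarrow> 'a \<Rightarrow> bool) \<Rightarrow> 'a set \<Rightarrow> int" where
  "kernel_sum r S = (\<Sum>y\<in>S. \<Sum>z\<in>S - {y}. kernel r (S - {y, z}) y z)"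

definition edges_in :: "('a \<Rightarrow> 'a \<Rightarrow> bool) \<Rightarrow> 'a set \<Rightarrow> nat" where
  "edges_in r S = card {{x, y} | x y. x \<in> S \<and> y \<in> S \<and> r x y}"

text \<open>The relation is a disjoint union of cliques on \<open>S\<close>, at most three of them: it has no induced path on three vertices
  and no independent set of size four. These are the induced subgraphs of blowups of three loops.\<close>

definition cluster3 :: "('a \<Rightarrow> 'a \<Rightarrow> bool) \<Rightarrow> 'a set \<Rightarrow> bool" where
  "cluster3 r S \<longleftrightarrow>
     (\<forall>x\<in>S. \<forall>y\<in>S. \<forall>z\<in>S. r x y \<and> r y z \<and> x \<noteq> z \<longrightarrow> r x z) \<and>
     (\<forall>W\<subseteq>S. card W = 4 \<longrightarrow> (\<exists>x\<in>W. \<exists>y\<in>W. r x y))"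

definition cnt4 :: "(nat \<Rightarrow> bool) \<Rightarrow> nat \<Rightarrow> nat \<Rightarrow> nat \<Rightarrow> nat \<Rightarrow> bool \<Rightarrow> bool \<Rightarrow> bool \<Rightarrow> bool \<Rightarrow> nat" where
  "cnt4 P d1 d2 d3 d4 y1 y2 y3 y4 = of_bool (P d1 \<and> y1) + of_bool (P d2 \<and> y2) + of_bool (P d3 \<and> y3) + of_bool (P d4 \<and> y4)"

text \<open>The kernel in terms of the truth values of the six edges of \<open>T\<close> and of the four adjacencies of each
  of \<open>y\<close> and \<open>z\<close>, so that the certificate becomes a finite check.\<close>

definition kern4 where
  "kern4 a b c d e f y1 y2 y3 y4 z1 z2 z3 z4 =
     (let d1 = of_bool a + of_bool b + of_bool c :: nat; d2 = of_bool a + of_bool d + of_bool e :: nat;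
          d3 = of_bool b + of_bool d + of_bool f :: nat; d4 = of_bool c + of_bool e + of_bool f :: nat
      in gram (\<lambda>k. cnt4 (\<lambda>d. d = k) d1 d2 d3 d4 True True True True) (\<lambda>k. cnt4 (\<lambda>d. d = k) d1 d2 d3 d4 y1 y2 y3 y4)
          (\<lambda>k. cnt4 (\<lambda>d. d = k) d1 d2 d3 d4 z1 z2 z3 z4)
          (cnt4 (\<lambda>d. d = 0) d1 d2 d3 d4 (y1 \<and> z1) (y2 \<and> z2) (y3 \<and> z3) (y4 \<and> z4)))"

lemma card_filter_eq_sum: "finite A \<Longrightarrow> card {v \<in> A. P v} = (\<Sum>v\<in>A. of_bool (P v))"
  by (simp add: Int_def)

lemma card_filter4:
  assumes "distinct [a, b, c, d]"
  shows "card {v \<in> {a, b, c, d}. P v} = of_bool (P a) + of_bool (P b) + of_bool (P c) + of_bool (P d)"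
proof -
  have "card {v \<in> {a, b, c, d}. P v} = (\<Sum>v\<in>{a, b, c, d}. of_bool (P v))"
    by (rule card_filter_eq_sum) simp
  then show ?thesis using assms by (simp add: add_ac)
qed

lemma kernel_eq_kern4:
  assumes r: "symp r" "irreflp r" and d: "distinct [a, b, c, d]"
  shows "kernel r {a, b, c, d} y z =
    kern4 (r a b) (r a c) (r a d) (r b c) (r b d) (r c d) (r y a) (r y b) (r y c) (r y d) (r z a) (r z b) (r z c) (r z d)"
proof -
  have s: "r b a = r a b" "r c a = r a c" "r d a = r a d" "r c b = r b c" "r d b = r b d" "r d c = r c d"
    using r(1) by (auto dest: sympD)
  have i: "\<not> r a a" "\<not> r b b" "\<not> r c c" "\<not> r d d"
    using r(2) by (auto dest: irreflpD)
  show ?thesis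
    unfolding kernel_def kern4_def num_deg_def nbr_deg_def tdeg_def card_filter4[OF d] cnt4_def Let_def
    by (simp add: s i add_ac)
qed

definition kern_K2 :: "bool \<Rightarrow> bool \<Rightarrow> bool \<Rightarrow> bool \<Rightarrow> bool \<Rightarrow> bool \<Rightarrow> bool \<Rightarrow> bool \<Rightarrow> int" where
  "kern_K2 y1 y2 y3 y4 z1 z2 z3 z4 =
     gram_K2 (of_bool y3 + of_bool y4, of_bool y1 + of_bool y2) (of_bool z3 + of_bool z4, of_bool z1 + of_bool z2)
     + (if \<not> y1 \<and> \<not> y2 \<and> \<not> z1 \<and> \<not> z2
        then 900 * (of_bool y3 - of_bool y4) * (of_bool z3 - of_bool z4) else 0)"

text \<open>Types with a perfect matching other than the complete graph carry no form.\<close>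

lemma kern4_matching:
  assumes "a \<and> f \<or> b \<and> e \<or> c \<and> d" "\<not> (a \<and> b \<and> c \<and> d \<and> e \<and> f)"
  shows "kern4 a b c d e f y1 y2 y3 y4 z1 z2 z3 z4 = 0"
  using assms
  by (cases a; cases b; cases c; cases d; cases e; cases f) (simp_all add: kern4_def gram_def cnt4_def)

lemma kern4_table:
  "kern4 False False False False False False y1 y2 y3 y4 z1 z2 z3 z4 = 397 * form_E4 (of_bool y1 + of_bool y2 + of_bool y3 + of_bool y4) * form_E4 (of_bool z1 + of_bool z2 + of_bool z3 + of_bool z4)"
  "kern4 False False False False False True y1 y2 y3 y4 z1 z2 z3 z4 = kern_K2 y3 y4 y1 y2 z3 z4 z1 z2"
  "kern4 False False False False True False y1 y2 y3 y4 z1 z2 z3 z4 = kern_K2 y2 y4 y1 y3 z2 z4 z1 z3"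
  "kern4 False False False False True True y1 y2 y3 y4 z1 z2 z3 z4 = gram_P3 (of_bool y1, (of_bool y2 + of_bool y3), of_bool y4) (of_bool z1, (of_bool z2 + of_bool z3), of_bool z4)"
  "kern4 False False False True False False y1 y2 y3 y4 z1 z2 z3 z4 = kern_K2 y2 y3 y1 y4 z2 z3 z1 z4"
  "kern4 False False False True False True y1 y2 y3 y4 z1 z2 z3 z4 = gram_P3 (of_bool y1, (of_bool y2 + of_bool y4), of_bool y3) (of_bool z1, (of_bool z2 + of_bool z4), of_bool z3)"
  "kern4 False False False True True False y1 y2 y3 y4 z1 z2 z3 z4 = gram_P3 (of_bool y1, (of_bool y3 + of_bool y4), of_bool y2) (of_bool z1, (of_bool z3 + of_bool z4), of_bool z2)"
  "kern4 False False False True True True y1 y2 y3 y4 z1 z2 z3 z4 = gram_K3 (of_bool y1, (of_bool y2 + of_bool y3 + of_bool y4)) (of_bool z1, (of_bool z2 + of_bool z3 + of_bool z4))"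
  "kern4 False False True False False False y1 y2 y3 y4 z1 z2 z3 z4 = kern_K2 y1 y4 y2 y3 z1 z4 z2 z3"
  "kern4 False False True False False True y1 y2 y3 y4 z1 z2 z3 z4 = gram_P3 (of_bool y2, (of_bool y1 + of_bool y3), of_bool y4) (of_bool z2, (of_bool z1 + of_bool z3), of_bool z4)"
  "kern4 False False True False True False y1 y2 y3 y4 z1 z2 z3 z4 = gram_P3 (of_bool y3, (of_bool y1 + of_bool y2), of_bool y4) (of_bool z3, (of_bool z1 + of_bool z2), of_bool z4)"
  "kern4 False False True False True True y1 y2 y3 y4 z1 z2 z3 z4 = 4324 * form_K13 ((of_bool y1 + of_bool y2 + of_bool y3), of_bool y4) * form_K13 ((of_bool z1 + of_bool z2 + of_bool z3), of_bool z4)"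
  "kern4 False True False False False False y1 y2 y3 y4 z1 z2 z3 z4 = kern_K2 y1 y3 y2 y4 z1 z3 z2 z4"
  "kern4 False True False False False True y1 y2 y3 y4 z1 z2 z3 z4 = gram_P3 (of_bool y2, (of_bool y1 + of_bool y4), of_bool y3) (of_bool z2, (of_bool z1 + of_bool z4), of_bool z3)"
  "kern4 False True False True False False y1 y2 y3 y4 z1 z2 z3 z4 = gram_P3 (of_bool y4, (of_bool y1 + of_bool y2), of_bool y3) (of_bool z4, (of_bool z1 + of_bool z2), of_bool z3)"
  "kern4 False True False True False True y1 y2 y3 y4 z1 z2 z3 z4 = 4324 * form_K13 ((of_bool y1 + of_bool y2 + of_bool y4), of_bool y3) * form_K13 ((of_bool z1 + of_bool z2 + of_bool z4), of_bool z3)"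
  "kern4 False True True False False False y1 y2 y3 y4 z1 z2 z3 z4 = gram_P3 (of_bool y2, (of_bool y3 + of_bool y4), of_bool y1) (of_bool z2, (of_bool z3 + of_bool z4), of_bool z1)"
  "kern4 False True True False False True y1 y2 y3 y4 z1 z2 z3 z4 = gram_K3 (of_bool y2, (of_bool y1 + of_bool y3 + of_bool y4)) (of_bool z2, (of_bool z1 + of_bool z3 + of_bool z4))"
  "kern4 True False False False False False y1 y2 y3 y4 z1 z2 z3 z4 = kern_K2 y1 y2 y3 y4 z1 z2 z3 z4"
  "kern4 True False False False True False y1 y2 y3 y4 z1 z2 z3 z4 = gram_P3 (of_bool y3, (of_bool y1 + of_bool y4), of_bool y2) (of_bool z3, (of_bool z1 + of_bool z4), of_bool z2)"
  "kern4 True False False True False False y1 y2 y3 y4 z1 z2 z3 z4 = gram_P3 (of_bool y4, (of_bool y1 + of_bool y3), of_bool y2) (of_bool z4, (of_bool z1 + of_bool z3), of_bool z2)"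
  "kern4 True False False True True False y1 y2 y3 y4 z1 z2 z3 z4 = 4324 * form_K13 ((of_bool y1 + of_bool y3 + of_bool y4), of_bool y2) * form_K13 ((of_bool z1 + of_bool z3 + of_bool z4), of_bool z2)"
  "kern4 True False True False False False y1 y2 y3 y4 z1 z2 z3 z4 = gram_P3 (of_bool y3, (of_bool y2 + of_bool y4), of_bool y1) (of_bool z3, (of_bool z2 + of_bool z4), of_bool z1)"
  "kern4 True False True False True False y1 y2 y3 y4 z1 z2 z3 z4 = gram_K3 (of_bool y3, (of_bool y1 + of_bool y2 + of_bool y4)) (of_bool z3, (of_bool z1 + of_bool z2 + of_bool z4))"
  "kern4 True True False False False False y1 y2 y3 y4 z1 z2 z3 z4 = gram_P3 (of_bool y4, (of_bool y2 + of_bool y3), of_bool y1) (of_bool z4, (of_bool z2 + of_bool z3), of_bool z1)"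
  "kern4 True True False True False False y1 y2 y3 y4 z1 z2 z3 z4 = gram_K3 (of_bool y4, (of_bool y1 + of_bool y2 + of_bool y3)) (of_bool z4, (of_bool z1 + of_bool z2 + of_bool z3))"
  "kern4 True True True False False False y1 y2 y3 y4 z1 z2 z3 z4 = 4324 * form_K13 ((of_bool y2 + of_bool y3 + of_bool y4), of_bool y1) * form_K13 ((of_bool z2 + of_bool z3 + of_bool z4), of_bool z1)"
  "kern4 True True True True True True y1 y2 y3 y4 z1 z2 z3 z4 = 400 * form_K4 (of_bool y1 + of_bool y2 + of_bool y3 + of_bool y4) * form_K4 (of_bool z1 + of_bool z2 + of_bool z3 + of_bool z4)"
  by (simp_all add: kern4_def gram_def cnt4_def kern_K2_def)

definition p3free :: "bool \<Rightarrow> bool \<Rightarrow> bool \<Rightarrow> bool" where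
  "p3free a b c \<longleftrightarrow> (a \<and> b \<longrightarrow> c) \<and> (a \<and> c \<longrightarrow> b) \<and> (b \<and> c \<longrightarrow> a)"
definition good6 where
  "good6 b01 b02 b03 b04 b05 b12 b13 b14 b15 b23 b24 b25 b34 b35 b45 \<longleftrightarrow>
     p3free b01 b02 b12 & p3free b01 b03 b13 & p3free b01 b04 b14
       & p3free b01 b05 b15 & p3free b02 b03 b23 & p3free b02 b04 b24
       & p3free b02 b05 b25 & p3free b03 b04 b34 & p3free b03 b05 b35
       & p3free b04 b05 b45 & p3free b12 b13 b23 & p3free b12 b14 b24
       & p3free b12 b15 b25 & p3free b13 b14 b34 & p3free b13 b15 b35
       & p3free b14 b15 b45 & p3free b23 b24 b34 & p3free b23 b25 b35
       & p3free b24 b25 b45 & p3free b34 b35 b45 & (b01 \<or> b02 \<or> b03 \<or> b12 \<or> b13 \<or> b23)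
       & (b01 \<or> b02 \<or> b04 \<or> b12 \<or> b14 \<or> b24) & (b01 \<or> b02 \<or> b05 \<or> b12 \<or> b15 \<or> b25) & (b01 \<or> b03 \<or> b04 \<or> b13 \<or> b14 \<or> b34)
       & (b01 \<or> b03 \<or> b05 \<or> b13 \<or> b15 \<or> b35) & (b01 \<or> b04 \<or> b05 \<or> b14 \<or> b15 \<or> b45) & (b02 \<or> b03 \<or> b04 \<or> b23 \<or> b24 \<or> b34)
       & (b02 \<or> b03 \<or> b05 \<or> b23 \<or> b25 \<or> b35) & (b02 \<or> b04 \<or> b05 \<or> b24 \<or> b25 \<or> b45) & (b03 \<or> b04 \<or> b05 \<or> b34 \<or> b35 \<or> b45)
       & (b12 \<or> b13 \<or> b14 \<or> b23 \<or> b24 \<or> b34) & (b12 \<or> b13 \<or> b15 \<or> b23 \<or> b25 \<or> b35) & (b12 \<or> b14 \<or> b15 \<or> b24 \<or> b25 \<or> b45)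
       & (b13 \<or> b14 \<or> b15 \<or> b34 \<or> b35 \<or> b45) & (b23 \<or> b24 \<or> b25 \<or> b34 \<or> b35 \<or> b45)"
definition kern6 where
  "kern6 b01 b02 b03 b04 b05 b12 b13 b14 b15 b23 b24 b25 b34 b35 b45 = 2 *
     (kern4 b23 b24 b25 b34 b35 b45 b02 b03 b04 b05 b12 b13 b14 b15
       + kern4 b13 b14 b15 b34 b35 b45 b01 b03 b04 b05 b12 b23 b24 b25
       + kern4 b12 b14 b15 b24 b25 b45 b01 b02 b04 b05 b13 b23 b34 b35
       + kern4 b12 b13 b15 b23 b25 b35 b01 b02 b03 b05 b14 b24 b34 b45
       + kern4 b12 b13 b14 b23 b24 b34 b01 b02 b03 b04 b15 b25 b35 b45
       + kern4 b03 b04 b05 b34 b35 b45 b01 b13 b14 b15 b02 b23 b24 b25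
       + kern4 b02 b04 b05 b24 b25 b45 b01 b12 b14 b15 b03 b23 b34 b35
       + kern4 b02 b03 b05 b23 b25 b35 b01 b12 b13 b15 b04 b24 b34 b45
       + kern4 b02 b03 b04 b23 b24 b34 b01 b12 b13 b14 b05 b25 b35 b45
       + kern4 b01 b04 b05 b14 b15 b45 b02 b12 b24 b25 b03 b13 b34 b35
       + kern4 b01 b03 b05 b13 b15 b35 b02 b12 b23 b25 b04 b14 b34 b45
       + kern4 b01 b03 b04 b13 b14 b34 b02 b12 b23 b24 b05 b15 b35 b45
       + kern4 b01 b02 b05 b12 b15 b25 b03 b13 b23 b35 b04 b14 b24 b45
       + kern4 b01 b02 b04 b12 b14 b24 b03 b13 b23 b34 b05 b15 b25 b45
       + kern4 b01 b02 b03 b12 b13 b23 b04 b14 b24 b34 b05 b15 b25 b35)"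
text \<open>The inequality of the certificate for the 6-vertex graph with the given adjacencies.\<close>

definition ok6 where
  "ok6 b01 b02 b03 b04 b05 b12 b13 b14 b15 b23 b24 b25 b34 b35 b45 \<longleftrightarrow>
     (if of_bool b01 + of_bool b02 + of_bool b03 + of_bool b04 + of_bool b05 + of_bool b12 + of_bool b13 + of_bool b14 + of_bool b15 + of_bool b23 + of_bool b24 + of_bool b25 + of_bool b34 + of_bool b35 + of_bool b45 = (4::nat) then 97200 else 0) + kern6 b01 b02 b03 b04 b05 b12 b13 b14 b15 b23 b24 b25 b34 b35 b45
      + (if good6 b01 b02 b03 b04 b05 b12 b13 b14 b15 b23 b24 b25 b34 b35 b45 then 0 else 1) \<le> 48000"
text \<open>Relabelling the vertices reduces the number of graphs to be checked: vertex 0 may be taken of least degree,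
  and the others in increasing order of their degrees after the removal of vertex 0.\<close>

definition min6 where
  "min6 b01 b02 b03 b04 b05 b12 b13 b14 b15 b23 b24 b25 b34 b35 b45 \<longleftrightarrow> 
     (of_bool b01 + of_bool b02 + of_bool b03 + of_bool b04 + of_bool b05) <= ((of_bool b01 + of_bool b12 + of_bool b13 + of_bool b14 + of_bool b15)::nat)
       & (of_bool b01 + of_bool b02 + of_bool b03 + of_bool b04 + of_bool b05) <= ((of_bool b02 + of_bool b12 + of_bool b23 + of_bool b24 + of_bool b25)::nat)
       & (of_bool b01 + of_bool b02 + of_bool b03 + of_bool b04 + of_bool b05) <= ((of_bool b03 + of_bool b13 + of_bool b23 + of_bool b34 + of_bool b35)::nat)
       & (of_bool b01 + of_bool b02 + of_bool b03 + of_bool b04 + of_bool b05) <= ((of_bool b04 + of_bool b14 + of_bool b24 + of_bool b34 + of_bool b45)::nat)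
       & (of_bool b01 + of_bool b02 + of_bool b03 + of_bool b04 + of_bool b05) <= ((of_bool b05 + of_bool b15 + of_bool b25 + of_bool b35 + of_bool b45)::nat)"
definition sorted5 where
  "sorted5 b12 b13 b14 b15 b23 b24 b25 b34 b35 b45 \<longleftrightarrow> 
     (of_bool b12 + of_bool b13 + of_bool b14 + of_bool b15) <= ((of_bool b12 + of_bool b23 + of_bool b24 + of_bool b25)::nat)
       & (of_bool b12 + of_bool b23 + of_bool b24 + of_bool b25) <= ((of_bool b13 + of_bool b23 + of_bool b34 + of_bool b35)::nat)
       & (of_bool b13 + of_bool b23 + of_bool b34 + of_bool b35) <= ((of_bool b14 + of_bool b24 + of_bool b34 + of_bool b45)::nat)
       & (of_bool b14 + of_bool b24 + of_bool b34 + of_bool b45) <= ((of_bool b15 + of_bool b25 + of_bool b35 + of_bool b45)::nat)"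
lemmas forms = form_E4_def form_K4_def form_K13_def form_K3_1_def form_K3_2_def
 form_P3_1_def form_P3_2_def form_K2_1_def form_K2_2_def form_K2_3_def form_K2_4_def form_K2_5_def gram_K2_def gram_P3_def gram_K3_def kern_K2_def

text \<open>All extensions of a 5-vertex graph by a vertex of least degree satisfy the certificate.
  The sixteen following lemmas split the 5-vertex graphs by the neighbourhood of their first vertex.\<close>

definition ok5 where
  "ok5 b12 b13 b14 b15 b23 b24 b25 b34 b35 b45 \<longleftrightarrow> (\<forall>b01 b02 b03 b04 b05. min6 b01 b02 b03 b04 b05 b12 b13 b14 b15 b23 b24 b25 b34 b35 b45 \<longrightarrow> ok6 b01 b02 b03 b04 b05 b12 b13 b14 b15 b23 b24 b25 b34 b35 b45)"

lemma ok5_TTTT: "\<forall>b23 b24 b25 b34 b35 b45. sorted5 True True True True b23 b24 b25 b34 b35 b45 \<longrightarrow> ok5 True True True True b23 b24 b25 b34 b35 b45"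
  apply (simp only: all_bool_eq)
  apply (simp add: sorted5_def)?
  apply (simp only: ok5_def all_bool_eq)?
  apply (simp add: min6_def)?
  apply (simp add: ok6_def kern6_def kern4_matching kern4_table forms good6_def p3free_def)?
  done

lemma ok5_TTTF: "\<forall>b23 b24 b25 b34 b35 b45. sorted5 True True True False b23 b24 b25 b34 b35 b45 \<longrightarrow> ok5 True True True False b23 b24 b25 b34 b35 b45"
  apply (simp only: all_bool_eq)
  apply (simp add: sorted5_def)?
  apply (simp only: ok5_def all_bool_eq)?
  apply (simp add: min6_def)?
  apply (simp add: ok6_def kern6_def kern4_matching kern4_table forms good6_def p3free_def)?
  done

lemma ok5_TTFT: "\<forall>b23 b24 b25 b34 b35 b45. sorted5 True True False True b23 b24 b25 b34 b35 b45 \<longrightarrow> ok5 True True False True b23 b24 b25 b34 b35 b45"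
  apply (simp only: all_bool_eq)
  apply (simp add: sorted5_def)?
  apply (simp only: ok5_def all_bool_eq)?
  apply (simp add: min6_def)?
  apply (simp add: ok6_def kern6_def kern4_matching kern4_table forms good6_def p3free_def)?
  done

lemma ok5_TTFF: "\<forall>b23 b24 b25 b34 b35 b45. sorted5 True True False False b23 b24 b25 b34 b35 b45 \<longrightarrow> ok5 True True False False b23 b24 b25 b34 b35 b45"
  apply (simp only: all_bool_eq)
  apply (simp add: sorted5_def)?
  apply (simp only: ok5_def all_bool_eq)?
  apply (simp add: min6_def)?
  apply (simp add: ok6_def kern6_def kern4_matching kern4_table forms good6_def p3free_def)?
  done

lemma ok5_TFTT: "\<forall>b23 b24 b25 b34 b35 b45. sorted5 True False True True b23 b24 b25 b34 b35 b45 \<longrightarrow> ok5 True False True True b23 b24 b25 b34 b35 b45"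
  apply (simp only: all_bool_eq)
  apply (simp add: sorted5_def)?
  apply (simp only: ok5_def all_bool_eq)?
  apply (simp add: min6_def)?
  apply (simp add: ok6_def kern6_def kern4_matching kern4_table forms good6_def p3free_def)?
  done

lemma ok5_TFTF: "\<forall>b23 b24 b25 b34 b35 b45. sorted5 True False True False b23 b24 b25 b34 b35 b45 \<longrightarrow> ok5 True False True False b23 b24 b25 b34 b35 b45"
  apply (simp only: all_bool_eq)
  apply (simp add: sorted5_def)?
  apply (simp only: ok5_def all_bool_eq)?
  apply (simp add: min6_def)?
  apply (simp add: ok6_def kern6_def kern4_matching kern4_table forms good6_def p3free_def)?
  done

lemma ok5_TFFT: "\<forall>b23 b24 b25 b34 b35 b45. sorted5 True False False True b23 b24 b25 b34 b35 b45 \<longrightarrow> ok5 True False False True b23 b24 b25 b34 b35 b45"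
  apply (simp only: all_bool_eq)
  apply (simp add: sorted5_def)?
  apply (simp only: ok5_def all_bool_eq)?
  apply (simp add: min6_def)?
  apply (simp add: ok6_def kern6_def kern4_matching kern4_table forms good6_def p3free_def)?
  done

lemma ok5_TFFF: "\<forall>b23 b24 b25 b34 b35 b45. sorted5 True False False False b23 b24 b25 b34 b35 b45 \<longrightarrow> ok5 True False False False b23 b24 b25 b34 b35 b45"
  apply (simp only: all_bool_eq)
  apply (simp add: sorted5_def)?
  apply (simp only: ok5_def all_bool_eq)?
  apply (simp add: min6_def)?
  apply (simp add: ok6_def kern6_def kern4_matching kern4_table forms good6_def p3free_def)?
  done

lemma ok5_FTTT: "\<forall>b23 b24 b25 b34 b35 b45. sorted5 False True True True b23 b24 b25 b34 b35 b45 \<longrightarrow> ok5 False True True True b23 b24 b25 b34 b35 b45"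
  apply (simp only: all_bool_eq)
  apply (simp add: sorted5_def)?
  apply (simp only: ok5_def all_bool_eq)?
  apply (simp add: min6_def)?
  apply (simp add: ok6_def kern6_def kern4_matching kern4_table forms good6_def p3free_def)?
  done

lemma ok5_FTTF: "\<forall>b23 b24 b25 b34 b35 b45. sorted5 False True True False b23 b24 b25 b34 b35 b45 \<longrightarrow> ok5 False True True False b23 b24 b25 b34 b35 b45"
  apply (simp only: all_bool_eq)
  apply (simp add: sorted5_def)?
  apply (simp only: ok5_def all_bool_eq)?
  apply (simp add: min6_def)?
  apply (simp add: ok6_def kern6_def kern4_matching kern4_table forms good6_def p3free_def)?
  done

lemma ok5_FTFT: "\<forall>b23 b24 b25 b34 b35 b45. sorted5 False True False True b23 b24 b25 b34 b35 b45 \<longrightarrow> ok5 False True False True b23 b24 b25 b34 b35 b45"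
  apply (simp only: all_bool_eq)
  apply (simp add: sorted5_def)?
  apply (simp only: ok5_def all_bool_eq)?
  apply (simp add: min6_def)?
  apply (simp add: ok6_def kern6_def kern4_matching kern4_table forms good6_def p3free_def)?
  done

lemma ok5_FTFF: "\<forall>b23 b24 b25 b34 b35 b45. sorted5 False True False False b23 b24 b25 b34 b35 b45 \<longrightarrow> ok5 False True False False b23 b24 b25 b34 b35 b45"
  apply (simp only: all_bool_eq)
  apply (simp add: sorted5_def)?
  apply (simp only: ok5_def all_bool_eq)?
  apply (simp add: min6_def)?
  apply (simp add: ok6_def kern6_def kern4_matching kern4_table forms good6_def p3free_def)?
  done

lemma ok5_FFTT: "\<forall>b23 b24 b25 b34 b35 b45. sorted5 False False True True b23 b24 b25 b34 b35 b45 \<longrightarrow> ok5 False False True True b23 b24 b25 b34 b35 b45"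
  apply (simp only: all_bool_eq)
  apply (simp add: sorted5_def)?
  apply (simp only: ok5_def all_bool_eq)?
  apply (simp add: min6_def)?
  apply (simp add: ok6_def kern6_def kern4_matching kern4_table forms good6_def p3free_def)?
  done

lemma ok5_FFTF: "\<forall>b23 b24 b25 b34 b35 b45. sorted5 False False True False b23 b24 b25 b34 b35 b45 \<longrightarrow> ok5 False False True False b23 b24 b25 b34 b35 b45"
  apply (simp only: all_bool_eq)
  apply (simp add: sorted5_def)?
  apply (simp only: ok5_def all_bool_eq)?
  apply (simp add: min6_def)?
  apply (simp add: ok6_def kern6_def kern4_matching kern4_table forms good6_def p3free_def)?
  done

lemma ok5_FFFT: "\<forall>b23 b24 b25 b34 b35 b45. sorted5 False False False True b23 b24 b25 b34 b35 b45 \<longrightarrow> ok5 False False False True b23 b24 b25 b34 b35 b45"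
  apply (simp only: all_bool_eq)
  apply (simp add: sorted5_def)?
  apply (simp only: ok5_def all_bool_eq)?
  apply (simp add: min6_def)?
  apply (simp add: ok6_def kern6_def kern4_matching kern4_table forms good6_def p3free_def)?
  done

lemma ok5_FFFF: "\<forall>b23 b24 b25 b34 b35 b45. sorted5 False False False False b23 b24 b25 b34 b35 b45 \<longrightarrow> ok5 False False False False b23 b24 b25 b34 b35 b45"
  apply (simp only: all_bool_eq)
  apply (simp add: sorted5_def)?
  apply (simp only: ok5_def all_bool_eq)?
  apply (simp add: min6_def)?
  apply (simp add: ok6_def kern6_def kern4_matching kern4_table forms good6_def p3free_def)?
  done

lemma edges_in_insert:
  assumes "symp r" "irreflp r" "finite S" "z \<notin> S"
  shows "edges_in r (insert z S) = edges_in r S + (\<Sum>x\<in>S. of_bool (r z x))"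
proof -
  let ?E = "\<lambda>S. {{x, y} | x y. x \<in> S \<and> y \<in> S \<and> r x y}"
  have eq: "?E (insert z S) = ?E S \<union> (\<lambda>x. {z, x}) ` {x \<in> S. r z x}"
  proof (intro set_eqI iffI)
    fix e assume "e \<in> ?E (insert z S)"
    then obtain x y where e: "e = {x, y}" "x \<in> insert z S" "y \<in> insert z S" "r x y" by auto
    have "r y x" using e(4) assms(1) by (auto dest: sympD)
    moreover have "x \<noteq> y" using e(4) assms(2) by (auto dest: irreflpD)
    ultimately show "e \<in> ?E S \<union> (\<lambda>x. {z, x}) ` {x \<in> S. r z x}"
      using e by (cases "x = z"; cases "y = z") (auto simp: insert_commute)
  next
    fix e assume "e \<in> ?E S \<union> (\<lambda>x. {z, x}) ` {x \<in> S. r z x}"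
    then show "e \<in> ?E (insert z S)" by auto
  qed
  have fin: "finite (?E S)"
    by (rule finite_subset[of _ "Pow S"]) (use assms in auto)
  have "?E S \<inter> (\<lambda>x. {z, x}) ` {x \<in> S. r z x} = {}" using assms(4) by (auto simp: doubleton_eq_iff)
  moreover have "inj_on (\<lambda>x. {z, x}) {x \<in> S. r z x}" using assms(4) by (auto simp: inj_on_def doubleton_eq_iff)
  ultimately show ?thesis
    unfolding edges_in_def eq using fin assms(3)
    by (simp add: card_Un_disjoint card_image Int_def)
qed

lemma edges_in_empty: "edges_in r {} = 0"
  by (simp add: edges_in_def)

lemma kernel_commute: "kernel r T y z = kernel r T z y"
  unfolding kernel_def gram_def gram_K2_def gram_P3_def gram_K3_def
  by (simp add: algebra_simps conj_commute)

definition p3free_on :: "('a \<Rightarrow> 'a \<Rightarrow> bool) \<Rightarrow> 'a set \<Rightarrow> bool" where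
  "p3free_on r S \<longleftrightarrow> (\<forall>x\<in>S. \<forall>y\<in>S. \<forall>z\<in>S. x \<noteq> y \<and> y \<noteq> z \<and> x \<noteq> z \<longrightarrow> p3free (r x y) (r x z) (r y z))"

lemma p3free_on_empty: "p3free_on r {}"
  by (simp add: p3free_on_def)

lemma p3free_commute: "p3free a b c = p3free b a c" "p3free a b c = p3free a c b"
  by (auto simp: p3free_def)

lemma p3free_on_insert:
  assumes "symp r" "irreflp r" "z \<notin> S"
  shows "p3free_on r (insert z S) \<longleftrightarrow> p3free_on r S \<and> (\<forall>x\<in>S. \<forall>y\<in>S. x \<noteq> y \<longrightarrow> p3free (r z x) (r z y) (r x y))"
proof -
  have s: "r x y = r y x" for x y using assms(1) by (auto dest: sympD)
  show ?thesis
  proof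
    assume h: "p3free_on r (insert z S)"
    show "p3free_on r S \<and> (\<forall>x\<in>S. \<forall>y\<in>S. x \<noteq> y \<longrightarrow> p3free (r z x) (r z y) (r x y))"
    proof (intro conjI ballI impI)
      show "p3free_on r S" using h by (simp add: p3free_on_def)
      fix x y assume "x \<in> S" "y \<in> S" "x \<noteq> y"
      then show "p3free (r z x) (r z y) (r x y)"
        using assms(3) h[unfolded p3free_on_def, rule_format, of z x y] by auto
    qed
  next
    assume h: "p3free_on r S \<and> (\<forall>x\<in>S. \<forall>y\<in>S. x \<noteq> y \<longrightarrow> p3free (r z x) (r z y) (r x y))"
    show "p3free_on r (insert z S)"
      unfolding p3free_on_def
    proof (intro ballI impI)
      fix a b c assume m: "a \<in> insert z S" "b \<in> insert z S" "c \<in> insert z S" and n: "a \<noteq> b \<and> b \<noteq> c \<and> a \<noteq> c"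
      consider "a = z" "b \<in> S" "c \<in> S" | "b = z" "a \<in> S" "c \<in> S" | "c = z" "a \<in> S" "b \<in> S" | "a \<in> S" "b \<in> S" "c \<in> S"
        using m n by blast
      then show "p3free (r a b) (r a c) (r b c)"
      proof cases
        case 1 then show ?thesis using h n by simp
      next
        case 2
        then have "p3free (r z a) (r z c) (r a c)" using h n by blast
        then have "p3free (r a z) (r a c) (r z c)" unfolding p3free_def s[of a z] by blast
        then show ?thesis using 2 by simp
      next
        case 3
        then have "p3free (r z a) (r z b) (r a b)" using h n by blast
        then have "p3free (r a b) (r a z) (r b z)" unfolding p3free_def s[of a z] s[of b z] by blast
        then show ?thesis using 3 by simp
      next
        case 4 then show ?thesis using h n by (simp add: p3free_on_def)
      qed
    qed
  qed
qed

lemma p3free_onD: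
  assumes "irreflp r" "p3free_on r S" "x \<in> S" "y \<in> S" "z \<in> S" "r x y" "r y z" "x \<noteq> z"
  shows "r x z"
proof -
  have "x \<noteq> y" "y \<noteq> z" using assms(1,6,7) by (auto dest: irreflpD)
  then have "p3free (r x y) (r x z) (r y z)"
    using assms(2-5,8) unfolding p3free_on_def by blast
  then show ?thesis using assms(6,7) by (simp add: p3free_def)
qed

locale six =
  fixes r :: "'a \<Rightarrow> 'a \<Rightarrow> bool" and x0 x1 x2 x3 x4 x5 :: 'a
  assumes r: "symp r" "irreflp r" and d: "distinct [x0, x1, x2, x3, x4, x5]"
begin

lemma ne: "x0 \<noteq> x1" "x0 \<noteq> x2" "x0 \<noteq> x3" "x0 \<noteq> x4" "x0 \<noteq> x5" "x1 \<noteq> x2" "x1 \<noteq> x3" "x1 \<noteq> x4" "x1 \<noteq> x5"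
   "x2 \<noteq> x3" "x2 \<noteq> x4" "x2 \<noteq> x5" "x3 \<noteq> x4" "x3 \<noteq> x5" "x4 \<noteq> x5"
  using d by auto

lemma rs: "r x1 x0 = r x0 x1" "r x2 x0 = r x0 x2" "r x3 x0 = r x0 x3" "r x4 x0 = r x0 x4" "r x5 x0 = r x0 x5"
  "r x2 x1 = r x1 x2" "r x3 x1 = r x1 x3" "r x4 x1 = r x1 x4" "r x5 x1 = r x1 x5"
  "r x3 x2 = r x2 x3" "r x4 x2 = r x2 x4" "r x5 x2 = r x2 x5"
  "r x4 x3 = r x3 x4" "r x5 x3 = r x3 x5" "r x5 x4 = r x4 x5"
  "r x0 x0 = False" "r x1 x1 = False" "r x2 x2 = False" "r x3 x3 = False" "r x4 x4 = False" "r x5 x5 = False"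
  using r by (auto dest: sympD irreflpD)

lemma edges: "edges_in r {x0, x1, x2, x3, x4, x5} =
   of_bool (r x0 x1) + of_bool (r x0 x2) + of_bool (r x0 x3) + of_bool (r x0 x4) + of_bool (r x0 x5) +
   of_bool (r x1 x2) + of_bool (r x1 x3) + of_bool (r x1 x4) + of_bool (r x1 x5) +
   of_bool (r x2 x3) + of_bool (r x2 x4) + of_bool (r x2 x5) + of_bool (r x3 x4) + of_bool (r x3 x5) + of_bool (r x4 x5)"
  using ne by (simp add: edges_in_insert[OF r] edges_in_empty)

lemma ksum: "kernel_sum r {x0, x1, x2, x3, x4, x5} =
  kern6 (r x0 x1) (r x0 x2) (r x0 x3) (r x0 x4) (r x0 x5) (r x1 x2) (r x1 x3) (r x1 x4) (r x1 x5)
     (r x2 x3) (r x2 x4) (r x2 x5) (r x3 x4) (r x3 x5) (r x4 x5)"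
proof -
  let ?S = "{x0, x1, x2, x3, x4, x5}"
  have S: "?S - {x0, x1} = {x2, x3, x4, x5}" "?S - {x0, x2} = {x1, x3, x4, x5}" "?S - {x0, x3} = {x1, x2, x4, x5}"
    "?S - {x0, x4} = {x1, x2, x3, x5}" "?S - {x0, x5} = {x1, x2, x3, x4}" "?S - {x1, x2} = {x0, x3, x4, x5}"
    "?S - {x1, x3} = {x0, x2, x4, x5}" "?S - {x1, x4} = {x0, x2, x3, x5}" "?S - {x1, x5} = {x0, x2, x3, x4}"
    "?S - {x2, x3} = {x0, x1, x4, x5}" "?S - {x2, x4} = {x0, x1, x3, x5}" "?S - {x2, x5} = {x0, x1, x3, x4}"
    "?S - {x3, x4} = {x0, x1, x2, x5}" "?S - {x3, x5} = {x0, x1, x2, x4}" "?S - {x4, x5} = {x0, x1, x2, x3}"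
    using ne by auto
  have D: "?S - {x0} = {x1, x2, x3, x4, x5}" "?S - {x1} = {x0, x2, x3, x4, x5}" "?S - {x2} = {x0, x1, x3, x4, x5}"
    "?S - {x3} = {x0, x1, x2, x4, x5}" "?S - {x4} = {x0, x1, x2, x3, x5}" "?S - {x5} = {x0, x1, x2, x3, x4}"
    using ne by auto
  have C: "{x1, x0} = {x0, x1}" "{x2, x0} = {x0, x2}" "{x3, x0} = {x0, x3}" "{x4, x0} = {x0, x4}" "{x5, x0} = {x0, x5}"
    "{x2, x1} = {x1, x2}" "{x3, x1} = {x1, x3}" "{x4, x1} = {x1, x4}" "{x5, x1} = {x1, x5}"
    "{x3, x2} = {x2, x3}" "{x4, x2} = {x2, x4}" "{x5, x2} = {x2, x5}"
    "{x4, x3} = {x3, x4}" "{x5, x3} = {x3, x5}" "{x5, x4} = {x4, x5}"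
    by auto
  have sum6: "(\<Sum>y\<in>?S. f y) = f x0 + f x1 + f x2 + f x3 + f x4 + f x5" for f :: "'a \<Rightarrow> int"
    using ne by simp
  have sum5: "(\<Sum>y\<in>{a, b, c, d, e}. f y) = f a + f b + f c + f d + f e" if "distinct [a, b, c, d, e]"
    for f :: "'a \<Rightarrow> int" and a b c d e
    using that by simp
  have kc: "kernel r T x1 x0 = kernel r T x0 x1" "kernel r T x2 x0 = kernel r T x0 x2" "kernel r T x3 x0 = kernel r T x0 x3"
    "kernel r T x4 x0 = kernel r T x0 x4" "kernel r T x5 x0 = kernel r T x0 x5" "kernel r T x2 x1 = kernel r T x1 x2"
    "kernel r T x3 x1 = kernel r T x1 x3" "kernel r T x4 x1 = kernel r T x1 x4" "kernel r T x5 x1 = kernel r T x1 x5"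
    "kernel r T x3 x2 = kernel r T x2 x3" "kernel r T x4 x2 = kernel r T x2 x4" "kernel r T x5 x2 = kernel r T x2 x5"
    "kernel r T x4 x3 = kernel r T x3 x4" "kernel r T x5 x3 = kernel r T x3 x5" "kernel r T x5 x4 = kernel r T x4 x5" for T
    by (rule kernel_commute)+
  show ?thesis
    unfolding kernel_sum_def sum6 D
    using ne
    apply (simp only: sum5 distinct.simps list.set insert_iff empty_iff simp_thms ne ne[symmetric] C S kc)
    apply (simp only: kernel_eq_kern4[OF r] distinct.simps list.set insert_iff empty_iff simp_thms ne ne[symmetric] rs kern6_def)
    apply simp
    done
qed

lemma cluster:
  assumes "good6 (r x0 x1) (r x0 x2) (r x0 x3) (r x0 x4) (r x0 x5) (r x1 x2) (r x1 x3) (r x1 x4) (r x1 x5)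
     (r x2 x3) (r x2 x4) (r x2 x5) (r x3 x4) (r x3 x5) (r x4 x5)"
  shows "cluster3 r {x0, x1, x2, x3, x4, x5}"
proof -
  let ?S = "{x0, x1, x2, x3, x4, x5}"
  have "p3free_on r ?S"
    using assms ne ne[symmetric] unfolding good6_def
    by (simp add: p3free_on_insert[OF r] p3free_on_empty rs) (simp add: p3free_commute)
  then have "\<forall>x\<in>?S. \<forall>y\<in>?S. \<forall>z\<in>?S. r x y \<and> r y z \<and> x \<noteq> z \<longrightarrow> r x z"
    using p3free_onD[OF r(2)] by blast
  moreover have "\<exists>x\<in>W. \<exists>y\<in>W. r x y" if W: "W \<subseteq> ?S" "card W = 4" for W
  proof (rule ccontr)
    assume "\<not> ?thesis"
    then have nr: "\<not> r a b" if "a \<in> W" "b \<in> W" for a b using that by blast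
    have cS: "card ?S = 6" using ne by simp
    have "card (?S - W) = 2" using W cS by (simp add: card_Diff_subset finite_subset)
    then obtain u v where uv: "?S - W = {u, v}" "u \<noteq> v" by (auto simp: card_2_iff)
    then have mem: "a \<in> W" if "a \<in> ?S" "a \<noteq> u" "a \<noteq> v" for a
      using that by auto
    have "u \<in> ?S" "v \<in> ?S" using uv by auto
    then show False
      using assms uv(2) unfolding good6_def
      by (elim insertE emptyE; simp add: nr mem ne ne[symmetric])
  qed
  ultimately show ?thesis unfolding cluster3_def by blast
qed

end

lemma sorted5_imp_ok5:
  "sorted5 b12 b13 b14 b15 b23 b24 b25 b34 b35 b45 \<Longrightarrow> ok5 b12 b13 b14 b15 b23 b24 b25 b34 b35 b45"
  using ok5_TTTT ok5_TTTF ok5_TTFT ok5_TTFF ok5_TFTT ok5_TFTF ok5_TFFT ok5_TFFF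
    ok5_FTTT ok5_FTTF ok5_FTFT ok5_FTFF ok5_FFTT ok5_FFTF ok5_FFFT ok5_FFFF
  by (cases b12; cases b13; cases b14; cases b15) simp_all

text \<open>Sorting the vertices of \<open>S\<close> as required reduces the inequality to the finite check.\<close>

lemma certificate:
  assumes r: "symp r" "irreflp r" and S: "card S = 6"
  shows "(if edges_in r S = 4 then 97200 else 0) + kernel_sum r S + (if cluster3 r S then 0 else 1) \<le> 48000"
proof -
  have fin: "finite S" and ne: "S \<noteq> {}" using S by (auto intro: card_ge_0_finite)
  obtain z where z: "z \<in> S" "\<forall>x\<in>S. tdeg r S z \<le> tdeg r S x"
    using ex_min_if_finite[of "tdeg r S ` S"] fin ne
    by (metis (no_types, lifting) arg_min_if_finite(1) arg_min_least)
  obtain l where l: "set l = S - {z}" "distinct l"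
    using finite_distinct_list[of "S - {z}"] fin by auto
  define xs where "xs = sort_key (tdeg r (S - {z})) l"
  have xs: "set xs = S - {z}" "distinct xs" "sorted (map (tdeg r (S - {z})) xs)"
    using l by (simp_all add: xs_def)
  have "card (S - {z}) = 5" using S z(1) fin by simp
  then have "length xs = 5" using xs(1) distinct_card[OF xs(2)] by simp
  then obtain x1 x2 x3 x4 x5 where xs5: "xs = [x1, x2, x3, x4, x5]"
    by (auto simp: eval_nat_numeral length_Suc_conv)
  have d: "distinct [z, x1, x2, x3, x4, x5]" using xs(1,2) xs5 by auto
  interpret six r z x1 x2 x3 x4 x5 using r d by unfold_locales
  have S5: "S - {z} = {x1, x2, x3, x4, x5}" using xs(1) xs5 by simp
  then have Seq: "S = {z, x1, x2, x3, x4, x5}" using z(1) by auto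
  have deg: "tdeg r A v = (\<Sum>u\<in>A. of_bool (r v u))" if "finite A" for A v
    unfolding tdeg_def by (rule card_filter_eq_sum[OF that])
  have d5: "tdeg r {x1, x2, x3, x4, x5} x1 = of_bool (r x1 x2) + of_bool (r x1 x3) + of_bool (r x1 x4) + of_bool (r x1 x5)"
    "tdeg r {x1, x2, x3, x4, x5} x2 = of_bool (r x1 x2) + of_bool (r x2 x3) + of_bool (r x2 x4) + of_bool (r x2 x5)"
    "tdeg r {x1, x2, x3, x4, x5} x3 = of_bool (r x1 x3) + of_bool (r x2 x3) + of_bool (r x3 x4) + of_bool (r x3 x5)"
    "tdeg r {x1, x2, x3, x4, x5} x4 = of_bool (r x1 x4) + of_bool (r x2 x4) + of_bool (r x3 x4) + of_bool (r x4 x5)"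
    "tdeg r {x1, x2, x3, x4, x5} x5 = of_bool (r x1 x5) + of_bool (r x2 x5) + of_bool (r x3 x5) + of_bool (r x4 x5)"
    using ne by (simp_all add: deg rs add_ac del: sum_of_bool_eq)
  have d6: "tdeg r {z, x1, x2, x3, x4, x5} z = of_bool (r z x1) + of_bool (r z x2) + of_bool (r z x3) + of_bool (r z x4) + of_bool (r z x5)"
    "tdeg r {z, x1, x2, x3, x4, x5} x1 = of_bool (r z x1) + of_bool (r x1 x2) + of_bool (r x1 x3) + of_bool (r x1 x4) + of_bool (r x1 x5)"
    "tdeg r {z, x1, x2, x3, x4, x5} x2 = of_bool (r z x2) + of_bool (r x1 x2) + of_bool (r x2 x3) + of_bool (r x2 x4) + of_bool (r x2 x5)"
    "tdeg r {z, x1, x2, x3, x4, x5} x3 = of_bool (r z x3) + of_bool (r x1 x3) + of_bool (r x2 x3) + of_bool (r x3 x4) + of_bool (r x3 x5)"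
    "tdeg r {z, x1, x2, x3, x4, x5} x4 = of_bool (r z x4) + of_bool (r x1 x4) + of_bool (r x2 x4) + of_bool (r x3 x4) + of_bool (r x4 x5)"
    "tdeg r {z, x1, x2, x3, x4, x5} x5 = of_bool (r z x5) + of_bool (r x1 x5) + of_bool (r x2 x5) + of_bool (r x3 x5) + of_bool (r x4 x5)"
    using ne by (simp_all add: deg rs add_ac del: sum_of_bool_eq)
  have "sorted5 (r x1 x2) (r x1 x3) (r x1 x4) (r x1 x5) (r x2 x3) (r x2 x4) (r x2 x5) (r x3 x4) (r x3 x5) (r x4 x5)"
    using xs(3) unfolding xs5 S5 sorted5_def by (simp only: list.map sorted_simps list.set ball_simps d5; blast?)
  then have "ok5 (r x1 x2) (r x1 x3) (r x1 x4) (r x1 x5) (r x2 x3) (r x2 x4) (r x2 x5) (r x3 x4) (r x3 x5) (r x4 x5)"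
    by (rule sorted5_imp_ok5)
  moreover have "min6 (r z x1) (r z x2) (r z x3) (r z x4) (r z x5)
      (r x1 x2) (r x1 x3) (r x1 x4) (r x1 x5) (r x2 x3) (r x2 x4) (r x2 x5) (r x3 x4) (r x3 x5) (r x4 x5)"
    using z(2) unfolding Seq min6_def by (simp only: ball_simps d6; blast?)
  ultimately have ok: "ok6 (r z x1) (r z x2) (r z x3) (r z x4) (r z x5)
      (r x1 x2) (r x1 x3) (r x1 x4) (r x1 x5) (r x2 x3) (r x2 x4) (r x2 x5) (r x3 x4) (r x3 x5) (r x4 x5)"
    unfolding ok5_def by blast
  have "(if cluster3 r S then 0 else 1) \<le> (if good6 (r z x1) (r z x2) (r z x3) (r z x4) (r z x5)
      (r x1 x2) (r x1 x3) (r x1 x4) (r x1 x5) (r x2 x3) (r x2 x4) (r x2 x5) (r x3 x4) (r x3 x5) (r x4 x5) then 0 else 1 :: int)"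
    using cluster unfolding Seq by simp
  from order_trans[OF add_left_mono[OF this] ok[unfolded ok6_def]]
  show ?thesis unfolding Seq edges ksum .
qed

section \<open>Positive semidefiniteness of the kernels\<close>

definition psd :: "('a \<Rightarrow> 'a \<Rightarrow> real) \<Rightarrow> bool" where
  "psd k \<longleftrightarrow> (\<forall>U \<rho>. finite U \<longrightarrow> 0 \<le> (\<Sum>y\<in>U. \<Sum>z\<in>U. \<rho> y * \<rho> z * k y z))"

lemma psd_square: "psd (\<lambda>y z. g y * g z)"
  unfolding psd_def
proof (intro allI impI)
  fix U :: "'a set" and \<rho> :: "'a \<Rightarrow> real"
  have "(\<Sum>y\<in>U. \<Sum>z\<in>U. \<rho> y * \<rho> z * (g y * g z)) = (\<Sum>y\<in>U. \<rho> y * g y) * (\<Sum>y\<in>U. \<rho> y * g y)"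
    by (simp add: sum_product mult_ac)
  then show "0 \<le> (\<Sum>y\<in>U. \<Sum>z\<in>U. \<rho> y * \<rho> z * (g y * g z))" by simp
qed

lemma psd_zero: "psd (\<lambda>y z. 0)"
  by (simp add: psd_def)

lemma psd_add: "psd k \<Longrightarrow> psd l \<Longrightarrow> psd (\<lambda>y z. k y z + l y z)"
  by (simp add: psd_def sum.distrib ring_distribs)

lemma psd_scale: "psd k \<Longrightarrow> 0 \<le> c \<Longrightarrow> psd (\<lambda>y z. c * k y z)"
proof -
  assume k: "psd k" and c: "0 \<le> c"
  have "(\<Sum>y\<in>U. \<Sum>z\<in>U. \<rho> y * \<rho> z * (c * k y z)) = c * (\<Sum>y\<in>U. \<Sum>z\<in>U. \<rho> y * \<rho> z * k y z)" for U \<rho>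
    by (simp add: sum_distrib_left mult_ac)
  then show ?thesis using k c by (simp add: psd_def)
qed

lemma psd_scaled_square: "0 \<le> c \<Longrightarrow> psd (\<lambda>y z. c * (g y * g z))"
  by (rule psd_scale[OF psd_square])

lemma psd_restrict:
  assumes "psd k"
  shows "psd (\<lambda>y z. if P y \<and> P z then k y z else 0)"
  unfolding psd_def
proof (intro allI impI)
  fix U :: "'a set" and \<rho> :: "'a \<Rightarrow> real" assume "finite U"
  then have "0 \<le> (\<Sum>y\<in>U. \<Sum>z\<in>U. (if P y then \<rho> y else 0) * (if P z then \<rho> z else 0) * k y z)"
    by (rule assms[unfolded psd_def, rule_format])
  also have "\<dots> = (\<Sum>y\<in>U. \<Sum>z\<in>U. \<rho> y * \<rho> z * (if P y \<and> P z then k y z else 0))"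
    by (intro sum.cong refl) simp
  finally show "0 \<le> (\<Sum>y\<in>U. \<Sum>z\<in>U. \<rho> y * \<rho> z * (if P y \<and> P z then k y z else 0))" .
qed

text \<open>One step of an \<open>LDL\<close> decomposition: a form whose multiple is a square plus a positive multiple of a
  semidefinite form is semidefinite. It is stated with integer multipliers to avoid fractions.\<close>

lemma psd_complete_square:
  assumes "psd l" "c > 0" "q > 0" "\<And>y z. c * k y z = g y * g z + q * l y z"
  shows "psd k"
proof -
  have "psd (\<lambda>y z. 1 / c * (g y * g z + q * l y z))"
    using assms(2,3) by (intro psd_scale psd_add psd_square psd_scale[OF assms(1)]) simp_all
  also have "(\<lambda>y z. 1 / c * (g y * g z + q * l y z)) = k"
    using assms(2) by (intro ext) (simp add: assms(4)[symmetric])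
  finally show ?thesis .
qed

lemma psd_gram_K2:
  fixes a b c d e :: "'a \<Rightarrow> real"
  shows "psd (\<lambda>y z.
     a y * (8380 * a z - 3914 * b z - 11071 * c z + 1262 * d z - 27 * e z)
   + b y * (- 3914 * a z + 3321 * b z + 6727 * c z - 2550 * d z - 761 * e z)
   + c y * (- 11071 * a z + 6727 * b z + 22929 * c z - 2877 * d z - 3057 * e z)
   + d y * (1262 * a z - 2550 * b z - 2877 * c z + 2900 * d z + 728 * e z)
   + e y * (- 27 * a z - 761 * b z - 3057 * c z + 728 * d z + 1191 * e z))" (is "psd ?k")
proof -
  define g1 where "g1 y = - 27 * a y - 761 * b y - 3057 * c y + 728 * d y + 1191 * e y" for y
  define g2 where "g2 y = - 4682121 * a y + 3376190 * b y + 5685480 * c y - 2483042 * d y" for y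
  define g3 where "g3 y = - 15260723120 * a y + 23780402700 * c y + 8448735770 * d y" for y
  define g4 where "g4 y = 63719147911 * a y - 16298915410 * d y" for y
  define k1 where "k1 y z = a y * (9979851 * a z - 4682121 * b z - 13268100 * c z + 1522698 * d z) + b y * (- 4682121 * a z + 3376190 * b z + 5685480 * c z - 2483042 * d z) + c y * (- 13268100 * a z + 5685480 * b z + 17963190 * c z - 1201011 * d z) + d y * (1522698 * a z - 2483042 * b z - 1201011 * c z + 2923916 * d z)" for y z
  define k2 where "k2 y z = a y * (9883808639 * a z - 15260723120 * c z - 5444991882 * d z) + c y * (- 15260723120 * a z + 23780402700 * c z + 8448735770 * d z) + d y * (- 5444991882 * a z + 8448735770 * c z + 3111837436 * d z)" for y z
  define k3 where "k3 y z = a y * (63719147911 * a z - 16298915410 * d z) + d y * (- 16298915410 * a z + 77590753297 * d z)" for y z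
  define k4 where "k4 y z = d y * (1 * d z)" for y z
  have "psd k4" unfolding k4_def using psd_scaled_square[of 1 d] by (simp add: mult_ac)
  then have "psd k3"
    by (rule psd_complete_square[where c = 63719147911 and q = 4678362042315118444467 and g = g4]) (simp_all add: k3_def g4_def k4_def algebra_simps)
  then have "psd k2"
    by (rule psd_complete_square[where c = 23780402700 and q = 33761900 and g = g3]) (simp_all add: k2_def g3_def k3_def algebra_simps)
  then have "psd k1"
    by (rule psd_complete_square[where c = 3376190 and q = 1191 and g = g2]) (simp_all add: k1_def g2_def k2_def algebra_simps)
  then have "psd ?k"
    by (rule psd_complete_square[where c = 1191 and q = 1 and g = g1]) (simp_all add: g1_def k1_def algebra_simps)
  then show ?thesis .
qed

lemma psd_gram_2:
  fixes f g :: "'a \<Rightarrow> real"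
  assumes "\<alpha> > 0" "\<beta> ^ 2 \<le> \<alpha> * \<gamma>"
  shows "psd (\<lambda>y z. f y * (\<alpha> * f z + \<beta> * g z) + g y * (\<beta> * f z + \<gamma> * g z))" (is "psd ?k")
proof -
  define h where "h y = \<alpha> * f y + \<beta> * g y" for y
  have eq: "?k = (\<lambda>y z. 1 / \<alpha> * (h y * h z) + (\<gamma> - \<beta> ^ 2 / \<alpha>) * (g y * g z))"
    using assms(1) by (intro ext) (simp add: h_def field_simps power2_eq_square)
  show ?thesis
    unfolding eq using assms by (intro psd_add psd_scaled_square) (simp_all add: field_simps)
qed

text \<open>The kernel is the square of the difference of the adjacencies to the two elements of \<open>I\<close>.\<close>

lemma psd_balance:
  assumes "card I = 2"
  shows "psd (\<lambda>y z. 2 * real (card {v \<in> I. r y v \<and> r z v}) - real (card {v \<in> I. r y v}) * real (card {v \<in> I. r z v}))"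
    (is "psd ?k")
proof -
  obtain u v where I: "I = {u, v}" "u \<noteq> v" using assms by (auto simp: card_2_iff)
  have "card {w \<in> I. P w} = of_bool (P u) + of_bool (P v)" for P
  proof -
    have "card {w \<in> I. P w} = (\<Sum>w\<in>I. of_bool (P w))"
      by (rule card_filter_eq_sum) (simp add: I)
    then show ?thesis using I by simp
  qed
  then have "?k = (\<lambda>y z. (of_bool (r y u) - of_bool (r y v)) * (of_bool (r z u) - of_bool (r z v)))"
    by (intro ext) (auto simp: of_bool_def)
  then show ?thesis by (simp add: psd_square)
qed

lemma psd_kernel:
  "psd (\<lambda>y z. real_of_int (kernel r T y z))"
proof -
  let ?n = "num_deg r T" and ?p = "nbr_deg r T"
  let ?m = "\<lambda>y z. card {v \<in> T. tdeg r T v = 0 \<and> r y v \<and> r z v}"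
  consider "?n 0 = 4" | "?n 0 = 2" | "?n 0 = 1" "?n 2 = 1" | "?n 0 = 1" "?n 2 = 3"
    | "?n 0 \<noteq> 4" "?n 0 \<noteq> 2" "\<not> (?n 0 = 1 \<and> ?n 2 = 1)" "\<not> (?n 0 = 1 \<and> ?n 2 = 3)" by blast
  then show ?thesis
  proof cases
    case 1
    have "psd (\<lambda>y z. 397 * (real_of_int (form_E4 (?p y 0)) * real_of_int (form_E4 (?p z 0))))"
      by (rule psd_scaled_square) simp
    then show ?thesis using 1 by (simp add: kernel_def gram_def mult.assoc)
  next
    case 2
    let ?I = "{v \<in> T. tdeg r T v = 0}"
    have cI: "card ?I = 2" using 2 by (simp add: num_deg_def)
    have eq: "{v \<in> T. tdeg r T v = 0 \<and> P v} = {v \<in> ?I. P v}" for P by auto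
    have b: "psd (\<lambda>y z. 2 * real (?m y z) - real (?p y 0) * real (?p z 0))"
      using psd_balance[OF cI, of r] unfolding nbr_deg_def eq .
    have "psd (\<lambda>y z. real_of_int (gram_K2 (?p y 0, ?p y 1) (?p z 0, ?p z 1)))"
      unfolding gram_K2_def using psd_gram_K2[of "\<lambda>y. real_of_int (form_K2_1 (?p y 0, ?p y 1))"
        "\<lambda>y. real_of_int (form_K2_2 (?p y 0, ?p y 1))" "\<lambda>y. real_of_int (form_K2_3 (?p y 0, ?p y 1))"
        "\<lambda>y. real_of_int (form_K2_4 (?p y 0, ?p y 1))" "\<lambda>y. real_of_int (form_K2_5 (?p y 0, ?p y 1))"]
      by simp
    moreover have "psd (\<lambda>y z. if ?p y 1 = 0 \<and> ?p z 1 = 0 then 900 * (2 * real (?m y z) - real (?p y 0) * real (?p z 0)) else 0)"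
      using psd_scale[OF psd_restrict[OF b, of "\<lambda>y. ?p y 1 = 0"], of 900]
      by (simp add: if_distrib cong: if_cong)
    ultimately have "psd (\<lambda>y z. real_of_int (gram_K2 (?p y 0, ?p y 1) (?p z 0, ?p z 1))
       + (if ?p y 1 = 0 \<and> ?p z 1 = 0 then 900 * (2 * real (?m y z) - real (?p y 0) * real (?p z 0)) else 0))"
      by (rule psd_add)
    also have "(\<lambda>y z. real_of_int (gram_K2 (?p y 0, ?p y 1) (?p z 0, ?p z 1))
       + (if ?p y 1 = 0 \<and> ?p z 1 = 0 then 900 * (2 * real (?m y z) - real (?p y 0) * real (?p z 0)) else 0))
      = (\<lambda>y z. real_of_int (kernel r T y z))"
      using 2 by (intro ext) (simp add: kernel_def gram_def)
    finally show ?thesis .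
  next
    case 3
    have "psd (\<lambda>y z. real_of_int (gram_P3 (?p y 0, ?p y 1, ?p y 2) (?p z 0, ?p z 1, ?p z 2)))"
      unfolding gram_P3_def using psd_gram_2[of 145 28 68 "\<lambda>y. real_of_int (form_P3_1 (?p y 0, ?p y 1, ?p y 2))"
        "\<lambda>y. real_of_int (form_P3_2 (?p y 0, ?p y 1, ?p y 2))"] by simp
    then show ?thesis using 3 by (simp add: kernel_def gram_def)
  next
    case 4
    have "psd (\<lambda>y z. real_of_int (gram_K3 (?p y 0, ?p y 2) (?p z 0, ?p z 2)))"
      unfolding gram_K3_def using psd_gram_2[of 2800 2950 4000 "\<lambda>y. real_of_int (form_K3_1 (?p y 0, ?p y 2))"
        "\<lambda>y. real_of_int (form_K3_2 (?p y 0, ?p y 2))"] by simp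
    then show ?thesis using 4 by (simp add: kernel_def gram_def)
  next
    case 5
    have "psd (\<lambda>y z. 4324 * (real_of_int (form_K13 (?p y 1, ?p y 3)) * real_of_int (form_K13 (?p z 1, ?p z 3))))"
      "psd (\<lambda>y z. 400 * (real_of_int (form_K4 (?p y 3)) * real_of_int (form_K4 (?p z 3))))"
      by (rule psd_scaled_square; simp)+
    moreover have "kernel r T = (\<lambda>y z.
        if ?n 1 = 3 \<and> ?n 3 = 1 then 4324 * form_K13 (?p y 1, ?p y 3) * form_K13 (?p z 1, ?p z 3)
        else if ?n 3 = 4 then 400 * form_K4 (?p y 3) * form_K4 (?p z 3) else 0)"
      unfolding kernel_def gram_def by (intro ext) (simp only: 5 if_False)
    ultimately show ?thesis using psd_zero
      by (cases "?n 1 = 3 \<and> ?n 3 = 1"; cases "?n 3 = 4")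
        (simp_all only: simp_thms if_True if_False of_int_mult of_int_numeral of_int_0 mult.assoc)
  qed
qed

lemma kernel_bounded:
  obtains M :: real where "M > 0"
    "\<And>(r :: 'a \<Rightarrow> 'a \<Rightarrow> bool) T y z. symp r \<Longrightarrow> irreflp r \<Longrightarrow> card T = 4 \<Longrightarrow> \<bar>real_of_int (kernel r T y z)\<bar> \<le> M"
proof -
  define K where "K = range (\<lambda>((a, b, c, d, e, f), (y1, y2, y3, y4), (z1, z2, z3, z4)).
     \<bar>real_of_int (kern4 a b c d e f y1 y2 y3 y4 z1 z2 z3 z4)\<bar>)"
  have finK: "finite K" unfolding K_def by simp
  have "\<bar>real_of_int (kernel r T y z)\<bar> \<le> Max (insert 1 K)" if "symp r" "irreflp r" "card T = 4"
    for r :: "'a \<Rightarrow> 'a \<Rightarrow> bool" and T y z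
  proof -
    have "finite T" using that(3) card.infinite by fastforce
    then obtain l where l: "set l = T" "distinct l" using finite_distinct_list by blast
    then have "length l = 4" using that(3) distinct_card by fastforce
    then obtain a b c d where "l = [a, b, c, d]" by (auto simp: eval_nat_numeral length_Suc_conv)
    then have T: "T = {a, b, c, d}" and d: "distinct [a, b, c, d]" using l by auto
    have "\<bar>real_of_int (kernel r T y z)\<bar> \<in> K"
      unfolding T kernel_eq_kern4[OF that(1,2) d] K_def
      by (rule range_eqI[of _ _ "((_, _, _, _, _, _), (_, _, _, _), (_, _, _, _))"]) simp
    then show ?thesis using finK by simp
  qed
  moreover have "Max (insert 1 K) > 0" using finK by (meson Max_ge finite_insert insertI1 less_le_trans zero_less_one)
  ultimately show ?thesis using that by blast
qed

section \<open>Summing the certificate\<close>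

definition ksub :: "nat \<Rightarrow> 'a set \<Rightarrow> 'a set set" where
  "ksub k V = {S. S \<subseteq> V \<and> card S = k}"

lemma finite_ksub: "finite V \<Longrightarrow> finite (ksub k V)"
  unfolding ksub_def by (rule finite_subset[of _ "Pow V"]) auto

lemma card_ksub: "finite V \<Longrightarrow> card (ksub k V) = card V choose k"
  unfolding ksub_def by (rule n_subsets)

lemma card_ksub_superset:
  assumes "finite V" "P \<subseteq> V" "card P \<le> k"
  shows "card {S \<in> ksub k V. P \<subseteq> S} = (card V - card P) choose (k - card P)"
proof -
  have fP: "finite P" using assms finite_subset by blast
  have "bij_betw (\<lambda>S. S - P) {S \<in> ksub k V. P \<subseteq> S} (ksub (k - card P) (V - P))"
  proof (rule bij_betw_byWitness[of _ "\<lambda>S. S \<union> P"])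
    show "\<forall>S\<in>{S \<in> ksub k V. P \<subseteq> S}. S - P \<union> P = S" by auto
    show "\<forall>S\<in>ksub (k - card P) (V - P). S \<union> P - P = S" by (auto simp: ksub_def)
    show "(\<lambda>S. S - P) ` {S \<in> ksub k V. P \<subseteq> S} \<subseteq> ksub (k - card P) (V - P)"
      using fP by (auto simp: ksub_def card_Diff_subset)
    show "(\<lambda>S. S \<union> P) ` ksub (k - card P) (V - P) \<subseteq> {S \<in> ksub k V. P \<subseteq> S}"
    proof
      fix S assume "S \<in> (\<lambda>S. S \<union> P) ` ksub (k - card P) (V - P)"
      then obtain R where R: "S = R \<union> P" "R \<subseteq> V - P" "card R = k - card P" by (auto simp: ksub_def)
      have "finite R" using R(2) assms(1) finite_subset by blast
      moreover have "R \<inter> P = {}" using R(2) by auto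
      ultimately have "card S = k" using R fP assms(3) by (simp add: card_Un_disjoint)
      then show "S \<in> {S \<in> ksub k V. P \<subseteq> S}" using R assms(2) by (auto simp: ksub_def)
    qed
  qed
  then have "card {S \<in> ksub k V. P \<subseteq> S} = card (ksub (k - card P) (V - P))" by (rule bij_betw_same_card)
  then show ?thesis using assms fP by (simp add: card_ksub card_Diff_subset)
qed

lemma binomial_le_power: "(n choose k) \<le> n ^ k"
  by (cases "k \<le> n") (simp_all add: binomial_le_pow binomial_eq_0)

lemma binomial_le_power_real: "real (n choose k) \<le> real n ^ k"
  using of_nat_mono[OF binomial_le_power[of n k], where 'a = real] by simp

text \<open>Choosing a 6-set and an ordered pair in it amounts to choosing the remaining 4-set first.\<close>

lemma sum_ksub_pairs:
  fixes f :: "'a set \<Rightarrow> 'a \<Rightarrow> 'a \<Rightarrow> real"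
  assumes "finite V"
  shows "(\<Sum>S\<in>ksub (k + 2) V. \<Sum>y\<in>S. \<Sum>z\<in>S - {y}. f (S - {y, z}) y z) =
    (\<Sum>T\<in>ksub k V. \<Sum>y\<in>V - T. \<Sum>z\<in>V - T - {y}. f T y z)"
proof -
  let ?A = "Sigma (ksub (k + 2) V) (\<lambda>S. Sigma S (\<lambda>y. S - {y}))"
  let ?B = "Sigma (ksub k V) (\<lambda>T. Sigma (V - T) (\<lambda>y. V - T - {y}))"
  have fin: "finite S" if "S \<in> ksub j V" for S j using that assms finite_subset by (auto simp: ksub_def)
  have "(\<Sum>S\<in>ksub (k + 2) V. \<Sum>y\<in>S. \<Sum>z\<in>S - {y}. f (S - {y, z}) y z) = (\<Sum>(S, y, z)\<in>?A. f (S - {y, z}) y z)"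
    using assms fin by (simp add: sum.Sigma finite_ksub split_def)
  also have "\<dots> = (\<Sum>(T, y, z)\<in>?B. f T y z)"
  proof (rule sum.reindex_bij_witness[of _ "\<lambda>(T, y, z). (insert y (insert z T), y, z)" "\<lambda>(S, y, z). (S - {y, z}, y, z)"])
    fix a assume "a \<in> ?A"
    then obtain S y z where a: "a = (S, y, z)" "S \<in> ksub (k + 2) V" "y \<in> S" "z \<in> S" "z \<noteq> y" by auto
    then show "(case case a of (S, y, z) \<Rightarrow> (S - {y, z}, y, z) of (T, y, z) \<Rightarrow> (insert y (insert z T), y, z)) = a" by auto
    have "card (S - {y, z}) = k" using a fin[OF a(2)] by (auto simp: ksub_def card_Diff_subset)
    then show "(case a of (S, y, z) \<Rightarrow> (S - {y, z}, y, z)) \<in> ?B" using a by (auto simp: ksub_def)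
    show "(case case a of (S, y, z) \<Rightarrow> (S - {y, z}, y, z) of (T, y, z) \<Rightarrow> f T y z) = (case a of (S, y, z) \<Rightarrow> f (S - {y, z}) y z)"
      using a by simp
  next
    fix b assume "b \<in> ?B"
    then obtain T y z where b: "b = (T, y, z)" "T \<in> ksub k V" "y \<in> V" "z \<in> V" "y \<notin> T" "z \<notin> T" "z \<noteq> y" by auto
    then show "(case case b of (T, y, z) \<Rightarrow> (insert y (insert z T), y, z) of (S, y, z) \<Rightarrow> (S - {y, z}, y, z)) = b" by auto
    have "card (insert y (insert z T)) = k + 2" using b fin[OF b(2)] by (auto simp: ksub_def)
    then show "(case b of (T, y, z) \<Rightarrow> (insert y (insert z T), y, z)) \<in> ?A" using b by (auto simp: ksub_def)
  qed
  also have "\<dots> = (\<Sum>T\<in>ksub k V. \<Sum>y\<in>V - T. \<Sum>z\<in>V - T - {y}. f T y z)"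
    using assms by (simp add: sum.Sigma finite_ksub split_def)
  finally show ?thesis .
qed

definition num4 :: "('a \<Rightarrow> 'a \<Rightarrow> bool) \<Rightarrow> 'a set \<Rightarrow> nat" where
  "num4 r V = card {S \<in> ksub 6 V. edges_in r S = 4}"
definition num4_at :: "('a \<Rightarrow> 'a \<Rightarrow> bool) \<Rightarrow> 'a set \<Rightarrow> 'a \<Rightarrow> nat" where
  "num4_at r V x = card {S \<in> ksub 6 V. x \<in> S \<and> edges_in r S = 4}"
definition bad6 :: "('a \<Rightarrow> 'a \<Rightarrow> bool) \<Rightarrow> 'a set \<Rightarrow> nat" where
  "bad6 r V = card {S \<in> ksub 6 V. \<not> cluster3 r S}"
definition bad6_at :: "('a \<Rightarrow> 'a \<Rightarrow> bool) \<Rightarrow> 'a set \<Rightarrow> 'a \<Rightarrow> nat" where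
  "bad6_at r V x = card {S \<in> ksub 6 V. x \<in> S \<and> \<not> cluster3 r S}"
definition square_sum :: "('a \<Rightarrow> 'a \<Rightarrow> bool) \<Rightarrow> 'a set \<Rightarrow> real" where
  "square_sum r V = (\<Sum>T\<in>ksub 4 V. \<Sum>y\<in>V - T. \<Sum>z\<in>V - T. real_of_int (kernel r T y z))"

lemma psdD_one: "psd k \<Longrightarrow> finite U \<Longrightarrow> 0 \<le> (\<Sum>y\<in>U. \<Sum>z\<in>U. k y z)"
  unfolding psd_def by (drule spec[of _ U], drule spec[of _ "\<lambda>_. 1"]) simp

text \<open>Testing semidefiniteness with the weight 1 everywhere and an additional weight \<open>t\<close> at \<open>x\<close> bounds a row sum
  of the form from below by its total.\<close>

lemma psd_cross:
  assumes k: "psd k" and sym: "\<And>y z. k y z = k z y" and U: "finite U" "x \<in> U" and t: "t > 0"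
  shows "2 * (\<Sum>z\<in>U. k x z) \<ge> - (\<Sum>y\<in>U. \<Sum>z\<in>U. k y z) / t - t * k x x"
proof -
  define d where "d y = (if y = x then t else 0)" for y
  have d1: "(\<Sum>y\<in>U. d y * h y) = t * h x" for h :: "'a \<Rightarrow> real"
  proof -
    have "(\<Sum>y\<in>U. d y * h y) = (\<Sum>y\<in>U. if y = x then t * h y else 0)"
      by (intro sum.cong) (auto simp: d_def)
    then show ?thesis using U by simp
  qed
  have "0 \<le> (\<Sum>y\<in>U. \<Sum>z\<in>U. (1 + d y) * (1 + d z) * k y z)"
    by (rule k[unfolded psd_def, rule_format, OF U(1)])
  also have "\<dots> = (\<Sum>y\<in>U. \<Sum>z\<in>U. k y z) + (\<Sum>y\<in>U. d y * (\<Sum>z\<in>U. k y z))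
     + (\<Sum>y\<in>U. \<Sum>z\<in>U. d z * k y z) + (\<Sum>y\<in>U. d y * (\<Sum>z\<in>U. d z * k y z))"
    by (simp add: algebra_simps sum.distrib sum_distrib_left)
  also have "(\<Sum>y\<in>U. \<Sum>z\<in>U. d z * k y z) = t * (\<Sum>z\<in>U. k x z)"
    unfolding d1 by (simp add: sum_distrib_left sym[of _ x])
  also have "(\<Sum>y\<in>U. d y * (\<Sum>z\<in>U. k y z)) = t * (\<Sum>z\<in>U. k x z)"
    unfolding d1 by simp
  also have "(\<Sum>y\<in>U. d y * (\<Sum>z\<in>U. d z * k y z)) = t * (t * k x x)"
    unfolding d1 by simp
  finally have "0 \<le> (\<Sum>y\<in>U. \<Sum>z\<in>U. k y z) + t * (2 * (\<Sum>z\<in>U. k x z) + t * k x x)"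
    by (simp add: algebra_simps)
  then have "0 \<le> ((\<Sum>y\<in>U. \<Sum>z\<in>U. k y z) + t * (2 * (\<Sum>z\<in>U. k x z) + t * k x x)) / t"
    using t by simp
  also have "\<dots> = (\<Sum>y\<in>U. \<Sum>z\<in>U. k y z) / t + (2 * (\<Sum>z\<in>U. k x z) + t * k x x)"
    using t by (simp add: add_divide_distrib)
  finally show ?thesis by simp
qed

lemma square_sum_nonneg: "finite V \<Longrightarrow> square_sum r V \<ge> 0"
  unfolding square_sum_def by (intro sum_nonneg psdD_one psd_kernel) auto

context
  fixes r :: "'a \<Rightarrow> 'a \<Rightarrow> bool" and V :: "'a set" and M :: real
  assumes r: "symp r" "irreflp r" and V: "finite V"
    and M: "M > 0" "\<And>T y z. card T = 4 \<Longrightarrow> \<bar>real_of_int (kernel r T y z)\<bar> \<le> M"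
begin

abbreviation (input) rk :: "'a set \<Rightarrow> 'a \<Rightarrow> 'a \<Rightarrow> real" where "rk T y z \<equiv> real_of_int (kernel r T y z)"

lemma cert_real:
  assumes "S \<in> ksub 6 V"
  shows "97200 * of_bool (edges_in r S = 4) + (\<Sum>y\<in>S. \<Sum>z\<in>S - {y}. rk (S - {y, z}) y z) + of_bool (\<not> cluster3 r S) \<le> 48000"
proof -
  have "card S = 6" using assms by (simp add: ksub_def)
  from certificate[OF r this]
  have "real_of_int ((if edges_in r S = 4 then 97200 else 0) + kernel_sum r S + (if cluster3 r S then 0 else 1)) \<le> real_of_int 48000"
    by (simp only: of_int_le_iff)
  then show ?thesis by (simp add: kernel_sum_def split: if_splits)
qed

lemma sum_cert:
  assumes "\<And>S. P S \<Longrightarrow> S \<in> ksub 6 V"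
  shows "97200 * real (card {S. P S \<and> edges_in r S = 4})
     + (\<Sum>S\<in>{S. P S}. \<Sum>y\<in>S. \<Sum>z\<in>S - {y}. rk (S - {y, z}) y z) + real (card {S. P S \<and> \<not> cluster3 r S})
     \<le> 48000 * real (card {S. P S})"
proof -
  have fin: "finite {S. P S}" using assms by (intro finite_subset[OF _ finite_ksub[OF V]]) auto
  have c: "real (card {S. P S \<and> R S}) = (\<Sum>S\<in>{S. P S}. of_bool (R S))" for R
    using fin by (simp add: Int_def)
  have "97200 * real (card {S. P S \<and> edges_in r S = 4})
     + (\<Sum>S\<in>{S. P S}. \<Sum>y\<in>S. \<Sum>z\<in>S - {y}. rk (S - {y, z}) y z) + real (card {S. P S \<and> \<not> cluster3 r S})
    = (\<Sum>S\<in>{S. P S}. 97200 * of_bool (edges_in r S = 4) + (\<Sum>y\<in>S. \<Sum>z\<in>S - {y}. rk (S - {y, z}) y z) + of_bool (\<not> cluster3 r S))"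
    unfolding c by (simp only: sum.distrib sum_distrib_left)
  also have "\<dots> \<le> (\<Sum>S\<in>{S. P S}. 48000)"
    by (intro sum_mono cert_real assms) simp
  finally show ?thesis by simp
qed

lemma offdiag:
  assumes T: "T \<in> ksub 4 V"
  shows "(\<Sum>y\<in>V - T. \<Sum>z\<in>V - T - {y}. rk T y z) \<ge> (\<Sum>y\<in>V - T. \<Sum>z\<in>V - T. rk T y z) - M * card V"
proof -
  have "(\<Sum>z\<in>V - T. rk T y z) = rk T y y + (\<Sum>z\<in>V - T - {y}. rk T y z)" if "y \<in> V - T" for y
    using that V by (intro sum.remove) auto
  then have "(\<Sum>y\<in>V - T. \<Sum>z\<in>V - T. rk T y z) = (\<Sum>y\<in>V - T. rk T y y + (\<Sum>z\<in>V - T - {y}. rk T y z))"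
    by (intro sum.cong) auto
  also have "\<dots> = (\<Sum>y\<in>V - T. rk T y y) + (\<Sum>y\<in>V - T. \<Sum>z\<in>V - T - {y}. rk T y z)"
    by (rule sum.distrib)
  also have "(\<Sum>y\<in>V - T. rk T y y) \<le> (\<Sum>y\<in>V - T. M)"
    using M(2) T by (intro sum_mono) (auto simp: ksub_def abs_le_iff)
  also have "\<dots> \<le> M * card V" using M(1) V by (simp add: card_mono mult.commute)
  finally show ?thesis by simp
qed

text \<open>The sum of the certificate over all 6-sets; the error term accounts for the diagonal terms, which occur in the squares but
  not among the splittings of a 6-set.\<close>

lemma global_bound:
  "97200 * real (num4 r V) + real (bad6 r V) + square_sum r V \<le> 48000 * real (card V choose 6) + M * real (card V) ^ 5"
proof -
  have "square_sum r V - real (card (ksub 4 V)) * (M * card V)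
     = (\<Sum>T\<in>ksub 4 V. (\<Sum>y\<in>V - T. \<Sum>z\<in>V - T. rk T y z) - M * card V)"
    unfolding square_sum_def by (simp add: sum_subtractf)
  also have "\<dots> \<le> (\<Sum>T\<in>ksub 4 V. \<Sum>y\<in>V - T. \<Sum>z\<in>V - T - {y}. rk T y z)"
    by (intro sum_mono offdiag)
  also have "\<dots> = (\<Sum>S\<in>ksub 6 V. \<Sum>y\<in>S. \<Sum>z\<in>S - {y}. rk (S - {y, z}) y z)"
    using sum_ksub_pairs[where k = 4 and f = rk, OF V] by simp
  finally have 1: "square_sum r V - real (card (ksub 4 V)) * (M * card V)
     \<le> (\<Sum>S\<in>ksub 6 V. \<Sum>y\<in>S. \<Sum>z\<in>S - {y}. rk (S - {y, z}) y z)" .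
  have "real (card (ksub 4 V)) \<le> real (card V) ^ 4"
    unfolding card_ksub[OF V] by (rule binomial_le_power_real)
  then have "real (card (ksub 4 V)) * (M * card V) \<le> real (card V) ^ 4 * (M * card V)"
    using M(1) by (intro mult_right_mono) auto
  also have "\<dots> = M * real (card V) ^ 5" by (simp add: eval_nat_numeral)
  finally have 2: "real (card (ksub 4 V)) * (M * card V) \<le> M * real (card V) ^ 5" .
  have "97200 * real (num4 r V) + (\<Sum>S\<in>ksub 6 V. \<Sum>y\<in>S. \<Sum>z\<in>S - {y}. rk (S - {y, z}) y z) + real (bad6 r V)
     \<le> 48000 * real (card V choose 6)"
    using sum_cert[of "\<lambda>S. S \<in> ksub 6 V"] unfolding num4_def bad6_def card_ksub[OF V, symmetric] by simp
  with 1 2 show ?thesis by linarith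
qed

text \<open>The sum of the certificate over the 6-sets through \<open>x\<close>. If \<open>x\<close> lies in the 4-set, the forms contribute
  a nonnegative sum. If \<open>x\<close> is one of the two attached vertices, they contribute row sums, which by
  \<open>psd_cross\<close> are at worst slightly negative when the total sum of squares is small.\<close>

lemma local_bound:
  assumes x: "x \<in> V" and t: "t > 0"
  shows "97200 * real (num4_at r V x) + real (bad6_at r V x)
     \<le> 48000 * real ((card V - 1) choose 5) + square_sum r V / t + (t + 3) * M * real (card V) ^ 4"
proof -
  let ?n = "card V"
  let ?A = "{T \<in> ksub 4 V. x \<in> T}" and ?B = "{T \<in> ksub 4 V. x \<notin> T}"
  define f where "f T y z = (if x \<in> insert y (insert z T) then rk T y z else 0)" for T y z
  have fin: "finite (ksub j V)" for j by (rule finite_ksub[OF V])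
  have "(\<Sum>S\<in>{S. S \<in> ksub 6 V \<and> x \<in> S}. \<Sum>y\<in>S. \<Sum>z\<in>S - {y}. rk (S - {y, z}) y z)
     = (\<Sum>S\<in>ksub 6 V. if x \<in> S then \<Sum>y\<in>S. \<Sum>z\<in>S - {y}. rk (S - {y, z}) y z else 0)"
    using fin[of 6] by (simp add: sum.inter_filter)
  also have "\<dots> = (\<Sum>S\<in>ksub 6 V. \<Sum>y\<in>S. \<Sum>z\<in>S - {y}. f (S - {y, z}) y z)"
  proof (intro sum.cong refl)
    fix S
    have "f (S - {y, z}) y z = (if x \<in> S then rk (S - {y, z}) y z else 0)" if "y \<in> S" "z \<in> S - {y}" for y z
    proof -
      have "insert y (insert z (S - {y, z})) = S" using that by auto
      then show ?thesis by (simp add: f_def)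
    qed
    then have "(\<Sum>y\<in>S. \<Sum>z\<in>S - {y}. f (S - {y, z}) y z)
        = (\<Sum>y\<in>S. \<Sum>z\<in>S - {y}. if x \<in> S then rk (S - {y, z}) y z else 0)"
      by (intro sum.cong refl)
    then show "(if x \<in> S then \<Sum>y\<in>S. \<Sum>z\<in>S - {y}. rk (S - {y, z}) y z else 0)
        = (\<Sum>y\<in>S. \<Sum>z\<in>S - {y}. f (S - {y, z}) y z)"
      by simp
  qed
  also have "\<dots> = (\<Sum>T\<in>ksub 4 V. \<Sum>y\<in>V - T. \<Sum>z\<in>V - T - {y}. f T y z)"
    using sum_ksub_pairs[where k = 4 and f = f, OF V] by simp
  also have "\<dots> \<ge> (\<Sum>T\<in>ksub 4 V. if x \<in> T then - (M * ?n)
       else - (\<Sum>y\<in>V - T. \<Sum>z\<in>V - T. rk T y z) / t - (t + 2) * M)"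
  proof (intro sum_mono)
    fix T assume T: "T \<in> ksub 4 V"
    have finU: "finite (V - T)" using V by auto
    show "(if x \<in> T then - (M * ?n) else - (\<Sum>y\<in>V - T. \<Sum>z\<in>V - T. rk T y z) / t - (t + 2) * M)
       \<le> (\<Sum>y\<in>V - T. \<Sum>z\<in>V - T - {y}. f T y z)"
    proof (cases "x \<in> T")
      case True
      have "0 \<le> (\<Sum>y\<in>V - T. \<Sum>z\<in>V - T. rk T y z)" by (rule psdD_one[OF psd_kernel finU])
      with offdiag[OF T] True show ?thesis by (simp add: f_def)
    next
      case False
      let ?U = "V - T"
      have xU: "x \<in> ?U" using x False by auto
      have s: "(\<Sum>z\<in>?U. rk T x z) = rk T x x + (\<Sum>z\<in>?U - {x}. rk T x z)"
        using finU xU by (rule sum.remove)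
      have "(\<Sum>y\<in>?U. \<Sum>z\<in>?U - {y}. f T y z)
         = (\<Sum>z\<in>?U - {x}. f T x z) + (\<Sum>y\<in>?U - {x}. \<Sum>z\<in>?U - {y}. f T y z)"
        using finU xU by (rule sum.remove)
      also have "(\<Sum>y\<in>?U - {x}. \<Sum>z\<in>?U - {y}. f T y z) = (\<Sum>y\<in>?U - {x}. rk T y x)"
      proof (intro sum.cong refl)
        fix y assume y: "y \<in> ?U - {x}"
        have "(\<Sum>z\<in>?U - {y}. f T y z) = f T y x + (\<Sum>z\<in>?U - {y} - {x}. f T y z)"
          using finU xU y by (intro sum.remove) auto
        also have "(\<Sum>z\<in>?U - {y} - {x}. f T y z) = 0"
          using y False by (intro sum.neutral) (auto simp: f_def)
        finally show "(\<Sum>z\<in>?U - {y}. f T y z) = rk T y x" by (simp add: f_def)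
      qed
      also have "(\<Sum>y\<in>?U - {x}. rk T y x) = (\<Sum>z\<in>?U - {x}. rk T x z)"
        by (simp add: kernel_commute[of r T _ x])
      also have "(\<Sum>z\<in>?U - {x}. f T x z) = (\<Sum>z\<in>?U - {x}. rk T x z)"
        by (simp add: f_def)
      finally have e: "(\<Sum>y\<in>?U. \<Sum>z\<in>?U - {y}. f T y z) = 2 * (\<Sum>z\<in>?U. rk T x z) - 2 * rk T x x"
        using s by simp
      have "rk T x x \<le> M" using M(2)[of T x x] T by (simp add: ksub_def abs_le_iff)
      moreover from this t have "t * rk T x x \<le> t * M" by simp
      moreover have "2 * (\<Sum>z\<in>?U. rk T x z) \<ge> - (\<Sum>y\<in>?U. \<Sum>z\<in>?U. rk T y z) / t - t * rk T x x"
        by (rule psd_cross[OF psd_kernel _ finU xU t]) (simp add: kernel_commute)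
      ultimately show ?thesis using False e by (simp add: algebra_simps)
    qed
  qed
  finally have 1: "(\<Sum>T\<in>ksub 4 V. if x \<in> T then - (M * ?n)
       else - (\<Sum>y\<in>V - T. \<Sum>z\<in>V - T. rk T y z) / t - (t + 2) * M)
    \<le> (\<Sum>S\<in>{S. S \<in> ksub 6 V \<and> x \<in> S}. \<Sum>y\<in>S. \<Sum>z\<in>S - {y}. rk (S - {y, z}) y z)" by simp
  have "(\<Sum>T\<in>ksub 4 V. if x \<in> T then - (M * ?n)
       else - (\<Sum>y\<in>V - T. \<Sum>z\<in>V - T. rk T y z) / t - (t + 2) * M)
     \<ge> (\<Sum>T\<in>ksub 4 V. (if x \<in> T then - (M * ?n) else 0) + (- (\<Sum>y\<in>V - T. \<Sum>z\<in>V - T. rk T y z) / t - (t + 2) * M))"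
  proof (intro sum_mono)
    fix T
    have "0 \<le> (\<Sum>y\<in>V - T. \<Sum>z\<in>V - T. rk T y z)" using V by (intro psdD_one[OF psd_kernel]) auto
    then have "0 \<le> (\<Sum>y\<in>V - T. \<Sum>z\<in>V - T. rk T y z) / t" using t by simp
    moreover have "0 \<le> (t + 2) * M" using t M(1) by simp
    ultimately show "(if x \<in> T then - (M * ?n) else 0) + (- (\<Sum>y\<in>V - T. \<Sum>z\<in>V - T. rk T y z) / t - (t + 2) * M)
      \<le> (if x \<in> T then - (M * ?n) else - (\<Sum>y\<in>V - T. \<Sum>z\<in>V - T. rk T y z) / t - (t + 2) * M)" by simp
  qed
  moreover have "(\<Sum>T\<in>ksub 4 V. (if x \<in> T then - (M * ?n) else 0) + (- (\<Sum>y\<in>V - T. \<Sum>z\<in>V - T. rk T y z) / t - (t + 2) * M))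
     = - (M * ?n * card ?A) - square_sum r V / t - (t + 2) * M * card (ksub 4 V)"
  proof -
    have "(\<Sum>T\<in>ksub 4 V. (if x \<in> T then - (M * ?n) else 0)) = (\<Sum>T\<in>?A. - (M * ?n))"
      by (rule sum.inter_filter[OF fin, symmetric])
    then show ?thesis
      by (simp add: sum.distrib sum_subtractf square_sum_def sum_divide_distrib sum_negf mult_ac)
  qed
  moreover have "M * ?n * card ?A \<le> M * real ?n ^ 4"
  proof -
    have "card ?A = (?n - 1) choose 3"
      using card_ksub_superset[OF V, of "{x}" 4] x by simp
    also have "\<dots> \<le> ?n ^ 3"
      by (rule order_trans[OF binomial_le_power power_mono]) auto
    finally have "real (card ?A) \<le> real ?n ^ 3" using of_nat_mono by fastforce
    then have "M * ?n * card ?A \<le> M * ?n * real ?n ^ 3"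
      using M(1) by (intro mult_left_mono) auto
    then show ?thesis by (simp add: eval_nat_numeral)
  qed
  moreover have "(t + 2) * M * card (ksub 4 V) \<le> (t + 2) * M * real ?n ^ 4"
  proof -
    have "real (card (ksub 4 V)) \<le> real ?n ^ 4"
      unfolding card_ksub[OF V] by (rule binomial_le_power_real)
    then show ?thesis using t M(1) by (intro mult_left_mono) auto
  qed
  ultimately have 2: "- (M * real ?n ^ 4) - square_sum r V / t - (t + 2) * M * real ?n ^ 4
    \<le> (\<Sum>S\<in>{S. S \<in> ksub 6 V \<and> x \<in> S}. \<Sum>y\<in>S. \<Sum>z\<in>S - {y}. rk (S - {y, z}) y z)"
    using 1 by linarith
  have c: "card {S. S \<in> ksub 6 V \<and> x \<in> S} = (?n - 1) choose 5"
    using card_ksub_superset[OF V, of "{x}" 6] x by simp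
  have "97200 * real (num4_at r V x) + real (bad6_at r V x)
    \<le> 48000 * real ((?n - 1) choose 5) + (M * real ?n ^ 4 + square_sum r V / t + (t + 2) * M * real ?n ^ 4)"
    using sum_cert[of "\<lambda>S. S \<in> ksub 6 V \<and> x \<in> S"] 2 c
    unfolding num4_at_def bad6_at_def by (simp add: conj_assoc)
  then show ?thesis by (simp add: algebra_simps)
qed

end

section \<open>From few non-clusters to a partition\<close>

lemma edges_in_clique:
  assumes "finite K" "irreflp r" "\<And>x y. x \<in> K \<Longrightarrow> y \<in> K \<Longrightarrow> x \<noteq> y \<Longrightarrow> r x y"
  shows "edges_in r K = card K choose 2"
proof -
  have "{{x, y} | x y. x \<in> K \<and> y \<in> K \<and> r x y} = {e. e \<subseteq> K \<and> card e = 2}"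
  proof (intro set_eqI iffI)
    fix e assume "e \<in> {{x, y} | x y. x \<in> K \<and> y \<in> K \<and> r x y}"
    then obtain x y where "e = {x, y}" "x \<in> K" "y \<in> K" "r x y" by auto
    moreover have "x \<noteq> y" using calculation assms(2) by (auto dest: irreflpD)
    ultimately show "e \<in> {e. e \<subseteq> K \<and> card e = 2}" by auto
  next
    fix e assume "e \<in> {e. e \<subseteq> K \<and> card e = 2}"
    then obtain x y where "e = {x, y}" "x \<noteq> y" "x \<in> K" "y \<in> K" by (auto simp: card_2_iff)
    then show "e \<in> {{x, y} | x y. x \<in> K \<and> y \<in> K \<and> r x y}" using assms(3) by blast
  qed
  then show ?thesis unfolding edges_in_def using n_subsets[OF assms(1)] by simp
qed

lemma finite_edges: "finite S \<Longrightarrow> finite {{x, y} | x y. x \<in> S \<and> y \<in> S \<and> r x y}"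
  by (rule finite_subset[of _ "Pow S"]) auto

lemma edges_in_disjoint:
  assumes "finite S" "A \<inter> B = {}" "A \<union> B \<subseteq> S"
  shows "edges_in r A + edges_in r B \<le> edges_in r S"
proof -
  let ?E = "\<lambda>S. {{x, y} | x y. x \<in> S \<and> y \<in> S \<and> r x y}"
  have fin: "finite A" "finite B" using assms finite_subset by blast+
  have "?E A \<inter> ?E B = {}" using assms(2) by (auto simp: doubleton_eq_iff)
  then have "edges_in r A + edges_in r B = card (?E A \<union> ?E B)"
    unfolding edges_in_def using fin by (simp add: card_Un_disjoint finite_edges)
  also have "\<dots> \<le> edges_in r S"
    unfolding edges_in_def using assms by (intro card_mono finite_edges) blast+
  finally show ?thesis .
qed

text \<open>A union of at most two cliques on six vertices spans at least six edges, so four edges require three cliques.\<close>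

lemma independent_triple:
  assumes r: "symp r" "irreflp r" and S: "card S = 6" "cluster3 r S" "edges_in r S = 4"
  obtains a b c where "a \<in> S" "b \<in> S" "c \<in> S" "a \<noteq> b" "a \<noteq> c" "b \<noteq> c" "\<not> r a b" "\<not> r a c" "\<not> r b c"
proof -
  have fin: "finite S" using S(1) card.infinite by fastforce
  have tr: "r x z" if "x \<in> S" "y \<in> S" "z \<in> S" "r x y" "r y z" "x \<noteq> z" for x y z
    using that S(2) unfolding cluster3_def by blast
  have sym: "r x y \<Longrightarrow> r y x" for x y using r(1) by (rule sympD)
  have irr: "\<not> r x x" for x using r(2) by (auto dest: irreflpD)
  obtain a where a: "a \<in> S" using S(1) by fastforce
  define A where "A = insert a {x \<in> S. r a x}"
  have AS: "A \<subseteq> S" "a \<in> A" using a by (auto simp: A_def)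
  have finA: "finite A" "finite (S - A)" using AS fin finite_subset by blast+
  have cA: "card A + card (S - A) = 6"
    using AS fin S(1) card_mono[OF fin AS(1)] by (simp add: card_Diff_subset finA)
  have A: "r x y" if "x \<in> A" "y \<in> A" "x \<noteq> y" for x y
    using that tr[of x a y] sym[of a x] sym[of a y] a unfolding A_def by auto
  have eA: "edges_in r A = card A choose 2"
    by (rule edges_in_clique[OF finA(1) r(2) A])
  have "\<exists>b\<in>S - A. \<exists>c\<in>S - A. b \<noteq> c \<and> \<not> r b c"
  proof (rule ccontr)
    assume "\<not> ?thesis"
    then have "edges_in r (S - A) = card (S - A) choose 2"
      by (intro edges_in_clique finA r(2)) blast
    moreover have "edges_in r A + edges_in r (S - A) \<le> 4"
      using edges_in_disjoint[of S A "S - A" r] fin AS S(3) by auto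
    moreover have "card (S - A) = 6 - card A" using cA by simp
    ultimately have le: "(card A choose 2) + ((6 - card A) choose 2) \<le> 4"
      using eA by simp
    have "card A \<le> 6" using cA by simp
    then have "card A = 0 \<or> card A = 1 \<or> card A = 2 \<or> card A = 3 \<or> card A = 4 \<or> card A = 5 \<or> card A = 6"
      by linarith
    then show False using le by (elim disjE) (simp_all add: choose_two)
  qed
  then obtain b c where bc: "b \<in> S" "c \<in> S" "b \<notin> A" "c \<notin> A" "b \<noteq> c" "\<not> r b c" by auto
  show thesis
    by (rule that[of a b c]) (use a bc in \<open>auto simp: A_def\<close>)
qed

text \<open>The blowup of three loops with classes given by \<open>p\<close> differs from \<open>r\<close> at the pair \<open>x, y\<close>.\<close>

definition wrong :: "('a \<Rightarrow> 'a \<Rightarrow> bool) \<Rightarrow> ('a \<Rightarrow> nat) \<Rightarrow> 'a \<Rightarrow> 'a \<Rightarrow> bool" where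
  "wrong r p x y \<longleftrightarrow> x \<noteq> y \<and> r x y \<noteq> (p x = p y)"

definition defects :: "('a \<Rightarrow> 'a \<Rightarrow> bool) \<Rightarrow> 'a set \<Rightarrow> ('a \<Rightarrow> nat) \<Rightarrow> nat" where
  "defects r V p = card {(x, y). x \<in> V \<and> y \<in> V \<and> wrong r p x y}"

text \<open>In a cluster every vertex outside an independent triple has exactly one neighbour in the triple, and
  two such vertices are adjacent iff they have the same one.\<close>

lemma not_wrong:
  assumes r: "symp r" "irreflp r" and cl: "cluster3 r S"
    and S: "a \<in> S" "b \<in> S" "c \<in> S" "y \<in> S" "z \<in> S"
    and t: "a \<noteq> b" "a \<noteq> c" "b \<noteq> c" "\<not> r a b" "\<not> r a c" "\<not> r b c"
    and yz: "y \<noteq> z" "y \<notin> {a, b, c}" "z \<notin> {a, b, c}"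
  shows "r y z \<longleftrightarrow> (if r y a then 0 else if r y b then 1 else 2) = (if r z a then 0 else if r z b then 1 else (2 :: nat))"
proof -
  have tr: "r x z" if "x \<in> S" "y \<in> S" "z \<in> S" "r x y" "r y z" "x \<noteq> z" for x y z
    using that cl unfolding cluster3_def by blast
  have sym: "r x y = r y x" for x y using r(1) by (auto dest: sympD)
  have irr: "\<not> r x x" for x using r(2) by (auto dest: irreflpD)
  have some: "r u a \<or> r u b \<or> r u c" if "u \<in> S" "u \<notin> {a, b, c}" for u
  proof -
    have "card {u, a, b, c} = 4" using that t by auto
    moreover have "{u, a, b, c} \<subseteq> S" using that S by auto
    ultimately have "\<exists>x\<in>{u, a, b, c}. \<exists>y\<in>{u, a, b, c}. r x y" using cl unfolding cluster3_def by blast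
    then show ?thesis using t irr sym by auto
  qed
  have one: "\<not> (r u v \<and> r u w)" if "u \<in> S" "v \<in> S" "w \<in> S" "v \<noteq> w" "\<not> r v w" for u v w
    using tr[of v u w] that sym by blast
  have same: "r y z" if "v \<in> S" "r y v" "r z v" for v
    using tr[of y v z] that S yz sym by blast
  have diff: "\<not> r y z" if "v \<in> S" "w \<in> S" "v \<noteq> w" "\<not> r v w" "r y v" "r z w" "w \<noteq> y" for v w
  proof
    assume "r y z"
    then have "r y w" using tr[of y z w] that S by blast
    then show False using one[of y v w] that S by blast
  qed
  have y: "r y a \<or> r y b \<or> r y c" "z \<in> S" and z: "r z a \<or> r z b \<or> r z c" using some S yz by auto
  have ty: "\<not> (r y a \<and> r y b)" "\<not> (r y a \<and> r y c)" "\<not> (r y b \<and> r y c)"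
    "\<not> (r z a \<and> r z b)" "\<not> (r z a \<and> r z c)" "\<not> (r z b \<and> r z c)"
    using one S t by blast+
  have nd: "\<not> (r y z \<and> r y v \<and> r z w)" if "v \<in> S" "w \<in> S" "v \<noteq> w" "\<not> r v w" "y \<noteq> w" for v w
    using diff that by blast
  have sba: "\<not> r b a" "\<not> r c a" "\<not> r c b" using t(4-6) sym by blast+
  have d: "\<not> (r y z \<and> r y a \<and> r z b)" "\<not> (r y z \<and> r y a \<and> r z c)" "\<not> (r y z \<and> r y b \<and> r z a)"
    "\<not> (r y z \<and> r y b \<and> r z c)" "\<not> (r y z \<and> r y c \<and> r z a)" "\<not> (r y z \<and> r y c \<and> r z b)"
    using nd[of a b] nd[of a c] nd[of b a] nd[of b c] nd[of c a] nd[of c b] S t yz sba by simp_all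
  have s: "r y a \<and> r z a \<longrightarrow> r y z" "r y b \<and> r z b \<longrightarrow> r y z" "r y c \<and> r z c \<longrightarrow> r y z"
    using same S by blast+
  from y(1) z show ?thesis by (elim disjE) (use ty d s in simp_all)
qed

text \<open>By averaging, some 4-set that contains an independent triple extends to few non-clusters. Classify the
  vertices by their neighbour in the triple. A pair disjoint from the 4-set and completing it
  to a cluster is not wrong, by \<open>not_wrong\<close>; the pairs that meet the 4-set are the linear error term.\<close>

lemma partition_of_few_bad:
  assumes r: "symp r" "irreflp r" and V: "finite V" "V \<noteq> {}"
    and \<beta>: "\<beta> > 0" "\<beta> * real (card V) ^ 6 \<le> real (num4 r V) - real (bad6 r V)"
  obtains p where "\<And>x. p x < 3"
    "real (defects r V p) \<le> 30 * real (bad6 r V) / (\<beta> * real (card V) ^ 4) + 8 * real (card V)"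
proof -
  let ?n = "real (card V)"
  have n: "?n > 0" using V by (simp add: card_gt_0_iff)
  have fk: "finite (ksub j V)" for j by (rule finite_ksub[OF V(1)])
  define tri where "tri T \<longleftrightarrow> (\<exists>a\<in>T. \<exists>b\<in>T. \<exists>c\<in>T. a \<noteq> b \<and> a \<noteq> c \<and> b \<noteq> c \<and> \<not> r a b \<and> \<not> r a c \<and> \<not> r b c)" for T
  define TT where "TT = {T \<in> ksub 4 V. tri T}"
  define bd where "bd T = (\<Sum>y\<in>V - T. \<Sum>z\<in>V - T - {y}. of_bool (\<not> cluster3 r (insert y (insert z T))) :: real)" for T
  have finT: "finite TT" unfolding TT_def using fk by simp
  have ins: "insert y (insert z (S - {y, z})) = S" if "y \<in> S" "z \<in> S - {y}" for y z and S :: "'a set"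
    using that by auto
  have c6: "card S = 6" "finite S" if "S \<in> ksub 6 V" for S
    using that V(1) finite_subset by (auto simp: ksub_def)
  have "(\<Sum>T\<in>ksub 4 V. bd T) = (\<Sum>S\<in>ksub 6 V. \<Sum>y\<in>S. \<Sum>z\<in>S - {y}. of_bool (\<not> cluster3 r (insert y (insert z (S - {y, z})))))"
    unfolding bd_def
    using sum_ksub_pairs[where k = 4 and f = "\<lambda>T y z. of_bool (\<not> cluster3 r (insert y (insert z T)))", OF V(1)] by simp
  also have "\<dots> = (\<Sum>S\<in>ksub 6 V. \<Sum>y\<in>S. \<Sum>z\<in>S - {y}. of_bool (\<not> cluster3 r S))"
    by (intro sum.cong refl) (simp only: ins)
  also have "\<dots> = (\<Sum>S\<in>ksub 6 V. 30 * of_bool (\<not> cluster3 r S))"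
    by (intro sum.cong refl) (simp add: c6)
  also have "\<dots> = 30 * real (bad6 r V)"
    unfolding bad6_def using fk by (simp add: sum_distrib_left[symmetric] Int_def)
  finally have bd_sum: "(\<Sum>T\<in>ksub 4 V. bd T) = 30 * real (bad6 r V)" .
  have bd_nonneg: "bd T \<ge> 0" for T unfolding bd_def by (intro sum_nonneg) simp
  let ?G = "{S \<in> ksub 6 V. edges_in r S = 4 \<and> cluster3 r S}"
  have "real (num4 r V) \<le> real (card (?G \<union> {S \<in> ksub 6 V. \<not> cluster3 r S}))"
    unfolding num4_def using fk by (intro of_nat_mono card_mono) auto
  also have "\<dots> \<le> real (card ?G) + real (bad6 r V)"
    unfolding bad6_def of_nat_add[symmetric] by (intro of_nat_mono card_Un_le)
  finally have "\<beta> * ?n ^ 6 \<le> real (card ?G)" using \<beta>(2) by simp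
  also have "real (card ?G) = (\<Sum>S\<in>ksub 6 V. of_bool (edges_in r S = 4 \<and> cluster3 r S))"
    using fk by (simp add: Int_def)
  also have "\<dots> \<le> (\<Sum>S\<in>ksub 6 V. \<Sum>y\<in>S. \<Sum>z\<in>S - {y}. of_bool (tri (S - {y, z})))"
  proof (intro sum_mono)
    fix S assume S: "S \<in> ksub 6 V"
    show "of_bool (edges_in r S = 4 \<and> cluster3 r S) \<le> (\<Sum>y\<in>S. \<Sum>z\<in>S - {y}. of_bool (tri (S - {y, z})) :: real)"
    proof (cases "edges_in r S = 4 \<and> cluster3 r S")
      case True
      then obtain a b c where abc: "a \<in> S" "b \<in> S" "c \<in> S" "a \<noteq> b" "a \<noteq> c" "b \<noteq> c" "\<not> r a b" "\<not> r a c" "\<not> r b c"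
        using independent_triple[OF r c6(1)[OF S]] by blast
      have "card (S - {a, b, c}) = 3" using abc c6[OF S] by (simp add: card_Diff_subset)
      then obtain y z w where "S - {a, b, c} = {y, z, w}" "y \<noteq> z" by (auto simp: card_3_iff)
      then have yz: "y \<in> S" "z \<in> S - {y}" "y \<notin> {a, b, c}" "z \<notin> {a, b, c}" by auto
      have "tri (S - {y, z})" unfolding tri_def using abc yz
        by (intro bexI[of _ a] bexI[of _ b] bexI[of _ c]) auto
      then have "1 \<le> (of_bool (tri (S - {y, z})) :: real)" by simp
      also have "\<dots> \<le> (\<Sum>z\<in>S - {y}. of_bool (tri (S - {y, z})))"
        using yz c6(2)[OF S] by (intro member_le_sum) auto
      also have "\<dots> \<le> (\<Sum>y\<in>S. \<Sum>z\<in>S - {y}. of_bool (tri (S - {y, z})))"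
        using yz c6(2)[OF S] by (intro member_le_sum[where f = "\<lambda>y. \<Sum>z\<in>S - {y}. of_bool (tri (S - {y, z}))"]) (auto intro: sum_nonneg)
      finally show ?thesis using True by simp
    qed (auto intro!: sum_nonneg)
  qed
  also have "\<dots> = (\<Sum>T\<in>ksub 4 V. \<Sum>y\<in>V - T. \<Sum>z\<in>V - T - {y}. of_bool (tri T))"
    using sum_ksub_pairs[where k = 4 and f = "\<lambda>T y z. of_bool (tri T)", OF V(1)] by simp
  also have "\<dots> \<le> (\<Sum>T\<in>ksub 4 V. of_bool (tri T) * ?n ^ 2)"
  proof (intro sum_mono)
    fix T
    have "(\<Sum>y\<in>V - T. \<Sum>z\<in>V - T - {y}. of_bool (tri T)) \<le> (\<Sum>y\<in>V - T. \<Sum>z\<in>V. of_bool (tri T) :: real)"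
      using V(1) by (intro sum_mono sum_mono2) auto
    also have "\<dots> \<le> (\<Sum>y\<in>V. \<Sum>z\<in>V. of_bool (tri T))"
      using V(1) by (intro sum_mono2) (auto intro: sum_nonneg)
    finally show "(\<Sum>y\<in>V - T. \<Sum>z\<in>V - T - {y}. of_bool (tri T)) \<le> of_bool (tri T) * ?n ^ 2"
      by (simp add: power2_eq_square mult_ac)
  qed
  also have "\<dots> = real (card TT) * ?n ^ 2"
    unfolding TT_def using fk by (simp add: sum_distrib_right[symmetric] Int_def)
  finally have "\<beta> * ?n ^ 4 * ?n ^ 2 \<le> real (card TT) * ?n ^ 2" by (simp add: mult.assoc flip: power_add)
  then have TTb: "\<beta> * ?n ^ 4 \<le> real (card TT)" using n by simp
  have pos: "\<beta> * ?n ^ 4 > 0" using \<beta>(1) n by simp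
  have "\<exists>T\<in>TT. bd T * (\<beta> * ?n ^ 4) \<le> 30 * real (bad6 r V)"
  proof (rule ccontr)
    assume "\<not> ?thesis"
    then have lt: "30 * real (bad6 r V) < bd T * (\<beta> * ?n ^ 4)" if "T \<in> TT" for T using that by (simp add: not_le)
    have ne: "TT \<noteq> {}" using TTb pos by auto
    have "30 * real (bad6 r V) * real (card TT) = (\<Sum>T\<in>TT. 30 * real (bad6 r V))" by simp
    also have "\<dots> < (\<Sum>T\<in>TT. bd T * (\<beta> * ?n ^ 4))" using finT ne lt by (intro sum_strict_mono) auto
    also have "\<dots> = (\<Sum>T\<in>TT. bd T) * (\<beta> * ?n ^ 4)" by (simp add: sum_distrib_right)
    also have "\<dots> \<le> (30 * real (bad6 r V)) * (\<beta> * ?n ^ 4)"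
      unfolding bd_sum[symmetric] using pos fk bd_nonneg
      by (intro mult_right_mono sum_mono2) (auto simp: TT_def)
    also have "\<dots> \<le> (30 * real (bad6 r V)) * real (card TT)"
      using TTb by (intro mult_left_mono) auto
    finally show False by simp
  qed
  then obtain T where T: "T \<in> TT" "bd T * (\<beta> * ?n ^ 4) \<le> 30 * real (bad6 r V)" by blast
  then have bdT: "bd T \<le> 30 * real (bad6 r V) / (\<beta> * ?n ^ 4)" using pos by (simp add: pos_le_divide_eq)
  from T(1) obtain a b c where abc: "a \<in> T" "b \<in> T" "c \<in> T" "a \<noteq> b" "a \<noteq> c" "b \<noteq> c" "\<not> r a b" "\<not> r a c" "\<not> r b c"
    unfolding TT_def tri_def by blast
  have TV: "T \<subseteq> V" "card T = 4" using T(1) by (auto simp: TT_def ksub_def)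
  define p where "p y = (if r y a then 0 else if r y b then 1 else (2 :: nat))" for y
  let ?bad = "Sigma (V - T) (\<lambda>y. {z \<in> V - T - {y}. \<not> cluster3 r (insert y (insert z T))})"
  have "{(x, y). x \<in> V \<and> y \<in> V \<and> wrong r p x y} \<subseteq> ?bad \<union> (T \<times> V \<union> V \<times> T)"
  proof
    fix e assume "e \<in> {(x, y). x \<in> V \<and> y \<in> V \<and> wrong r p x y}"
    then obtain y z where e: "e = (y, z)" and h: "y \<in> V" "z \<in> V" "wrong r p y z" by auto
    show "e \<in> ?bad \<union> (T \<times> V \<union> V \<times> T)"
    proof (cases "y \<in> T \<or> z \<in> T")
      case False
      have "y \<noteq> z" using h by (simp add: wrong_def)
      have "\<not> cluster3 r (insert y (insert z T))"
      proof
        assume cl: "cluster3 r (insert y (insert z T))"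
        have "r y z \<longleftrightarrow> p y = p z"
          unfolding p_def by (rule not_wrong[OF r cl _ _ _ _ _ abc(4-9)]) (use abc False \<open>y \<noteq> z\<close> in auto)
        then show False using h(3) by (simp add: wrong_def)
      qed
      then show ?thesis using e h False \<open>y \<noteq> z\<close> by simp
    qed (use e h in auto)
  qed
  then have "defects r V p \<le> card (?bad \<union> (T \<times> V \<union> V \<times> T))"
    unfolding defects_def using V(1) TV by (intro card_mono finite_UnI finite_SigmaI) (auto intro: finite_subset)
  also have "\<dots> \<le> card ?bad + (card (T \<times> V) + card (V \<times> T))"
    by (intro order_trans[OF card_Un_le] add_mono card_Un_le) simp
  finally have "real (defects r V p) \<le> real (card ?bad) + 8 * ?n"
    using TV by (simp add: card_cartesian_product)
  also have "real (card ?bad) = bd T"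
    unfolding bd_def using V(1) by (simp add: Int_def)
  finally have "real (defects r V p) \<le> 30 * real (bad6 r V) / (\<beta> * ?n ^ 4) + 8 * ?n" using bdT by simp
  moreover have "p x < 3" for x by (simp add: p_def)
  ultimately show thesis using that by blast
qed

section \<open>Counting in a disjoint union of three cliques\<close>

lemma card_split_subsets:
  assumes "finite A" "finite B" "A \<inter> B = {}"
  shows "card {S. S \<subseteq> A \<union> B \<and> card (S \<inter> A) = i \<and> Q (S \<inter> B)} = (card A choose i) * card {R. R \<subseteq> B \<and> Q R}"
proof -
  have "bij_betw (\<lambda>S. (S \<inter> A, S \<inter> B)) {S. S \<subseteq> A \<union> B \<and> card (S \<inter> A) = i \<and> Q (S \<inter> B)}
      ({R. R \<subseteq> A \<and> card R = i} \<times> {R. R \<subseteq> B \<and> Q R})"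
  proof (rule bij_betw_byWitness[of _ "\<lambda>(P, R). P \<union> R"])
    show "(\<lambda>(P, R). P \<union> R) ` ({R. R \<subseteq> A \<and> card R = i} \<times> {R. R \<subseteq> B \<and> Q R})
       \<subseteq> {S. S \<subseteq> A \<union> B \<and> card (S \<inter> A) = i \<and> Q (S \<inter> B)}"
    proof clarify
      fix P R assume h: "P \<subseteq> A" "R \<subseteq> B" "Q R" "i = card P"
      have "(P \<union> R) \<inter> A = P" "(P \<union> R) \<inter> B = R" using h assms(3) by auto
      then show "P \<union> R \<subseteq> A \<union> B \<and> card ((P \<union> R) \<inter> A) = card P \<and> Q ((P \<union> R) \<inter> B)" using h by auto
    qed
    show "\<forall>a'\<in>{R. R \<subseteq> A \<and> card R = i} \<times> {R. R \<subseteq> B \<and> Q R}. ((case a' of (P, R) \<Rightarrow> P \<union> R) \<inter> A, (case a' of (P, R) \<Rightarrow> P \<union> R) \<inter> B) = a'"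
      using assms(3) by auto
  qed auto
  then show ?thesis using bij_betw_same_card assms(1) by (fastforce simp: card_cartesian_product n_subsets)
qed

lemma card_profile:
  assumes "finite A" "finite B" "finite C" "A \<inter> B = {}" "A \<inter> C = {}" "B \<inter> C = {}"
  shows "card {S. S \<subseteq> A \<union> B \<union> C \<and> card (S \<inter> A) = i \<and> card (S \<inter> B) = j \<and> card (S \<inter> C) = l}
    = (card A choose i) * (card B choose j) * (card C choose l)"
proof -
  have 1: "{S. S \<subseteq> A \<union> B \<union> C \<and> card (S \<inter> A) = i \<and> card (S \<inter> B) = j \<and> card (S \<inter> C) = l}
     = {S. S \<subseteq> A \<union> (B \<union> C) \<and> card (S \<inter> A) = i \<and> (card (S \<inter> (B \<union> C) \<inter> B) = j \<and> card (S \<inter> (B \<union> C) \<inter> C) = l)}"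
  proof -
    have "S \<inter> (B \<union> C) \<inter> B = S \<inter> B" "S \<inter> (B \<union> C) \<inter> C = S \<inter> C" for S by auto
    then show ?thesis by (simp only: Un_assoc)
  qed
  have "finite (B \<union> C)" "A \<inter> (B \<union> C) = {}" using assms by auto
  from card_split_subsets[OF assms(1) this, of i "\<lambda>R. card (R \<inter> B) = j \<and> card (R \<inter> C) = l"]
    card_split_subsets[OF assms(2,3,6), of j "\<lambda>R. card R = l"] n_subsets[OF assms(3), of l]
  show ?thesis unfolding 1 by (simp only: mult.assoc)
qed

definition same_class :: "('a \<Rightarrow> nat) \<Rightarrow> 'a \<Rightarrow> 'a \<Rightarrow> bool" where
  "same_class p x y \<longleftrightarrow> x \<noteq> y \<and> p x = p y"

definition cls :: "'a set \<Rightarrow> ('a \<Rightarrow> nat) \<Rightarrow> nat \<Rightarrow> 'a set" where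
  "cls V p i = {x \<in> V. p x = i}"

lemma symp_same_class: "symp (same_class p)" and irreflp_same_class: "irreflp (same_class p)"
  by (auto simp: same_class_def intro: sympI irreflpI)

lemma cls_Un: "(\<And>x. x \<in> V \<Longrightarrow> p x < 3) \<Longrightarrow> V = cls V p 0 \<union> cls V p 1 \<union> cls V p 2"
  by (auto simp: cls_def eval_nat_numeral less_Suc_eq)

lemma edges_in_same_class:
  assumes "finite S" "\<And>x. x \<in> S \<Longrightarrow> p x < 3"
  shows "edges_in (same_class p) S = (card (cls S p 0) choose 2) + (card (cls S p 1) choose 2) + (card (cls S p 2) choose 2)"
proof -
  let ?E = "\<lambda>S. {{x, y} | x y. x \<in> S \<and> y \<in> S \<and> same_class p x y}"
  let ?c = "cls S p"
  have "?E S = ?E (?c 0) \<union> ?E (?c 1) \<union> ?E (?c 2)"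
  proof
    show "?E S \<subseteq> ?E (?c 0) \<union> ?E (?c 1) \<union> ?E (?c 2)"
    proof
      fix e assume "e \<in> ?E S"
      then obtain x y where e: "e = {x, y}" "x \<in> S" "y \<in> S" "same_class p x y" by auto
      have "x \<in> ?c (p x)" "y \<in> ?c (p x)" using e by (auto simp: same_class_def cls_def)
      then have "e \<in> ?E (?c (p x))" using e(1,4) by blast
      moreover have "p x = 0 \<or> p x = 1 \<or> p x = 2" using assms(2)[OF e(2)] by linarith
      ultimately show "e \<in> ?E (?c 0) \<union> ?E (?c 1) \<union> ?E (?c 2)"
        by (elim disjE) simp_all
    qed
  qed (auto simp: cls_def)
  moreover have "?E (?c 0) \<inter> ?E (?c 1) = {}" "(?E (?c 0) \<union> ?E (?c 1)) \<inter> ?E (?c 2) = {}"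
    by (auto simp: cls_def doubleton_eq_iff)
  moreover have fin: "finite (?c i)" for i using assms(1) by (simp add: cls_def)
  ultimately have "edges_in (same_class p) S = edges_in (same_class p) (?c 0) + edges_in (same_class p) (?c 1) + edges_in (same_class p) (?c 2)"
    unfolding edges_in_def by (simp add: card_Un_disjoint finite_edges)
  moreover have "edges_in (same_class p) (?c i) = card (?c i) choose 2" for i
    by (rule edges_in_clique[OF fin irreflp_same_class]) (auto simp: cls_def same_class_def)
  ultimately show ?thesis by simp
qed

lemma cls_Int: "S \<subseteq> V \<Longrightarrow> cls S p i = S \<inter> cls V p i"
  by (auto simp: cls_def)

definition perms321 :: "(nat \<times> nat \<times> nat) set" where
  "perms321 = {(3,2,1), (3,1,2), (2,3,1), (2,1,3), (1,3,2), (1,2,3)}"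

lemma choose_two_sum:
  assumes "i + j + l = (6::nat)"
  shows "(i choose 2) + (j choose 2) + (l choose 2) = 4 \<longleftrightarrow> (i, j, l) \<in> perms321"
    and "(i choose 2) + (j choose 2) + (l choose 2) = 3 \<longleftrightarrow> i = 2 \<and> j = 2 \<and> l = 2"
    and "(i choose 2) + (j choose 2) + (l choose 2) \<noteq> 5"
proof -
  have l: "l = 6 - i - j" and "i \<le> 6" "j \<le> 6" "i + j \<le> 6" using assms by auto
  then have "i \<in> {0,1,2,3,4,5,6}" "j \<in> {0,1,2,3,4,5,6}" "i + j \<le> 6" by auto
  then have "((i choose 2) + (j choose 2) + ((6 - i - j) choose 2) = 4 \<longleftrightarrow> (i, j, 6 - i - j) \<in> perms321)
    \<and> ((i choose 2) + (j choose 2) + ((6 - i - j) choose 2) = 3 \<longleftrightarrow> i = 2 \<and> j = 2 \<and> 6 - i - j = 2)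
    \<and> (i choose 2) + (j choose 2) + ((6 - i - j) choose 2) \<noteq> 5"
    by (elim insertE emptyE) (simp_all add: choose_two perms321_def)
  then show "(i choose 2) + (j choose 2) + (l choose 2) = 4 \<longleftrightarrow> (i, j, l) \<in> perms321"
    and "(i choose 2) + (j choose 2) + (l choose 2) = 3 \<longleftrightarrow> i = 2 \<and> j = 2 \<and> l = 2"
    and "(i choose 2) + (j choose 2) + (l choose 2) \<noteq> 5"
    unfolding l by blast+
qed

definition profile :: "'a set \<Rightarrow> ('a \<Rightarrow> nat) \<Rightarrow> nat \<times> nat \<times> nat \<Rightarrow> 'a set set" where
  "profile V p c = {S. S \<subseteq> V \<and> (card (cls S p 0), card (cls S p 1), card (cls S p 2)) = c}"

lemma card_profile_cls:
  assumes "finite V" "\<And>x. x \<in> V \<Longrightarrow> p x < 3"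
  shows "card (profile V p (i, j, l)) = (card (cls V p 0) choose i) * (card (cls V p 1) choose j) * (card (cls V p 2) choose l)"
proof -
  have U: "cls V p 0 \<union> cls V p 1 \<union> cls V p 2 = V" using cls_Un[of V p, OF assms(2)] by simp
  have "profile V p (i, j, l) = {S. S \<subseteq> V \<and> card (S \<inter> cls V p 0) = i \<and> card (S \<inter> cls V p 1) = j \<and> card (S \<inter> cls V p 2) = l}"
    unfolding profile_def by (auto simp: cls_Int)
  moreover have "finite (cls V p u)" for u using assms(1) by (simp add: cls_def)
  moreover have "cls V p u \<inter> cls V p v = {}" if "u \<noteq> v" for u v using that by (auto simp: cls_def)
  ultimately show ?thesis
    using card_profile[of "cls V p 0" "cls V p 1" "cls V p 2" i j l] unfolding U by simp
qed

lemma card_cls_sum: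
  assumes "finite S" "\<And>x. x \<in> S \<Longrightarrow> p x < 3"
  shows "card S = card (cls S p 0) + card (cls S p 1) + card (cls S p 2)"
proof -
  have "card S = card (cls S p 0 \<union> cls S p 1 \<union> cls S p 2)" using cls_Un[of S p, OF assms(2)] by simp
  also have "\<dots> = card (cls S p 0) + card (cls S p 1) + card (cls S p 2)"
    using assms(1) by (subst card_Un_disjoint; (subst card_Un_disjoint)?) (auto simp: cls_def)
  finally show ?thesis .
qed

text \<open>Three cliques with six vertices in total span four edges iff their sizes are 3, 2, 1 in some order, and
  three edges iff the sizes are 2, 2, 2.\<close>

lemma edges_in_same_class_iff:
  assumes "S \<in> ksub 6 V" "finite V" "\<And>x. x \<in> V \<Longrightarrow> p x < 3"
  shows "edges_in (same_class p) S = 4 \<longleftrightarrow> (\<exists>c\<in>perms321. S \<in> profile V p c)"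
    and "edges_in (same_class p) S = 3 \<longleftrightarrow> S \<in> profile V p (2, 2, 2)"
    and "edges_in (same_class p) S \<noteq> 5"
proof -
  have S: "S \<subseteq> V" "card S = 6" "finite S" using assms finite_subset by (auto simp: ksub_def)
  have p: "x \<in> S \<Longrightarrow> p x < 3" for x using S assms(3) by auto
  have s: "card (cls S p 0) + card (cls S p 1) + card (cls S p 2) = 6"
    using card_cls_sum[of S p, OF S(3) p] S(2) by simp
  have e: "edges_in (same_class p) S = (card (cls S p 0) choose 2) + (card (cls S p 1) choose 2) + (card (cls S p 2) choose 2)"
    by (rule edges_in_same_class[OF S(3) p])
  show "edges_in (same_class p) S = 4 \<longleftrightarrow> (\<exists>c\<in>perms321. S \<in> profile V p c)"
    unfolding e choose_two_sum(1)[OF s] profile_def using S(1) by auto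
  show "edges_in (same_class p) S = 3 \<longleftrightarrow> S \<in> profile V p (2, 2, 2)"
    unfolding e choose_two_sum(2)[OF s] profile_def using S(1) by auto
  show "edges_in (same_class p) S \<noteq> 5"
    unfolding e by (rule choose_two_sum(3)[OF s])
qed

lemma profile_ksub:
  assumes "S \<in> profile V p (i, j, l)" "finite V" "\<And>x. x \<in> V \<Longrightarrow> p x < 3"
  shows "S \<in> ksub (i + j + l) V"
  using assms card_cls_sum[of S p] finite_subset[of S V] by (auto simp: profile_def ksub_def)

text \<open>The number of 6-sets with four edges in three disjoint cliques of sizes \<open>a\<close>, \<open>b\<close>, \<open>c\<close>.\<close>

definition blowup_count :: "nat \<Rightarrow> nat \<Rightarrow> nat \<Rightarrow> nat" where
  "blowup_count a b c =
     (a choose 3) * (b choose 2) * c + (a choose 3) * b * (c choose 2) + (a choose 2) * (b choose 3) * c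
     + (a choose 2) * b * (c choose 3) + a * (b choose 3) * (c choose 2) + a * (b choose 2) * (c choose 3)"

lemma num4_same_class:
  assumes "finite V" "\<And>x. x \<in> V \<Longrightarrow> p x < 3"
  shows "num4 (same_class p) V = blowup_count (card (cls V p 0)) (card (cls V p 1)) (card (cls V p 2))"
proof -
  have "{S \<in> ksub 6 V. edges_in (same_class p) S = 4} = (\<Union>c\<in>perms321. profile V p c)"
  proof (intro set_eqI iffI)
    fix S assume "S \<in> (\<Union>c\<in>perms321. profile V p c)"
    then obtain c where c: "c \<in> perms321" "S \<in> profile V p c" by auto
    then have "S \<in> ksub 6 V" using profile_ksub[where V = V and p = p, OF _ assms] by (fastforce simp: perms321_def)
    then show "S \<in> {S \<in> ksub 6 V. edges_in (same_class p) S = 4}"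
      using edges_in_same_class_iff(1)[where V = V and p = p, OF _ assms] c by blast
  qed (use edges_in_same_class_iff(1)[where V = V and p = p, OF _ assms] in blast)
  moreover have "card (\<Union>c\<in>perms321. profile V p c) = (\<Sum>c\<in>perms321. card (profile V p c))"
  proof (rule card_UN_disjoint)
    show "finite perms321" by (simp add: perms321_def)
    show "\<forall>i\<in>perms321. finite (profile V p i)"
      using assms(1) by (auto simp: profile_def intro: finite_subset[of _ "Pow V"])
    show "\<forall>i\<in>perms321. \<forall>j\<in>perms321. i \<noteq> j \<longrightarrow> profile V p i \<inter> profile V p j = {}"
      by (auto simp: profile_def)
  qed
  ultimately show ?thesis
    unfolding num4_def blowup_count_def perms321_def by (simp add: card_profile_cls[of V p, OF assms])
qed

section \<open>Vertices in many non-clusters, and twins\<close>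

lemma double_count:
  assumes "finite P" "finite Q"
    and "\<And>p. p \<in> P \<Longrightarrow> a \<le> card {q \<in> Q. R p q}" "\<And>q. q \<in> Q \<Longrightarrow> card {p \<in> P. R p q} \<le> b"
  shows "card P * a \<le> card Q * b"
proof -
  have "card P * a = (\<Sum>p\<in>P. a)" by simp
  also have "\<dots> \<le> (\<Sum>p\<in>P. card {q \<in> Q. R p q})" using assms(3) by (rule sum_mono)
  also have "\<dots> = (\<Sum>p\<in>P. \<Sum>q\<in>Q. of_bool (R p q))"
    by (intro sum.cong refl card_filter_eq_sum assms(2))
  also have "\<dots> = (\<Sum>q\<in>Q. \<Sum>p\<in>P. of_bool (R p q))" by (rule sum.swap)
  also have "\<dots> = (\<Sum>q\<in>Q. card {p \<in> P. R p q})"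
    by (intro sum.cong refl card_filter_eq_sum[symmetric] assms(1))
  also have "\<dots> \<le> (\<Sum>q\<in>Q. b)" using assms(4) by (rule sum_mono)
  also have "\<dots> = card Q * b" by simp
  finally show ?thesis .
qed

lemma bad6_at_ge_pairs:
  assumes V: "finite V" "x \<in> V" and P: "P \<subseteq> V \<times> V"
    and bad: "\<And>y z S. (y, z) \<in> P \<Longrightarrow> S \<in> ksub 6 V \<Longrightarrow> {x, y, z} \<subseteq> S \<Longrightarrow> \<not> cluster3 r S"
    and dist: "\<And>y z. (y, z) \<in> P \<Longrightarrow> x \<noteq> y \<and> x \<noteq> z \<and> y \<noteq> z"
  shows "card P * ((card V - 3) choose 3) \<le> bad6_at r V x * 36"
  unfolding bad6_at_def
proof (rule double_count[where R = "\<lambda>p S. fst p \<in> S \<and> snd p \<in> S"])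
  show "finite P" using P V(1) by (meson finite_SigmaI finite_subset)
  show "finite {S \<in> ksub 6 V. x \<in> S \<and> \<not> cluster3 r S}" using V(1) by (simp add: finite_ksub)
  fix q assume "q \<in> P"
  then obtain y z where q: "q = (y, z)" "(y, z) \<in> P" by (cases q) auto
  then have yz: "y \<in> V" "z \<in> V" using P by auto
  have "card {x, y, z} = 3" using dist[OF q(2)] by simp
  then have eq: "(card V - 3) choose 3 = card {S \<in> ksub 6 V. {x, y, z} \<subseteq> S}"
    using card_ksub_superset[OF V(1), of "{x, y, z}" 6] V(2) yz by simp
  have "{S \<in> ksub 6 V. {x, y, z} \<subseteq> S} \<subseteq> {S \<in> {S \<in> ksub 6 V. x \<in> S \<and> \<not> cluster3 r S}. fst q \<in> S \<and> snd q \<in> S}"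
    using bad[OF q(2)] q(1) by auto
  then have "card {S \<in> ksub 6 V. {x, y, z} \<subseteq> S} \<le> card {S \<in> {S \<in> ksub 6 V. x \<in> S \<and> \<not> cluster3 r S}. fst q \<in> S \<and> snd q \<in> S}"
    using V(1) by (intro card_mono) (auto simp: finite_ksub)
  then show "(card V - 3) choose 3 \<le> card {S \<in> {S \<in> ksub 6 V. x \<in> S \<and> \<not> cluster3 r S}. fst q \<in> S \<and> snd q \<in> S}"
    unfolding eq .
next
  fix S assume "S \<in> {S \<in> ksub 6 V. x \<in> S \<and> \<not> cluster3 r S}"
  then have S: "card S = 6" "finite S" using V(1) finite_subset by (auto simp: ksub_def)
  have "card {p \<in> P. fst p \<in> S \<and> snd p \<in> S} \<le> card (S \<times> S)"
    using S by (intro card_mono) (auto simp: mem_Times_iff)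
  then show "card {p \<in> P. fst p \<in> S \<and> snd p \<in> S} \<le> 36" using S by (simp add: card_cartesian_product)
qed

lemma bad6_at_ge_triples:
  assumes V: "finite V" "x \<in> V" and P: "P \<subseteq> V \<times> V \<times> V"
    and bad: "\<And>y z w S. (y, z, w) \<in> P \<Longrightarrow> S \<in> ksub 6 V \<Longrightarrow> {x, y, z, w} \<subseteq> S \<Longrightarrow> \<not> cluster3 r S"
    and dist: "\<And>y z w. (y, z, w) \<in> P \<Longrightarrow> distinct [x, y, z, w]"
  shows "card P * ((card V - 4) choose 2) \<le> bad6_at r V x * 216"
  unfolding bad6_at_def
proof (rule double_count[where R = "\<lambda>p S. fst p \<in> S \<and> fst (snd p) \<in> S \<and> snd (snd p) \<in> S"])
  show "finite P" using P V(1) by (meson finite_SigmaI finite_subset)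
  show "finite {S \<in> ksub 6 V. x \<in> S \<and> \<not> cluster3 r S}" using V(1) by (simp add: finite_ksub)
  fix q assume "q \<in> P"
  then obtain y z w where q: "q = (y, z, w)" "(y, z, w) \<in> P" by (cases q) auto
  then have yz: "y \<in> V" "z \<in> V" "w \<in> V" using P by auto
  have "card {x, y, z, w} = 4" using dist[OF q(2)] by simp
  then have eq: "(card V - 4) choose 2 = card {S \<in> ksub 6 V. {x, y, z, w} \<subseteq> S}"
    using card_ksub_superset[OF V(1), of "{x, y, z, w}" 6] V(2) yz by simp
  have "{S \<in> ksub 6 V. {x, y, z, w} \<subseteq> S} \<subseteq> {S \<in> {S \<in> ksub 6 V. x \<in> S \<and> \<not> cluster3 r S}. fst q \<in> S \<and> fst (snd q) \<in> S \<and> snd (snd q) \<in> S}"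
    using bad[OF q(2)] q(1) by auto
  then have "card {S \<in> ksub 6 V. {x, y, z, w} \<subseteq> S} \<le> card {S \<in> {S \<in> ksub 6 V. x \<in> S \<and> \<not> cluster3 r S}. fst q \<in> S \<and> fst (snd q) \<in> S \<and> snd (snd q) \<in> S}"
    using V(1) by (intro card_mono) (auto simp: finite_ksub)
  then show "(card V - 4) choose 2 \<le> card {S \<in> {S \<in> ksub 6 V. x \<in> S \<and> \<not> cluster3 r S}. fst q \<in> S \<and> fst (snd q) \<in> S \<and> snd (snd q) \<in> S}"
    unfolding eq .
next
  fix S assume "S \<in> {S \<in> ksub 6 V. x \<in> S \<and> \<not> cluster3 r S}"
  then have S: "card S = 6" "finite S" using V(1) finite_subset by (auto simp: ksub_def)
  have "card {p \<in> P. fst p \<in> S \<and> fst (snd p) \<in> S \<and> snd (snd p) \<in> S} \<le> card (S \<times> S \<times> S)"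
    using S by (intro card_mono) (auto simp: mem_Times_iff)
  then show "card {p \<in> P. fst p \<in> S \<and> fst (snd p) \<in> S \<and> snd (snd p) \<in> S} \<le> 216" using S by (simp add: card_cartesian_product)
qed

lemma not_cluster3_path:
  assumes "x \<in> S" "y \<in> S" "z \<in> S" "r x y" "r y z" "x \<noteq> z" "\<not> r x z"
  shows "\<not> cluster3 r S"
  using assms unfolding cluster3_def by blast

lemma not_cluster3_indep:
  assumes "W \<subseteq> S" "card W = 4" "\<And>x y. x \<in> W \<Longrightarrow> y \<in> W \<Longrightarrow> \<not> r x y"
  shows "\<not> cluster3 r S"
  using assms unfolding cluster3_def by blast

definition wdeg :: "('a \<Rightarrow> 'a \<Rightarrow> bool) \<Rightarrow> 'a set \<Rightarrow> ('a \<Rightarrow> nat) \<Rightarrow> 'a \<Rightarrow> nat" where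
  "wdeg r V p x = card {y \<in> V. wrong r p x y}"

lemma wrong_sym: "symp r \<Longrightarrow> wrong r p x y \<longleftrightarrow> wrong r p y x"
  unfolding wrong_def by (metis sympD)

lemma defects_remove:
  assumes r: "symp r" and V: "finite V" "x \<in> V"
  shows "defects r V p = defects r (V - {x}) p + 2 * wdeg r V p x"
proof -
  let ?D = "\<lambda>V. {(x, y). x \<in> V \<and> y \<in> V \<and> wrong r p x y}"
  let ?N = "{y \<in> V. wrong r p x y}"
  have irr: "\<not> wrong r p x x" by (simp add: wrong_def)
  have eq: "?D V = ?D (V - {x}) \<union> ((Pair x ` ?N) \<union> ((\<lambda>y. (y, x)) ` ?N))"
  proof
    show "?D V \<subseteq> ?D (V - {x}) \<union> ((Pair x ` ?N) \<union> ((\<lambda>y. (y, x)) ` ?N))"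
      using wrong_sym[OF r, of p x] by auto
    show "?D (V - {x}) \<union> ((Pair x ` ?N) \<union> ((\<lambda>y. (y, x)) ` ?N)) \<subseteq> ?D V"
      using wrong_sym[OF r, of p x] V(2) by auto
  qed
  have f: "finite (?D (V - {x}))" by (rule finite_subset[of _ "V \<times> V"]) (use V in auto)
  have fN: "finite ?N" using V by simp
  have d1: "(Pair x ` ?N) \<inter> ((\<lambda>y. (y, x)) ` ?N) = {}" using irr by auto
  have d2: "?D (V - {x}) \<inter> ((Pair x ` ?N) \<union> ((\<lambda>y. (y, x)) ` ?N)) = {}" by auto
  have c: "card (Pair x ` ?N) = card ?N" "card ((\<lambda>y. (y, x)) ` ?N) = card ?N"
    by (simp_all add: card_image inj_on_def)
  show ?thesis
    unfolding defects_def wdeg_def eq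
    using card_Un_disjoint[OF f _ d2] card_Un_disjoint[OF _ _ d1] fN c by simp
qed

lemma defects_cong:
  assumes "\<And>x y. x \<in> V \<Longrightarrow> y \<in> V \<Longrightarrow> wrong r p x y = wrong r' p' x y"
  shows "defects r V p = defects r' V p'"
  unfolding defects_def using assms by (intro arg_cong[where f = card]) auto

lemma edges_in_cong:
  assumes "\<And>x y. x \<in> S \<Longrightarrow> y \<in> S \<Longrightarrow> r x y = r' x y"
  shows "edges_in r S = edges_in r' S"
  unfolding edges_in_def using assms by (intro arg_cong[where f = card]) blast

lemma edges_in_image:
  assumes "inj_on f S" "\<And>x y. x \<in> S \<Longrightarrow> y \<in> S \<Longrightarrow> r' (f x) (f y) = r x y"
  shows "edges_in r' (f ` S) = edges_in r S"
proof -
  have "{{x, y} | x y. x \<in> f ` S \<and> y \<in> f ` S \<and> r' x y} = (`) f ` {{x, y} | x y. x \<in> S \<and> y \<in> S \<and> r x y}"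
  proof (intro set_eqI iffI)
    fix e assume "e \<in> {{x, y} | x y. x \<in> f ` S \<and> y \<in> f ` S \<and> r' x y}"
    then obtain x y where e: "e = {f x, f y}" "x \<in> S" "y \<in> S" "r' (f x) (f y)" by auto
    then have "e = f ` {x, y}" "r x y" using assms(2) by auto
    then show "e \<in> (`) f ` {{x, y} | x y. x \<in> S \<and> y \<in> S \<and> r x y}" using e by blast
  next
    fix e assume "e \<in> (`) f ` {{x, y} | x y. x \<in> S \<and> y \<in> S \<and> r x y}"
    then obtain x y where e: "e = f ` {x, y}" "x \<in> S" "y \<in> S" "r x y" by auto
    then have "e = {f x, f y}" "r' (f x) (f y)" using assms(2) by auto
    then show "e \<in> {{x, y} | x y. x \<in> f ` S \<and> y \<in> f ` S \<and> r' x y}" using e by blast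
  qed
  moreover have "inj_on ((`) f) {{x, y} | x y. x \<in> S \<and> y \<in> S \<and> r x y}"
    by (rule inj_on_subset[OF inj_on_image_Pow[OF assms(1)]]) auto
  ultimately show ?thesis unfolding edges_in_def by (simp add: card_image)
qed

lemma num4_remove:
  assumes V: "finite V" "x \<in> V"
  shows "num4 r V = num4 r (V - {x}) + num4_at r V x"
proof -
  let ?A = "{S \<in> ksub 6 (V - {x}). edges_in r S = 4}" and ?B = "{S \<in> ksub 6 V. x \<in> S \<and> edges_in r S = 4}"
  have "{S \<in> ksub 6 V. edges_in r S = 4} = ?A \<union> ?B" by (auto simp: ksub_def)
  moreover have "?A \<inter> ?B = {}" by (auto simp: ksub_def)
  moreover have "finite ?A" "finite ?B" using V by (simp_all add: finite_ksub)
  ultimately show ?thesis unfolding num4_def num4_at_def by (simp add: card_Un_disjoint)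
qed

lemma num4_cong:
  assumes "\<And>x y. x \<in> V \<Longrightarrow> y \<in> V \<Longrightarrow> r x y = r' x y"
  shows "num4 r V = num4 r' V"
proof -
  have "edges_in r S = edges_in r' S" if "S \<in> ksub 6 V" for S
    by (rule edges_in_cong) (use that assms in \<open>auto simp: ksub_def\<close>)
  then show ?thesis unfolding num4_def by (intro arg_cong[where f = card]) auto
qed

lemma sum_num4_at:
  assumes "finite V"
  shows "(\<Sum>x\<in>V. num4_at r V x) = 6 * num4 r V"
proof -
  let ?F = "{S \<in> ksub 6 V. edges_in r S = 4}"
  have f: "finite ?F" using assms by (simp add: finite_ksub)
  have "(\<Sum>x\<in>V. num4_at r V x) = (\<Sum>x\<in>V. \<Sum>S\<in>?F. of_bool (x \<in> S))"
  proof (intro sum.cong refl)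
    fix x
    have "{S \<in> ksub 6 V. x \<in> S \<and> edges_in r S = 4} = {S \<in> ?F. x \<in> S}" by auto
    then show "num4_at r V x = (\<Sum>S\<in>?F. of_bool (x \<in> S))"
      unfolding num4_at_def using card_filter_eq_sum[OF f] by simp
  qed
  also have "\<dots> = (\<Sum>S\<in>?F. \<Sum>x\<in>V. of_bool (x \<in> S))" by (rule sum.swap)
  also have "\<dots> = (\<Sum>S\<in>?F. 6)"
  proof (intro sum.cong refl)
    fix S assume "S \<in> ?F"
    then have "V \<inter> S = S" "card S = 6" by (auto simp: ksub_def)
    then show "(\<Sum>x\<in>V. of_bool (x \<in> S)) = (6 :: nat)" using assms by simp
  qed
  finally show ?thesis unfolding num4_def by simp
qed

lemma card_ksub_containing_le:
  assumes "finite V" "P \<subseteq> V" "card P \<le> 6"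
  shows "real (card {S \<in> ksub 6 V. P \<subseteq> S}) \<le> real (card V) ^ (6 - card P)"
proof -
  have "card {S \<in> ksub 6 V. P \<subseteq> S} \<le> (card V - card P) ^ (6 - card P)"
    unfolding card_ksub_superset[OF assms] by (rule binomial_le_power)
  also have "\<dots> \<le> card V ^ (6 - card P)" by (intro power_mono) auto
  finally show ?thesis using of_nat_mono by fastforce
qed

text \<open>The relation in which \<open>x\<close> is replaced by a nonadjacent twin of \<open>w\<close>.\<close>

definition clone :: "('a \<Rightarrow> 'a \<Rightarrow> bool) \<Rightarrow> 'a \<Rightarrow> 'a \<Rightarrow> 'a \<Rightarrow> 'a \<Rightarrow> bool" where
  "clone r w x u v = (let f = (\<lambda>u. if u = x then w else u) in r (f u) (f v))"

text \<open>The 6-sets avoiding \<open>x\<close> do not change, and those through \<open>x\<close> but not \<open>w\<close> correspond to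
  6-sets through \<open>w\<close>; the sets through both are the error term.\<close>

lemma num4_clone:
  assumes V: "finite V" "x \<in> V" "w \<in> V" "x \<noteq> w"
  shows "real (num4 (clone r w x) V) \<ge> real (num4 r V) - real (num4_at r V x) + real (num4_at r V w) - real (card V) ^ 4"
proof -
  let ?c = "clone r w x"
  let ?A = "{S \<in> ksub 6 V. w \<in> S \<and> edges_in r S = 4}"
  let ?B = "{S \<in> ksub 6 V. {w, x} \<subseteq> S}"
  define h where "h u = (if u = w then x else u)" for u
  have f: "finite ?A" "finite ?B" using V by (simp_all add: finite_ksub)
  have "(`) h ` (?A - ?B) \<subseteq> {S \<in> ksub 6 V. x \<in> S \<and> edges_in ?c S = 4}"
  proof
    fix R assume "R \<in> (`) h ` (?A - ?B)"
    then obtain S where R: "R = h ` S" and S: "S \<in> ksub 6 V" "w \<in> S" "edges_in r S = 4" and x: "x \<notin> S" by auto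
    have inj: "inj_on h S" using x by (auto simp: inj_on_def h_def)
    have "edges_in ?c (h ` S) = 4"
      using S(3) x V(4) by (subst edges_in_image[OF inj, where r = r]) (auto simp: clone_def h_def)
    moreover have "h ` S \<subseteq> V" using S(1) V by (auto simp: h_def ksub_def)
    moreover have "card (h ` S) = 6" using S(1) by (simp add: card_image[OF inj] ksub_def)
    moreover have "x \<in> h ` S" using S(2) by (force simp: h_def)
    ultimately show "R \<in> {S \<in> ksub 6 V. x \<in> S \<and> edges_in ?c S = 4}" by (simp add: ksub_def R)
  qed
  moreover have "inj_on ((`) h) (?A - ?B)"
  proof (rule inj_onI)
    fix S S' assume S: "S \<in> ?A - ?B" "S' \<in> ?A - ?B" "h ` S = h ` S'"
    have rec: "R = insert w (h ` R - {x})" if "R \<in> ?A - ?B" for R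
      using that V(4) by (auto simp: h_def)
    show "S = S'" using rec[OF S(1)] rec[OF S(2)] S(3) by simp
  qed
  ultimately have "card (?A - ?B) \<le> num4_at ?c V x"
    unfolding num4_at_def using V(1) by (intro card_inj_on_le) (auto simp: finite_ksub)
  moreover have "real (card ?A) - real (card ?B) \<le> real (card (?A - ?B))"
    using diff_card_le_card_Diff[OF f(2), of ?A] by linarith
  moreover have "real (card ?B) \<le> real (card V) ^ 4"
    using card_ksub_containing_le[of V "{w, x}"] V by simp
  moreover have "num4 ?c (V - {x}) = num4 r (V - {x})"
    by (rule num4_cong) (auto simp: clone_def)
  ultimately show ?thesis
    using num4_remove[OF V(1,2), of r] num4_remove[OF V(1,2), of ?c]
    unfolding num4_at_def[of r V w] by linarith
qed

lemma wdeg_le: "finite V \<Longrightarrow> wdeg r V p x \<le> card V"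
  unfolding wdeg_def by (intro card_mono) auto

lemma defects_clone:
  assumes "symp r" "irreflp r" "finite V" "x \<in> V"
  shows "defects r V p \<le> defects (clone r w x) V p + 2 * card V"
proof -
  have "symp (clone r w x)" using assms(1) by (auto simp: symp_def clone_def Let_def)
  then have "defects (clone r w x) V p = defects (clone r w x) (V - {x}) p + 2 * wdeg (clone r w x) V p x"
    using assms by (intro defects_remove)
  moreover have "defects (clone r w x) (V - {x}) p = defects r (V - {x}) p"
    by (rule defects_cong) (auto simp: wrong_def clone_def)
  ultimately show ?thesis
    using defects_remove[OF assms(1,3,4), of p] wdeg_le[OF assms(3), of r p x] by simp
qed

lemma edges_in_no_wrong:
  assumes "irreflp r" "\<And>x y. x \<in> S \<Longrightarrow> y \<in> S \<Longrightarrow> \<not> wrong r p x y"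
  shows "edges_in r S = edges_in (same_class p) S"
proof (rule edges_in_cong)
  fix x y assume "x \<in> S" "y \<in> S"
  then have "\<not> wrong r p x y" by (rule assms(2))
  then show "r x y = same_class p x y"
    using assms(1) by (cases "x = y") (auto simp: wrong_def same_class_def dest: irreflpD)
qed

lemma card_containing_wrong:
  assumes V: "finite V"
  shows "real (card {S \<in> ksub 6 V. \<exists>x\<in>S. \<exists>y\<in>S. wrong r p x y}) \<le> real (defects r V p) * real (card V) ^ 4"
proof -
  let ?D = "{(x, y). x \<in> V \<and> y \<in> V \<and> wrong r p x y}"
  have f: "finite ?D" by (rule finite_subset[of _ "V \<times> V"]) (use V in auto)
  have "{S \<in> ksub 6 V. \<exists>x\<in>S. \<exists>y\<in>S. wrong r p x y} \<subseteq> (\<Union>(x, y)\<in>?D. {S \<in> ksub 6 V. {x, y} \<subseteq> S})"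
    by (auto simp: ksub_def)
  then have "card {S \<in> ksub 6 V. \<exists>x\<in>S. \<exists>y\<in>S. wrong r p x y} \<le> card (\<Union>(x, y)\<in>?D. {S \<in> ksub 6 V. {x, y} \<subseteq> S})"
    using f V by (intro card_mono) (auto simp: finite_ksub)
  also have "\<dots> \<le> (\<Sum>e\<in>?D. card (case e of (x, y) \<Rightarrow> {S \<in> ksub 6 V. {x, y} \<subseteq> S}))"
    by (rule card_UN_le[OF f])
  finally have "real (card {S \<in> ksub 6 V. \<exists>x\<in>S. \<exists>y\<in>S. wrong r p x y})
     \<le> real (\<Sum>e\<in>?D. card (case e of (x, y) \<Rightarrow> {S \<in> ksub 6 V. {x, y} \<subseteq> S}))" by (rule of_nat_mono)
  also have "\<dots> = (\<Sum>e\<in>?D. real (card (case e of (x, y) \<Rightarrow> {S \<in> ksub 6 V. {x, y} \<subseteq> S})))" by simp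
  also have "\<dots> \<le> (\<Sum>e\<in>?D. real (card V) ^ 4)"
  proof (intro sum_mono)
    fix e assume "e \<in> ?D"
    then obtain x y where e: "e = (x, y)" "x \<in> V" "y \<in> V" "x \<noteq> y" by (auto simp: wrong_def)
    show "real (card (case e of (x, y) \<Rightarrow> {S \<in> ksub 6 V. {x, y} \<subseteq> S})) \<le> real (card V) ^ 4"
      using card_ksub_containing_le[of V "{x, y}"] V e by simp
  qed
  finally show ?thesis unfolding defects_def by simp
qed

text \<open>Only 6-sets that contain a wrong pair are counted differently.\<close>

lemma num4_le_same_class:
  assumes "irreflp r" "finite V"
  shows "real (num4 r V) \<le> real (num4 (same_class p) V) + real (defects r V p) * real (card V) ^ 4"
proof -
  let ?W = "{S \<in> ksub 6 V. \<exists>x\<in>S. \<exists>y\<in>S. wrong r p x y}"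
  have "{S \<in> ksub 6 V. edges_in r S = 4} \<subseteq> {S \<in> ksub 6 V. edges_in (same_class p) S = 4} \<union> ?W"
    using edges_in_no_wrong[OF assms(1), of _ p] by force
  then have "num4 r V \<le> card ({S \<in> ksub 6 V. edges_in (same_class p) S = 4} \<union> ?W)"
    unfolding num4_def using assms(2) by (intro card_mono) (auto simp: finite_ksub)
  also have "\<dots> \<le> num4 (same_class p) V + card ?W"
    unfolding num4_def by (rule card_Un_le)
  finally have "real (num4 r V) \<le> real (num4 (same_class p) V) + real (card ?W)"
    by (simp flip: of_nat_add)
  with card_containing_wrong[OF assms(2), of r p] show ?thesis by linarith
qed

section \<open>Class sizes and wrong pairs at a vertex\<close>

lemma sym_poly_bound:
  fixes x y z :: real
  assumes "0 \<le> x" "0 \<le> y" "0 \<le> z" "x + y + z = 1"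
  shows "x^3*y^2*z + x^3*y*z^2 + x^2*y^3*z + x^2*y*z^3 + x*y^3*z^2 + x*y^2*z^3
     \<le> 2 / 243 - ((x - 1/3)^2 + (y - 1/3)^2 + (z - 1/3)^2) / 81"
proof -
  define s where "s = x*y + x*z + y*z"
  define t where "t = x*y*z"
  have sq: "(x + y + z)^2 = 1" using assms(4) by simp
  have F: "x^3*y^2*z + x^3*y*z^2 + x^2*y^3*z + x^2*y*z^3 + x*y^3*z^2 + x*y^2*z^3 = t * ((x + y + z) * s - 3 * t)"
    unfolding s_def t_def by algebra
  have Q: "(x - 1/3)^2 + (y - 1/3)^2 + (z - 1/3)^2 = (x + y + z)^2 - 2 * s - 2 / 3 * (x + y + z) + 1 / 3"
    unfolding s_def by (simp add: power2_eq_square algebra_simps)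
  have Q': "(x - 1/3)^2 + (y - 1/3)^2 + (z - 1/3)^2 = 2 / 3 - 2 * s" unfolding Q assms(4) by simp
  have s0: "0 \<le> s" unfolding s_def using assms by simp
  have "0 \<le> (x - 1/3)^2 + (y - 1/3)^2 + (z - 1/3)^2" by simp
  then have s1: "s \<le> 1/3" unfolding Q' by simp
  have e: "s^2 - 3 * (x + y + z) * t = ((x*y - x*z)^2 + (x*y - y*z)^2 + (x*z - y*z)^2) / 2"
    unfolding s_def t_def by (simp add: power2_eq_square field_simps)
  have "0 \<le> s^2 - 3 * (x + y + z) * t" unfolding e by simp
  then have t1: "3 * t \<le> s^2" unfolding assms(4) by simp
  have ss: "s^2 \<le> s / 3" using mult_left_mono[OF s1 s0] by (simp add: power2_eq_square)
  have "0 \<le> (s^2 / 3 - t) * (s - (s^2 + 3 * t))"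
    using t1 ss s0 s1 by (intro mult_nonneg_nonneg) linarith+
  then have a: "t * (s - 3 * t) \<le> s^2 / 3 * (s - s^2)"
    by (simp add: algebra_simps power2_eq_square)
  have "0 \<le> s * ((1/3 - s) * (2/9 + 2/3 * s - s^2)) / 3"
    using s0 s1 ss by (intro divide_nonneg_nonneg mult_nonneg_nonneg) linarith+
  also have "s * ((1/3 - s) * (2/9 + 2/3 * s - s^2)) / 3 = 2 / 81 * s - s^2 / 3 * (s - s^2)"
    by (simp add: field_simps power2_eq_square)
  finally have b: "s^2 / 3 * (s - s^2) \<le> 2 / 81 * s" by simp
  have c: "2 / 243 - (2 / 3 - 2 * s) / 81 = 2 / 81 * s" by (simp add: field_simps)
  show ?thesis unfolding F Q' assms(4) c mult_1 by (rule order_trans[OF a b])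
qed

lemma choose_le_real: "real (n choose k) \<le> real n ^ k / fact k"
proof -
  have "(n choose k) * fact k \<le> n ^ k" by (rule binomial_fact_pow)
  then have "real ((n choose k) * fact k) \<le> real (n ^ k)" by (rule of_nat_mono)
  then show ?thesis by (simp add: pos_le_divide_eq)
qed

lemma fact_choose_ge: "(n - k) ^ k \<le> fact k * (n choose k)"
proof (induction k arbitrary: n)
  case (Suc k)
  have "(n - Suc k) ^ Suc k = (n - Suc k) * (n - 1 - k) ^ k" by simp
  also have "\<dots> \<le> n * (fact k * ((n - 1) choose k))" by (intro mult_le_mono Suc.IH) simp
  also have "\<dots> = fact k * (Suc k * (n choose Suc k))"
    by (cases n) (simp_all add: Suc_times_binomial_eq mult.commute mult.left_commute del: binomial_Suc_Suc mult_Suc mult_Suc_right)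
  also have "\<dots> = fact (Suc k) * (n choose Suc k)" by (simp add: algebra_simps)
  finally show ?case .
qed simp

lemma choose_ge_real: "k \<le> n \<Longrightarrow> (real n - real k) ^ k / fact k \<le> real (n choose k)"
proof -
  assume k: "k \<le> n"
  have "real ((n - k) ^ k) \<le> real (fact k * (n choose k))" using fact_choose_ge by (rule of_nat_mono)
  then show ?thesis using k by (simp add: pos_divide_le_eq of_nat_diff mult.commute)
qed

lemma choose6_ge:
  assumes "n \<ge> 6"
  shows "real (n choose 6) \<ge> (real n ^ 6 - 36 * real n ^ 5) / 720"
proof -
  have n: "real n > 0" using assms by simp
  have "1 + real 6 * (- 6 / real n) \<le> (1 + (- 6 / real n)) ^ 6"
    using assms by (intro Bernoulli_inequality) (simp add: field_simps)
  then have "real n ^ 6 * (1 + 6 * (- 6 / real n)) \<le> real n ^ 6 * (1 + (- 6 / real n)) ^ 6"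
    by (intro mult_left_mono) auto
  also have "\<dots> = (real n - 6) ^ 6"
    using n by (simp add: power_mult_distrib[symmetric] ring_distribs)
  also have "real n ^ 6 * (1 + 6 * (- 6 / real n)) = real n ^ 6 - 36 * real n ^ 5"
    using n by (simp add: algebra_simps eval_nat_numeral)
  finally have "real n ^ 6 - 36 * real n ^ 5 \<le> (real n - 6) ^ 6" .
  moreover have "(real n - 6) ^ 6 / 720 \<le> real (n choose 6)"
    using choose_ge_real[of 6 n] assms by (simp add: fact_numeral)
  ultimately show ?thesis by simp
qed

lemma blowup_count_le:
  "real (blowup_count a b c) \<le> (real a^3*real b^2*real c + real a^3*real b*real c^2 + real a^2*real b^3*real c
     + real a^2*real b*real c^3 + real a*real b^3*real c^2 + real a*real b^2*real c^3) / 12"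
proof -
  have c2: "real (m choose 2) \<le> real m ^ 2 / 2" for m using choose_le_real[of m 2] by simp
  have c3: "real (m choose 3) \<le> real m ^ 3 / 6" for m using choose_le_real[of m 3] by (simp add: fact_numeral)
  have "real (blowup_count a b c) \<le> real a^3/6 * (real b^2/2) * real c + real a^3/6 * real b * (real c^2/2) + real a^2/2 * (real b^3/6) * real c
     + real a^2/2 * real b * (real c^3/6) + real a * (real b^3/6) * (real c^2/2) + real a * (real b^2/2) * (real c^3/6)"
    unfolding blowup_count_def of_nat_add of_nat_mult
    by (intro add_mono mult_mono c2 c3 mult_nonneg_nonneg) auto
  then show ?thesis by (simp add: field_simps)
qed

text \<open>With few wrong pairs the count is close to that of a blowup, and by \<open>sym_poly_bound\<close> the deficit of a blowup is
  at least quadratic in the deviation of the proportions from one third.\<close>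

lemma class_sizes:
  assumes r: "irreflp r" and V: "finite V" and p: "\<And>x. p x < 3"
    and n: "n = real (card V)" "n \<ge> 10000"
    and N: "97200 * real (num4 r V) \<ge> 48000 * real (card V choose 6) - \<delta> * n ^ 6"
    and W: "real (defects r V p) \<le> \<epsilon> * n ^ 2" and small: "\<delta> + 97200 * \<epsilon> \<le> 1 / 2"
    and i: "i < 3"
  shows "\<bar>real (card (cls V p i)) - n / 3\<bar> \<le> n / 10"
proof -
  define v where "v j = real (card (cls V p j))" for j
  define u where "u j = v j / n" for j
  have n0: "n > 0" using n(2) by simp
  have "card V = card (cls V p 0) + card (cls V p 1) + card (cls V p 2)"
    by (rule card_cls_sum[OF V p])
  then have vs: "v 0 + v 1 + v 2 = n" unfolding v_def n(1) by simp
  have u: "u j \<ge> 0" for j unfolding u_def v_def using n0 by simp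
  have us: "u 0 + u 1 + u 2 = 1" unfolding u_def using vs n0 by (simp add: add_divide_distrib[symmetric])
  have vu: "v j = n * u j" for j unfolding u_def using n0 by simp
  define F where "F = u 0^3*u 1^2*u 2 + u 0^3*u 1*u 2^2 + u 0^2*u 1^3*u 2 + u 0^2*u 1*u 2^3 + u 0*u 1^3*u 2^2 + u 0*u 1^2*u 2^3"
  define D where "D = (u 0 - 1/3)^2 + (u 1 - 1/3)^2 + (u 2 - 1/3)^2"
  have FD: "F \<le> 2/243 - D / 81" unfolding F_def D_def by (rule sym_poly_bound[OF u u u us])
  have "real (num4 (same_class p) V) \<le> n ^ 6 * F / 12"
  proof -
    have "real (num4 (same_class p) V) \<le> (v 0^3*v 1^2*v 2 + v 0^3*v 1*v 2^2 + v 0^2*v 1^3*v 2 + v 0^2*v 1*v 2^3 + v 0*v 1^3*v 2^2 + v 0*v 1^2*v 2^3) / 12"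
      unfolding num4_same_class[OF V p] v_def by (rule blowup_count_le)
    also have "\<dots> = n ^ 6 * F / 12"
      unfolding vu F_def by (simp add: power_mult_distrib algebra_simps eval_nat_numeral)
    finally show ?thesis .
  qed
  moreover have "real (num4 r V) \<le> real (num4 (same_class p) V) + real (defects r V p) * n ^ 4"
    unfolding n(1) by (rule num4_le_same_class[OF r V])
  moreover have "real (defects r V p) * n ^ 4 \<le> \<epsilon> * n ^ 6"
    using mult_right_mono[OF W, of "n ^ 4"] n0 by (simp add: mult.assoc flip: power_add)
  ultimately have "97200 * real (num4 r V) \<le> 8100 * (n ^ 6 * F) + 97200 * (\<epsilon> * n ^ 6)" by linarith
  moreover have "48000 * real (card V choose 6) \<ge> 200 / 3 * (n ^ 6 - 36 * n ^ 5)"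
    using choose6_ge[of "card V"] n by simp
  moreover have "36 * n ^ 5 \<le> 36 / 10000 * n ^ 6"
  proof -
    have "10000 * n ^ 5 \<le> n * n ^ 5" using n(2) by (intro mult_right_mono) auto
    then show ?thesis by (simp add: eval_nat_numeral)
  qed
  moreover have "200 / 3 * A - 24 / 100 * A - d \<le> 8100 * G + 97200 * E"
    if "97200 * X \<le> 8100 * G + 97200 * E" "200 / 3 * (A - 36 * B) \<le> 48000 * C" "36 * B \<le> 36 / 10000 * A"
      "48000 * C - d \<le> 97200 * X" for A B C X G E d :: real
    using that by argo
  ultimately have "200 / 3 * n ^ 6 - 24 / 100 * n ^ 6 - \<delta> * n ^ 6 \<le> 8100 * (n ^ 6 * F) + 97200 * (\<epsilon> * n ^ 6)"
    using N by blast
  then have "n ^ 6 * (200 / 3 - 24 / 100) \<le> n ^ 6 * (8100 * F + (\<delta> + 97200 * \<epsilon>))" by (simp add: algebra_simps)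
  then have "200 / 3 - 24 / 100 \<le> 8100 * F + (\<delta> + 97200 * \<epsilon>)" using n0 by simp
  with small FD have "D \<le> 1 / 100" by linarith
  moreover have "(u i - 1/3)^2 \<le> D"
  proof -
    have "i = 0 \<or> i = 1 \<or> i = 2" using i by linarith
    then show ?thesis unfolding D_def by auto
  qed
  ultimately have "(u i - 1/3)^2 \<le> (1/10)^2" by (simp add: power2_eq_square)
  then have "\<bar>u i - 1/3\<bar> \<le> 1/10" by (simp add: abs_le_square_iff[symmetric])
  moreover have "real (card (cls V p i)) - n / 3 = n * (u i - 1/3)"
    unfolding v_def[symmetric] vu by (simp add: algebra_simps)
  ultimately show ?thesis using n0 by (simp add: abs_mult)
qed

lemma card_not_wrong_pairs:
  assumes V: "finite V" and Y: "Y \<subseteq> V" "Z \<subseteq> V"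
  shows "real (card Y) * real (card Z) - real (defects r V p) \<le> real (card {(y, z). y \<in> Y \<and> z \<in> Z \<and> \<not> wrong r p y z})"
proof -
  let ?D = "{(x, y). x \<in> V \<and> y \<in> V \<and> wrong r p x y}"
  have f: "finite ?D" by (rule finite_subset[of _ "V \<times> V"]) (use V in auto)
  have "real (card (Y \<times> Z)) - real (card ?D) \<le> real (card (Y \<times> Z - ?D))"
    using diff_card_le_card_Diff[OF f, of "Y \<times> Z"] by linarith
  also have "card (Y \<times> Z - ?D) \<le> card {(y, z). y \<in> Y \<and> z \<in> Z \<and> \<not> wrong r p y z}"
  proof (rule card_mono)
    show "finite {(y, z). y \<in> Y \<and> z \<in> Z \<and> \<not> wrong r p y z}"
      by (rule finite_subset[of _ "V \<times> V"]) (use V Y in auto)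
  qed (use Y in auto)
  finally show ?thesis unfolding defects_def by (simp add: card_cartesian_product)
qed

lemma choose_n3: "n \<ge> 100 \<Longrightarrow> real ((n - 3) choose 3) \<ge> real n ^ 3 / 12"
proof -
  assume n: "n \<ge> 100"
  have "(real (n - 3) - real 3) ^ 3 / fact 3 \<le> real ((n - 3) choose 3)"
    using n by (intro choose_ge_real) simp
  then have a: "(real n - 6) ^ 3 / 6 \<le> real ((n - 3) choose 3)" using n by (simp add: of_nat_diff fact_numeral)
  have "(9/10 * real n) ^ 3 \<le> (real n - 6) ^ 3" using n by (intro power_mono) auto
  then have "729/1000 * real n ^ 3 \<le> (real n - 6) ^ 3" by (simp add: power_mult_distrib power_divide)
  moreover have "real n ^ 3 \<ge> 0" by simp
  ultimately show ?thesis using a by linarith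
qed

lemma choose_n4: "n \<ge> 100 \<Longrightarrow> real ((n - 4) choose 2) \<ge> real n ^ 2 / 4"
proof -
  assume n: "n \<ge> 100"
  have "(real (n - 4) - real 2) ^ 2 / fact 2 \<le> real ((n - 4) choose 2)"
    using n by (intro choose_ge_real) simp
  then have a: "(real n - 6) ^ 2 / 2 \<le> real ((n - 4) choose 2)" using n by (simp add: of_nat_diff)
  have "(9/10 * real n) ^ 2 \<le> (real n - 6) ^ 2" using n by (intro power_mono) auto
  then have "81/100 * real n ^ 2 \<le> (real n - 6) ^ 2" by (simp add: power_mult_distrib power_divide)
  moreover have "real n ^ 2 \<ge> 0" by simp
  ultimately show ?thesis using a by linarith
qed

text \<open>If \<open>Y\<close> and \<open>Z\<close> are large, most pairs between them are not wrong, and each of these pairs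
  spoils all 6-sets that contain it and \<open>x\<close>.\<close>

lemma many_bad_of_pairs:
  assumes V: "finite V" "x \<in> V" and n: "n = real (card V)" "n \<ge> 100"
    and W: "real (defects r V p) \<le> \<eta> ^ 2 / 32 * n ^ 2" and \<eta>: "\<eta> > 0"
    and YZ: "Y \<subseteq> V - {x}" "Z \<subseteq> V - {x}" "Y \<inter> Z = {}" "real (card Y) \<ge> \<eta> / 4 * n" "real (card Z) \<ge> \<eta> / 4 * n"
    and bad: "\<And>y z S. y \<in> Y \<Longrightarrow> z \<in> Z \<Longrightarrow> \<not> wrong r p y z \<Longrightarrow> {x, y, z} \<subseteq> S \<Longrightarrow> \<not> cluster3 r S"
  shows "real (bad6_at r V x) \<ge> \<eta> ^ 2 / 13824 * n ^ 5"
proof -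
  let ?P = "{(y, z). y \<in> Y \<and> z \<in> Z \<and> \<not> wrong r p y z}"
  have YV: "Y \<subseteq> V" "Z \<subseteq> V" using YZ by auto
  have "\<eta> / 4 * n * (\<eta> / 4 * n) \<le> real (card Y) * real (card Z)"
    using YZ(4,5) \<eta> n(2) by (intro mult_mono) auto
  then have "\<eta> ^ 2 / 16 * n ^ 2 \<le> real (card Y) * real (card Z)" by (simp add: power2_eq_square algebra_simps)
  then have P: "\<eta> ^ 2 / 32 * n ^ 2 \<le> real (card ?P)"
    using card_not_wrong_pairs[OF V(1) YV, of r p] W by (simp add: algebra_simps)
  have "card ?P * ((card V - 3) choose 3) \<le> bad6_at r V x * 36"
  proof (rule bad6_at_ge_pairs[OF V])
    show "?P \<subseteq> V \<times> V" using YV by auto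
    show "\<And>y z S. (y, z) \<in> ?P \<Longrightarrow> S \<in> ksub 6 V \<Longrightarrow> {x, y, z} \<subseteq> S \<Longrightarrow> \<not> cluster3 r S" using bad by blast
    show "\<And>y z. (y, z) \<in> ?P \<Longrightarrow> x \<noteq> y \<and> x \<noteq> z \<and> y \<noteq> z" using YZ by blast
  qed
  then have "real (card ?P * ((card V - 3) choose 3)) \<le> real (bad6_at r V x * 36)" by (rule of_nat_mono)
  then have 1: "real (card ?P) * real ((card V - 3) choose 3) \<le> real (bad6_at r V x) * 36" by simp
  have "n ^ 3 / 12 \<le> real ((card V - 3) choose 3)" using choose_n3[of "card V"] n by simp
  then have "\<eta> ^ 2 / 32 * n ^ 2 * (n ^ 3 / 12) \<le> real (card ?P) * real ((card V - 3) choose 3)"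
    using P n(2) by (intro mult_mono) auto
  then have "\<eta> ^ 2 / 32 * n ^ 2 * (n ^ 3 / 12) \<le> real (bad6_at r V x) * 36" using 1 by (rule order_trans)
  moreover have "\<eta> ^ 2 / 32 * n ^ 2 * (n ^ 3 / 12) = \<eta> ^ 2 / 13824 * n ^ 5 * 36" by (simp add: eval_nat_numeral)
  ultimately have "\<eta> ^ 2 / 13824 * n ^ 5 * 36 \<le> real (bad6_at r V x) * 36" by (simp only:)
  then show ?thesis by (rule mult_right_le_imp_le) simp
qed

text \<open>Three nonneighbours of \<open>x\<close> from different classes without wrong pairs form with \<open>x\<close> an independent 4-set.\<close>

lemma many_bad_of_triples:
  assumes V: "finite V" "x \<in> V" and n: "n = real (card V)" "n \<ge> 100"
    and W: "real (defects r V p) \<le> n ^ 2 / 1000"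
    and Y: "\<And>i. i < 3 \<Longrightarrow> Y i \<subseteq> {y \<in> V - {x}. p y = i \<and> \<not> r x y}" "\<And>i. i < 3 \<Longrightarrow> real (card (Y i)) \<ge> n / 5"
    and r: "symp r" "irreflp r"
  shows "real (bad6_at r V x) \<ge> n ^ 5 / 172800"
proof -
  let ?P = "{(a, b, c). a \<in> Y 0 \<and> b \<in> Y 1 \<and> c \<in> Y 2 \<and> \<not> wrong r p a b \<and> \<not> wrong r p a c \<and> \<not> wrong r p b c}"
  let ?D = "{(x, y). x \<in> V \<and> y \<in> V \<and> wrong r p x y}"
  let ?T = "Y 0 \<times> Y 1 \<times> Y 2"
  have YV: "Y 0 \<subseteq> V" "Y 1 \<subseteq> V" "Y 2 \<subseteq> V" using Y(1)[of 0] Y(1)[of 1] Y(1)[of 2] by auto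
  have fD: "finite ?D" by (rule finite_subset[of _ "V \<times> V"]) (use V in auto)
  let ?B1 = "(\<lambda>((a, b), c). (a, b, c)) ` (?D \<times> V)" and ?B2 = "(\<lambda>((a, c), b). (a, b, c)) ` (?D \<times> V)"
    and ?B3 = "(\<lambda>((b, c), a). (a, b, c)) ` (?D \<times> V)"
  have cf: "card (f ` (?D \<times> V)) \<le> defects r V p * card V" for f :: "('a \<times> 'a) \<times> 'a \<Rightarrow> 'a \<times> 'a \<times> 'a"
    using card_image_le[of "?D \<times> V" f] fD V(1) unfolding defects_def card_cartesian_product by simp
  have cB: "card ?B1 \<le> defects r V p * card V" "card ?B2 \<le> defects r V p * card V" "card ?B3 \<le> defects r V p * card V"
    by (rule cf)+
  have fB: "finite (?B1 \<union> (?B2 \<union> ?B3))" using fD V by auto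
  have "card (?B1 \<union> (?B2 \<union> ?B3)) \<le> card ?B1 + (card ?B2 + card ?B3)"
    by (intro order_trans[OF card_Un_le] add_mono card_Un_le) simp
  then have "card (?B1 \<union> (?B2 \<union> ?B3)) \<le> 3 * (defects r V p * card V)" using cB by linarith
  then have "real (card (?B1 \<union> (?B2 \<union> ?B3))) \<le> real (3 * (defects r V p * card V))" by (rule of_nat_mono)
  also have "\<dots> = 3 * (real (defects r V p) * n)" by (simp add: n)
  also have "real (defects r V p) * n \<le> n ^ 2 / 1000 * n" using W n(2) by (intro mult_right_mono) auto
  finally have B: "real (card (?B1 \<union> (?B2 \<union> ?B3))) \<le> 3 / 1000 * n ^ 3" by (simp add: eval_nat_numeral)
  have sub: "?T - (?B1 \<union> (?B2 \<union> ?B3)) \<subseteq> ?P"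
  proof
    fix t assume t: "t \<in> ?T - (?B1 \<union> (?B2 \<union> ?B3))"
    then obtain a b c where abc: "t = (a, b, c)" "a \<in> Y 0" "b \<in> Y 1" "c \<in> Y 2" by auto
    have "wrong r p a b \<Longrightarrow> t \<in> ?B1" using abc YV by (intro image_eqI[of _ _ "((a, b), c)"]) auto
    moreover have "wrong r p a c \<Longrightarrow> t \<in> ?B2" using abc YV by (intro image_eqI[of _ _ "((a, c), b)"]) auto
    moreover have "wrong r p b c \<Longrightarrow> t \<in> ?B3" using abc YV by (intro image_eqI[of _ _ "((b, c), a)"]) auto
    ultimately show "t \<in> ?P" using t abc by blast
  qed
  have fP: "finite ?P" by (rule finite_subset[of _ "V \<times> V \<times> V"]) (use V YV in auto)
  have "n / 5 * (n / 5 * (n / 5)) \<le> real (card (Y 0)) * (real (card (Y 1)) * real (card (Y 2)))"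
    using Y(2)[of 0] Y(2)[of 1] Y(2)[of 2] n(2) by (intro mult_mono) auto
  also have "\<dots> = real (card ?T)" by (simp add: card_cartesian_product)
  finally have "n ^ 3 / 125 \<le> real (card ?T)" by (simp add: eval_nat_numeral)
  moreover have "real (card ?T) - real (card (?B1 \<union> (?B2 \<union> ?B3))) \<le> real (card (?T - (?B1 \<union> (?B2 \<union> ?B3))))"
    using diff_card_le_card_Diff[OF fB, of ?T] by linarith
  moreover have "real (card (?T - (?B1 \<union> (?B2 \<union> ?B3)))) \<le> real (card ?P)"
    by (intro of_nat_mono card_mono fP sub)
  ultimately have P: "n ^ 3 / 200 \<le> real (card ?P)" using B by linarith
  have sym: "r u v \<Longrightarrow> r v u" for u v using r(1) by (rule sympD)
  have irr: "\<not> r u u" for u using r(2) by (auto dest: irreflpD)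
  have PD: "distinct [x, a, b, c] \<and> \<not> r x a \<and> \<not> r x b \<and> \<not> r x c \<and> \<not> r a b \<and> \<not> r a c \<and> \<not> r b c"
    if "(a, b, c) \<in> ?P" for a b c
  proof -
    have h: "a \<in> Y 0" "b \<in> Y 1" "c \<in> Y 2" "\<not> wrong r p a b" "\<not> wrong r p a c" "\<not> wrong r p b c" using that by auto
    have a: "a \<noteq> x" "p a = 0" "\<not> r x a" using Y(1)[of 0] h(1) by auto
    have b: "b \<noteq> x" "p b = 1" "\<not> r x b" using Y(1)[of 1] h(2) by auto
    have c: "c \<noteq> x" "p c = 2" "\<not> r x c" using Y(1)[of 2] h(3) by auto
    show ?thesis using a b c h(4-6) unfolding wrong_def by auto
  qed
  have "card ?P * ((card V - 4) choose 2) \<le> bad6_at r V x * 216"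
  proof (rule bad6_at_ge_triples[OF V])
    show "?P \<subseteq> V \<times> V \<times> V" using YV by auto
    show "\<And>y z w. (y, z, w) \<in> ?P \<Longrightarrow> distinct [x, y, z, w]" using PD by blast
    fix a b c S assume h: "(a, b, c) \<in> ?P" "S \<in> ksub 6 V" "{x, a, b, c} \<subseteq> S"
    show "\<not> cluster3 r S"
    proof (rule not_cluster3_indep[OF h(3)])
      show "card {x, a, b, c} = 4" using PD[OF h(1)] by simp
      show "\<not> r u v" if "u \<in> {x, a, b, c}" "v \<in> {x, a, b, c}" for u v
        using that PD[OF h(1)] irr sym by blast
    qed
  qed
  then have "real (card ?P * ((card V - 4) choose 2)) \<le> real (bad6_at r V x * 216)" by (rule of_nat_mono)
  then have 1: "real (card ?P) * real ((card V - 4) choose 2) \<le> real (bad6_at r V x) * 216" by simp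
  have "n ^ 2 / 4 \<le> real ((card V - 4) choose 2)" using choose_n4[of "card V"] n by simp
  then have "n ^ 3 / 200 * (n ^ 2 / 4) \<le> real (card ?P) * real ((card V - 4) choose 2)"
    using P n(2) by (intro mult_mono) auto
  then have "n ^ 3 / 200 * (n ^ 2 / 4) \<le> real (bad6_at r V x) * 216" using 1 by (rule order_trans)
  moreover have "n ^ 3 / 200 * (n ^ 2 / 4) = n ^ 5 / 172800 * 216" by (simp add: eval_nat_numeral)
  ultimately show ?thesis by simp
qed

text \<open>Suppose \<open>x\<close> has many wrong pairs; by optimality this is so in whichever class \<open>x\<close> is put. Then \<open>x\<close> has many
  neighbours in two classes, or both many neighbours and many nonneighbours in one class, or few neighbours altogether. In the first two
  cases many pairs of vertices form with \<open>x\<close> an induced path, and in the last one many triples form with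
  \<open>x\<close> an independent set, so \<open>x\<close> lies in too many non-clusters.\<close>

lemma wdeg_small:
  assumes r: "symp r" "irreflp r" and V: "finite V" "x \<in> V" and p: "\<And>x. p x < 3"
    and n: "n = real (card V)" "n \<ge> 10000"
    and opt: "\<And>j. j < 3 \<Longrightarrow> defects r V p \<le> defects r V (p(x := j))"
    and sizes: "\<And>i. i < 3 \<Longrightarrow> \<bar>real (card (cls V p i)) - n / 3\<bar> \<le> n / 10"
    and W: "real (defects r V p) \<le> \<eta> ^ 2 / 32 * n ^ 2" and \<eta>: "0 < \<eta>" "\<eta> \<le> 1 / 10"
    and B: "real (bad6_at r V x) < \<eta> ^ 2 / 13824 * n ^ 5"
  shows "real (wdeg r V p x) \<le> \<eta> * n"
proof (rule ccontr)
  assume "\<not> ?thesis"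
  then have big: "real (wdeg r V p x) > \<eta> * n" by simp
  define N where "N j = {y \<in> V - {x}. p y = j \<and> r x y}" for j
  define M where "M j = {y \<in> V - {x}. p y = j \<and> \<not> r x y}" for j
  have fin: "finite (N j)" "finite (M j)" for j using V unfolding N_def M_def by auto
  have sub: "N j \<subseteq> V - {x}" "M j \<subseteq> V - {x}" for j unfolding N_def M_def by auto
  have sym: "r u v \<Longrightarrow> r v u" for u v using r(1) by (rule sympD)
  have n0: "n > 0" using n by simp
  have moved: "wdeg r V p x \<le> wdeg r V (p(x := j)) x" if "j < 3" for j
  proof -
    have "defects r (V - {x}) (p(x := j)) = defects r (V - {x}) p"
      by (rule defects_cong) (auto simp: wrong_def)
    then show ?thesis
      using opt[OF that] defects_remove[OF r(1) V, of p] defects_remove[OF r(1) V, of "p(x := j)"] by simp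
  qed
  have tot: "\<eta> * n < real (card (M j)) + real (card (N k)) + real (card (N l))" if "{j, k, l} = {0, 1, 2}" for j k l
  proof -
    have "j \<in> {j, k, l}" by simp
    then have "j < 3" unfolding that by auto
    have "{y \<in> V. wrong r (p(x := j)) x y} \<subseteq> M j \<union> (N k \<union> N l)"
    proof
      fix y assume "y \<in> {y \<in> V. wrong r (p(x := j)) x y}"
      then have y: "y \<in> V - {x}" "r x y \<noteq> (j = p y)" by (auto simp: wrong_def)
      have "p y \<in> {0, 1, 2}" using p[of y] by auto
      then have "p y \<in> {j, k, l}" using that by simp
      then show "y \<in> M j \<union> (N k \<union> N l)" using y unfolding M_def N_def by auto
    qed
    then have "wdeg r V (p(x := j)) x \<le> card (M j \<union> (N k \<union> N l))"
      unfolding wdeg_def using fin by (intro card_mono) auto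
    also have "\<dots> \<le> card (M j) + (card (N k) + card (N l))"
      by (intro order_trans[OF card_Un_le] add_mono card_Un_le) simp
    finally have "real (wdeg r V p x) \<le> real (card (M j) + (card (N k) + card (N l)))"
      using moved[OF \<open>j < 3\<close>] by (intro of_nat_mono) simp
    then show ?thesis using big by simp
  qed
  have one: "real (card (N k)) < \<eta> / 4 * n" if "real (card (N j)) \<ge> \<eta> / 4 * n" "j \<noteq> k" for j k
  proof (rule ccontr)
    assume h: "\<not> ?thesis"
    have "real (bad6_at r V x) \<ge> \<eta> ^ 2 / 13824 * n ^ 5"
    proof (rule many_bad_of_pairs[OF V n(1) _ W \<eta>(1) sub(1) sub(1)])
      show "n \<ge> 100" using n by simp
      show "N j \<inter> N k = {}" using that(2) by (auto simp: N_def)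
      show "\<eta> / 4 * n \<le> real (card (N j))" "\<eta> / 4 * n \<le> real (card (N k))" using h that by auto
      fix y z S assume yz: "y \<in> N j" "z \<in> N k" "\<not> wrong r p y z" "{x, y, z} \<subseteq> S"
      then have "r y x" "r x z" "y \<noteq> z" "\<not> r y z" using that(2) sym by (auto simp: N_def wrong_def)
      then show "\<not> cluster3 r S" using yz(4) by (intro not_cluster3_path[of y S x z]) auto
    qed
    then show False using B by simp
  qed
  have two: "real (card (M j)) < \<eta> / 4 * n" if "real (card (N j)) \<ge> \<eta> / 4 * n" for j
  proof (rule ccontr)
    assume h: "\<not> ?thesis"
    have "real (bad6_at r V x) \<ge> \<eta> ^ 2 / 13824 * n ^ 5"
    proof (rule many_bad_of_pairs[OF V n(1) _ W \<eta>(1) sub(1) sub(2)])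
      show "n \<ge> 100" using n by simp
      show "N j \<inter> M j = {}" by (auto simp: N_def M_def)
      show "\<eta> / 4 * n \<le> real (card (N j))" "\<eta> / 4 * n \<le> real (card (M j))" using h that by auto
      fix y z S assume yz: "y \<in> N j" "z \<in> M j" "\<not> wrong r p y z" "{x, y, z} \<subseteq> S"
      then have "r x y" "r y z" "x \<noteq> z" "\<not> r x z" by (auto simp: N_def M_def wrong_def)
      then show "\<not> cluster3 r S" using yz(4) by (intro not_cluster3_path[of x S y z]) auto
    qed
    then show False using B by simp
  qed
  have \<eta>n: "\<eta> * n > 0" using \<eta> n0 by simp
  have Nsmall: "real (card (N j)) < \<eta> / 4 * n" if j: "j < 3" for j
  proof (rule ccontr)
    assume h: "\<not> ?thesis"
    obtain k l where kl: "{j, k, l} = {0, 1, 2}" "j \<noteq> k" "j \<noteq> l"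
    proof -
      consider "j = 0" | "j = 1" | "j = 2" using j by linarith
      then show thesis
      proof cases
        case 1 then show thesis using that[of 1 2] by simp
      next
        case 2 then show thesis using that[of 0 2] by (simp add: insert_commute)
      next
        case 3 then show thesis using that[of 0 1] by (simp add: insert_commute)
      qed
    qed
    have "real (card (N k)) < \<eta> / 4 * n" "real (card (N l)) < \<eta> / 4 * n" "real (card (M j)) < \<eta> / 4 * n"
      using h one[of j k] one[of j l] two[of j] kl by auto
    then show False using tot[OF kl(1)] \<eta>n by linarith
  qed
  have "real (bad6_at r V x) \<ge> n ^ 5 / 172800"
  proof (rule many_bad_of_triples[OF V n(1) _ _ _ _ r])
    show "n \<ge> 100" using n by simp
    have "\<eta> ^ 2 \<le> (1/10) ^ 2" using \<eta> by (intro power_mono) auto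
    then have "\<eta> ^ 2 / 32 \<le> 1 / 1000" by (simp add: power2_eq_square)
    then have "\<eta> ^ 2 / 32 * n ^ 2 \<le> 1 / 1000 * n ^ 2" by (intro mult_right_mono) auto
    then show "real (defects r V p) \<le> n ^ 2 / 1000" using W by simp
    show "\<And>i. i < 3 \<Longrightarrow> M i \<subseteq> {y \<in> V - {x}. p y = i \<and> \<not> r x y}" by (simp add: M_def)
    fix i :: nat assume i: "i < 3"
    have "cls V p i \<subseteq> insert x (N i \<union> M i)" by (auto simp: cls_def N_def M_def)
    then have "card (cls V p i) \<le> card (insert x (N i \<union> M i))" using fin by (intro card_mono) auto
    also have "\<dots> \<le> 1 + (card (N i) + card (M i))"
      using card_Un_le[of "N i" "M i"] fin[of i] by (simp add: card_insert_if)
    finally have "real (card (cls V p i)) \<le> 1 + real (card (N i)) + real (card (M i))" by linarith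
    moreover have "\<eta> / 4 * n \<le> 1 / 40 * n" using \<eta> n0 by simp
    ultimately show "n / 5 \<le> real (card (M i))" using sizes[OF i] Nsmall[OF i] n(2) by linarith
  qed
  moreover have "\<eta> ^ 2 / 13824 * n ^ 5 \<le> n ^ 5 / 172800"
  proof -
    have "\<eta> ^ 2 \<le> (1/10) ^ 2" using \<eta> by (intro power_mono) auto
    then have "\<eta> ^ 2 / 13824 \<le> 1 / 172800" by (simp add: power2_eq_square)
    then have "\<eta> ^ 2 / 13824 * n ^ 5 \<le> 1 / 172800 * n ^ 5" using n0 by (intro mult_right_mono) auto
    then show ?thesis by simp
  qed
  ultimately show False using B by linarith
qed

section \<open>Correcting one wrong pair\<close>

definition flip :: "('a \<Rightarrow> 'a \<Rightarrow> bool) \<Rightarrow> 'a \<Rightarrow> 'a \<Rightarrow> 'a \<Rightarrow> 'a \<Rightarrow> bool" where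
  "flip r x y u v = (if {u, v} = {x, y} then \<not> r u v else r u v)"

lemma symp_flip: "symp r \<Longrightarrow> symp (flip r x y)"
  unfolding symp_def flip_def by (simp add: insert_commute) blast

lemma irreflp_flip: "irreflp r \<Longrightarrow> x \<noteq> y \<Longrightarrow> irreflp (flip r x y)"
  unfolding irreflp_def flip_def by auto

lemma edges_in_add:
  assumes "finite S" "x \<in> S" "y \<in> S" "\<not> r x y" "\<not> r y x"
    and "\<And>u v. u \<in> S \<Longrightarrow> v \<in> S \<Longrightarrow> r' u v \<longleftrightarrow> r u v \<or> {u, v} = {x, y}"
  shows "edges_in r' S = Suc (edges_in r S)"
proof -
  let ?E = "\<lambda>r. {{x, y} | x y. x \<in> S \<and> y \<in> S \<and> r x y}"
  have "?E r' = insert {x, y} (?E r)"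
  proof (intro set_eqI iffI)
    fix e assume "e \<in> ?E r'"
    then obtain u v where "e = {u, v}" "u \<in> S" "v \<in> S" "r' u v" by auto
    then show "e \<in> insert {x, y} (?E r)" using assms(6)[of u v] by auto
  next
    fix e assume "e \<in> insert {x, y} (?E r)"
    then consider "e = {x, y}" | u v where "e = {u, v}" "u \<in> S" "v \<in> S" "r u v" by auto
    then show "e \<in> ?E r'"
    proof cases
      case 1 then show ?thesis using assms(2,3) assms(6)[of x y] by blast
    next
      case 2 then show ?thesis using assms(6)[of u v] by blast
    qed
  qed
  moreover have "{x, y} \<notin> ?E r" using assms(4,5) by (auto simp: doubleton_eq_iff)
  ultimately show ?thesis unfolding edges_in_def using finite_edges[OF assms(1), of r] by simp
qed

text \<open>The 6-sets through \<open>x\<close> and \<open>y\<close> that contain a further wrong pair. The effect of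
  flipping \<open>x, y\<close> is computed exactly on all other 6-sets through both vertices.\<close>

definition unclean :: "('a \<Rightarrow> 'a \<Rightarrow> bool) \<Rightarrow> 'a set \<Rightarrow> ('a \<Rightarrow> nat) \<Rightarrow> 'a \<Rightarrow> 'a \<Rightarrow> 'a set set" where
  "unclean r V p x y = {S \<in> ksub 6 V. {x, y} \<subseteq> S \<and> (\<exists>u\<in>S. \<exists>v\<in>S. wrong r p u v \<and> {u, v} \<noteq> {x, y})}"

lemma card_unclean:
  assumes r: "symp r" and V: "finite V" "x \<in> V" "y \<in> V" "x \<noteq> y"
  shows "real (card (unclean r V p x y)) \<le> (real (wdeg r V p x) + real (wdeg r V p y)) * real (card V) ^ 3
    + real (defects r V p) * real (card V) ^ 2"
proof -
  let ?K = "\<lambda>P. {S \<in> ksub 6 V. P \<subseteq> S}"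
  let ?X = "{v \<in> V. wrong r p x v} - {y}" and ?Y = "{v \<in> V. wrong r p y v} - {x}"
  let ?D = "{(u, v). u \<in> V \<and> v \<in> V \<and> wrong r p u v}"
  let ?Z = "{e \<in> ?D. fst e \<notin> {x, y} \<and> snd e \<notin> {x, y}}"
  have fD: "finite ?D" by (rule finite_subset[of _ "V \<times> V"]) (use V in auto)
  have fin: "finite ?X" "finite ?Y" "finite ?Z" using V fD by auto
  have s: "wrong r p u v \<longleftrightarrow> wrong r p v u" for u v by (rule wrong_sym[OF r])
  have "unclean r V p x y \<subseteq> (\<Union>v\<in>?X. ?K {x, y, v}) \<union> ((\<Union>v\<in>?Y. ?K {x, y, v}) \<union> (\<Union>e\<in>?Z. ?K {x, y, fst e, snd e}))"
  proof
    fix S assume "S \<in> unclean r V p x y"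
    then obtain u v where S: "S \<in> ksub 6 V" "x \<in> S" "y \<in> S" "u \<in> S" "v \<in> S" "wrong r p u v" "{u, v} \<noteq> {x, y}"
      unfolding unclean_def by auto
    have uv: "u \<in> V" "v \<in> V" "u \<noteq> v" using S by (auto simp: ksub_def wrong_def)
    consider "u = x" | "v = x" | "u = y" | "v = y" | "u \<notin> {x, y}" "v \<notin> {x, y}" by auto
    then show "S \<in> (\<Union>v\<in>?X. ?K {x, y, v}) \<union> ((\<Union>v\<in>?Y. ?K {x, y, v}) \<union> (\<Union>e\<in>?Z. ?K {x, y, fst e, snd e}))"
    proof cases
      case 1
      then have "v \<in> ?X" using S uv by auto
      moreover have "S \<in> ?K {x, y, v}" using S by auto
      ultimately show ?thesis by blast
    next
      case 2
      then have "u \<in> ?X" using S uv s[of u v] by auto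
      moreover have "S \<in> ?K {x, y, u}" using S by auto
      ultimately show ?thesis by blast
    next
      case 3
      then have "v \<in> ?Y" using S uv by auto
      moreover have "S \<in> ?K {x, y, v}" using S by auto
      ultimately show ?thesis by blast
    next
      case 4
      then have "u \<in> ?Y" using S uv s[of u v] by auto
      moreover have "S \<in> ?K {x, y, u}" using S by auto
      ultimately show ?thesis by blast
    next
      case 5
      then have "(u, v) \<in> ?Z" using S uv by auto
      moreover have "S \<in> ?K {x, y, fst (u, v), snd (u, v)}" using S by auto
      ultimately show ?thesis by blast
    qed
  qed
  then have "card (unclean r V p x y) \<le> card ((\<Union>v\<in>?X. ?K {x, y, v}) \<union> ((\<Union>v\<in>?Y. ?K {x, y, v}) \<union> (\<Union>e\<in>?Z. ?K {x, y, fst e, snd e})))"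
    using fin V(1) by (intro card_mono) (auto simp: finite_ksub)
  also have "\<dots> \<le> card (\<Union>v\<in>?X. ?K {x, y, v}) + (card (\<Union>v\<in>?Y. ?K {x, y, v}) + card (\<Union>e\<in>?Z. ?K {x, y, fst e, snd e}))"
    by (intro order_trans[OF card_Un_le] add_mono card_Un_le) simp
  also have "\<dots> \<le> (\<Sum>v\<in>?X. card (?K {x, y, v})) + ((\<Sum>v\<in>?Y. card (?K {x, y, v})) + (\<Sum>e\<in>?Z. card (?K {x, y, fst e, snd e})))"
    by (intro add_mono card_UN_le fin)
  finally have "real (card (unclean r V p x y)) \<le> real ((\<Sum>v\<in>?X. card (?K {x, y, v})) + ((\<Sum>v\<in>?Y. card (?K {x, y, v})) + (\<Sum>e\<in>?Z. card (?K {x, y, fst e, snd e}))))"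
    by (rule of_nat_mono)
  also have "\<dots> = (\<Sum>v\<in>?X. real (card (?K {x, y, v}))) + ((\<Sum>v\<in>?Y. real (card (?K {x, y, v}))) + (\<Sum>e\<in>?Z. real (card (?K {x, y, fst e, snd e}))))"
    by simp
  also have "\<dots> \<le> (\<Sum>v\<in>?X. real (card V) ^ 3) + ((\<Sum>v\<in>?Y. real (card V) ^ 3) + (\<Sum>e\<in>?Z. real (card V) ^ 2))"
  proof (intro add_mono sum_mono)
    fix v assume v: "v \<in> ?X"
    then have "v \<noteq> x" by (auto simp: wrong_def)
    then have "card {x, y, v} = 3" using v V by auto
    then show "real (card (?K {x, y, v})) \<le> real (card V) ^ 3"
      using card_ksub_containing_le[of V "{x, y, v}"] V v by simp
  next
    fix v assume v: "v \<in> ?Y"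
    then have "v \<noteq> y" by (auto simp: wrong_def)
    then have "card {x, y, v} = 3" using v V by auto
    then show "real (card (?K {x, y, v})) \<le> real (card V) ^ 3"
      using card_ksub_containing_le[of V "{x, y, v}"] V v by simp
  next
    fix e assume e: "e \<in> ?Z"
    then have "fst e \<noteq> snd e" by (auto simp: wrong_def)
    then have "card {x, y, fst e, snd e} = 4" using e V by auto
    then show "real (card (?K {x, y, fst e, snd e})) \<le> real (card V) ^ 2"
      using card_ksub_containing_le[of V "{x, y, fst e, snd e}"] V e by auto
  qed
  also have "\<dots> = real (card ?X) * real (card V) ^ 3 + (real (card ?Y) * real (card V) ^ 3 + real (card ?Z) * real (card V) ^ 2)"
    by simp
  also have "\<dots> \<le> real (wdeg r V p x) * real (card V) ^ 3 + (real (wdeg r V p y) * real (card V) ^ 3 + real (defects r V p) * real (card V) ^ 2)"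
    unfolding wdeg_def defects_def using V fD by (intro add_mono mult_right_mono of_nat_mono card_mono) auto
  finally show ?thesis by (simp add: algebra_simps)
qed

lemma cls_insert: "cls (insert u R) p k = (if p u = k then insert u (cls R p k) else cls R p k)"
  by (auto simp: cls_def)

lemma profile_insert2:
  assumes "R \<in> profile (V - {x, y}) p (i, j, l)" "finite V" "x \<in> V" "y \<in> V" "x \<noteq> y"
  shows "insert x (insert y R) \<in> profile V p (i + of_bool (p x = 0) + of_bool (p y = 0),
    j + of_bool (p x = 1) + of_bool (p y = 1), l + of_bool (p x = 2) + of_bool (p y = 2))"
proof -
  have R: "R \<subseteq> V - {x, y}" "card (cls R p 0) = i" "card (cls R p 1) = j" "card (cls R p 2) = l"
    using assms(1) by (auto simp: profile_def)
  have "finite R" using R(1) assms(2) finite_subset by blast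
  then have f: "finite (cls R p k)" for k by (simp add: cls_def)
  have n: "x \<notin> cls R p k" "y \<notin> cls R p k" for k using R(1) by (auto simp: cls_def)
  have "card (cls (insert x (insert y R)) p k) = card (cls R p k) + of_bool (p x = k) + of_bool (p y = k)" for k
    unfolding cls_insert using f n assms(5) by simp
  then show ?thesis using R assms(3,4) by (auto simp: profile_def)
qed

lemma profile_Diff2:
  assumes "S \<in> profile V p (i, j, l)" "finite V" "x \<in> S" "y \<in> S" "x \<noteq> y"
  shows "S - {x, y} \<in> profile (V - {x, y}) p (i - of_bool (p x = 0) - of_bool (p y = 0),
    j - of_bool (p x = 1) - of_bool (p y = 1), l - of_bool (p x = 2) - of_bool (p y = 2))"
proof -
  let ?R = "S - {x, y}"
  have S: "S \<subseteq> V" "card (cls S p 0) = i" "card (cls S p 1) = j" "card (cls S p 2) = l"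
    using assms(1) by (auto simp: profile_def)
  have "finite ?R" using S(1) assms(2) finite_subset by blast
  then have f: "finite (cls ?R p k)" for k by (simp add: cls_def)
  have n: "x \<notin> cls ?R p k" "y \<notin> cls ?R p k" for k by (auto simp: cls_def)
  have "S = insert x (insert y ?R)" using assms by auto
  then have "card (cls S p k) = card (cls (insert x (insert y ?R)) p k)" for k by simp
  also have "card (cls (insert x (insert y ?R)) p k) = card (cls ?R p k) + of_bool (p x = k) + of_bool (p y = k)" for k
    unfolding cls_insert using f n assms(5) by simp
  finally show ?thesis using S by (auto simp: profile_def)
qed

lemma card_cls_Diff2:
  assumes "finite V" "x \<in> V" "y \<in> V" "x \<noteq> y"
  shows "real (card (cls (V - {x, y}) p k)) = real (card (cls V p k)) - of_bool (p x = k) - of_bool (p y = k)"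
proof -
  let ?R = "V - {x, y}"
  have f: "finite (cls ?R p k)" using assms by (simp add: cls_def)
  have n: "x \<notin> cls ?R p k" "y \<notin> cls ?R p k" by (auto simp: cls_def)
  have "V = insert x (insert y ?R)" using assms by auto
  then have "card (cls V p k) = card (cls (insert x (insert y ?R)) p k)" by simp
  also have "\<dots> = card (cls ?R p k) + of_bool (p x = k) + of_bool (p y = k)"
    unfolding cls_insert using f n assms(4) by simp
  finally show ?thesis by simp
qed

lemma choose2_real: "real (m choose 2) = real m * (real m - 1) / 2"
proof (cases m)
  case (Suc k)
  have "2 dvd m * (m - 1)" by (simp add: Suc)
  then show ?thesis by (simp add: choose_two real_of_nat_div Suc algebra_simps)
qed simp

text \<open>After the flip the clean 6-sets through \<open>x\<close> and \<open>y\<close> look like a blowup, so the good ones have class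
  sizes 3, 2, 1. Before it, if \<open>x\<close> and \<open>y\<close> are in the same class, a good clean set
  would be a blowup minus one edge, hence a blowup with five edges, which does not exist. If they are in different
  classes, it would be a blowup with three edges plus one, so of class sizes 2, 2, 2. In both cases
  there are by a positive proportion of \<open>n^4\<close> more sets of the first kind.\<close>

lemma flip_gain_normalised:
  assumes r: "symp r" "irreflp r" and V: "finite V" "x \<in> V" "y \<in> V" and p: "\<And>x. p x < 3"
    and n: "n = real (card V)" "n \<ge> 10000" and w: "wrong r p x y"
    and px: "p x = 0" "p y = 0 \<or> p y = 1"
    and sizes: "\<And>i. i < 3 \<Longrightarrow> \<bar>real (card (cls V p i)) - n / 3\<bar> \<le> n / 10"
  shows "real (num4 (flip r x y) V) \<ge> real (num4 r V) + n ^ 4 / 2000 - 2 * real (card (unclean r V p x y))"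
proof -
  let ?r = "flip r x y" and ?U = "unclean r V p x y" and ?V = "V - {x, y}"
  let ?F = "{S \<in> ksub 6 V. {x, y} \<subseteq> S}"
  let ?G' = "{S \<in> ?F. edges_in ?r S = 4}" and ?G = "{S \<in> ?F. edges_in r S = 4}"
  let ?A = "{S \<in> ?F. edges_in (same_class p) S = 4}"
  let ?B = "{S \<in> ?F. edges_in (same_class p) S = 3 \<and> p x \<noteq> p y}"
  have xy: "x \<noteq> y" using w by (simp add: wrong_def)
  have sym: "r u v = r v u" for u v using r(1) by (auto dest: sympD)
  have fF: "finite ?F" using V by (simp add: finite_ksub)
  have fU: "finite ?U" unfolding unclean_def using V by (simp add: finite_ksub)
  have fS: "finite S" if "S \<in> ?F" for S using that V finite_subset by (auto simp: ksub_def)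
  have num: "num4 ?r V + card ?G = num4 r V + card ?G'"
  proof -
    let ?O = "{S \<in> ksub 6 V. \<not> {x, y} \<subseteq> S \<and> edges_in r S = 4}"
    have same: "edges_in ?r S = edges_in r S" if S: "\<not> {x, y} \<subseteq> S" for S
    proof (rule edges_in_cong)
      fix u v assume "u \<in> S" "v \<in> S"
      then have "{u, v} \<subseteq> S" by simp
      then have "{u, v} \<noteq> {x, y}" using S by (intro notI) simp
      then show "?r u v = r u v" by (simp add: flip_def)
    qed
    have e1: "{S \<in> ksub 6 V. edges_in r S = 4} = ?O \<union> ?G" by blast
    have e2: "{S \<in> ksub 6 V. edges_in ?r S = 4} = ?O \<union> ?G'"
    proof (intro set_eqI)
      fix S
      show "S \<in> {S \<in> ksub 6 V. edges_in ?r S = 4} \<longleftrightarrow> S \<in> ?O \<union> ?G'"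
        using same[of S] by (cases "{x, y} \<subseteq> S") auto
    qed
    have fO: "finite ?O" using V by (simp add: finite_ksub)
    have d: "?O \<inter> ?G = {}" "?O \<inter> ?G' = {}" by auto
    have fG: "finite ?G" "finite ?G'" using V by (simp_all add: finite_ksub)
    show ?thesis
      unfolding num4_def e1 e2 card_Un_disjoint[OF fO fG(1) d(1)] card_Un_disjoint[OF fO fG(2) d(2)] by simp
  qed
  have clean: "edges_in ?r S = edges_in (same_class p) S" if S: "S \<in> ?F - ?U" for S
  proof (rule edges_in_no_wrong)
    show "irreflp ?r" by (rule irreflp_flip[OF r(2) xy])
    fix u v assume uv: "u \<in> S" "v \<in> S"
    show "\<not> wrong ?r p u v"
    proof (cases "{u, v} = {x, y}")
      case True
      then have "wrong r p u v" using w wrong_sym[OF r(1), of p x y] by (auto simp: doubleton_eq_iff)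
      then show ?thesis using True by (auto simp: wrong_def flip_def)
    next
      case False
      then have "\<not> wrong r p u v" using S uv unfolding unclean_def by blast
      then show ?thesis using False by (auto simp: wrong_def flip_def)
    qed
  qed
  have AG: "?A \<subseteq> ?G' \<union> ?U" using clean by auto
  have GB: "?G \<subseteq> ?B \<union> ?U"
  proof
    fix S assume S: "S \<in> ?G"
    show "S \<in> ?B \<union> ?U"
    proof (cases "S \<in> ?U")
      case False
      then have c: "edges_in ?r S = edges_in (same_class p) S" using S clean by blast
      have SS: "S \<in> ksub 6 V" "x \<in> S" "y \<in> S" "finite S" "edges_in r S = 4" using S fS by auto
      show ?thesis
      proof (cases "p x = p y")
        case True
        then have nr: "\<not> r x y" using w by (simp add: wrong_def)
        have "edges_in ?r S = Suc (edges_in r S)"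
        proof (rule edges_in_add[OF SS(4,2,3)])
          show "\<not> r x y" "\<not> r y x" using nr sym by auto
          show "flip r x y u v \<longleftrightarrow> r u v \<or> {u, v} = {x, y}" for u v
            using nr sym[of x y] by (auto simp: flip_def doubleton_eq_iff)
        qed
        then have "edges_in (same_class p) S = 5" using c SS(5) by simp
        then show ?thesis using edges_in_same_class_iff(3)[where V = V and p = p, OF SS(1) V(1) p] by simp
      next
        case False
        then have nr: "r x y" using w by (simp add: wrong_def)
        have "edges_in r S = Suc (edges_in ?r S)"
        proof (rule edges_in_add[OF SS(4,2,3)])
          show "\<not> flip r x y x y" "\<not> flip r x y y x" using nr sym[of x y] by (auto simp: flip_def insert_commute)
          show "r u v \<longleftrightarrow> flip r x y u v \<or> {u, v} = {x, y}" for u v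
            using nr sym[of x y] by (auto simp: flip_def doubleton_eq_iff)
        qed
        then show ?thesis using c SS False by simp
      qed
    qed simp
  qed
  have "card ?A \<le> card ?G' + card ?U"
    by (rule order_trans[OF card_mono[OF _ AG] card_Un_le]) (use V fU in \<open>simp add: finite_ksub\<close>)
  moreover have "card ?G \<le> card ?B + card ?U"
    by (rule order_trans[OF card_mono[OF _ GB] card_Un_le]) (use V fU in \<open>simp add: finite_ksub\<close>)
  ultimately have main: "real (num4 ?r V) \<ge> real (num4 r V) + real (card ?A) - real (card ?B) - 2 * real (card ?U)"
    using num by linarith
  let ?h = "\<lambda>R. insert x (insert y R)"
  have inj: "inj_on ?h (Pow ?V)"
  proof (rule inj_onI)
    fix R R' assume "R \<in> Pow ?V" "R' \<in> Pow ?V" "?h R = ?h R'"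
    then have "R = ?h R - {x, y}" "R' = ?h R' - {x, y}" by auto
    then show "R = R'" using \<open>?h R = ?h R'\<close> by simp
  qed
  have fA: "finite ?A" using V by (simp add: finite_ksub)
  have PV: "profile ?V p c \<subseteq> Pow ?V" for c by (auto simp: profile_def)
  have fPV: "finite (profile ?V p c)" for c using PV V(1) by (rule_tac finite_subset[OF PV]) simp
  have inA: "?h R \<in> ?A" if "R \<in> profile ?V p (i, j, l)"
    "(i + of_bool (p x = 0) + of_bool (p y = 0), j + of_bool (p x = 1) + of_bool (p y = 1), l + of_bool (p x = 2) + of_bool (p y = 2)) \<in> perms321"
    for R i j l
  proof -
    have P: "?h R \<in> profile V p (i + of_bool (p x = 0) + of_bool (p y = 0), j + of_bool (p x = 1) + of_bool (p y = 1), l + of_bool (p x = 2) + of_bool (p y = 2))"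
      by (rule profile_insert2[OF that(1) V xy])
    have k: "?h R \<in> ksub 6 V"
      using profile_ksub[where V = V and p = p, OF P V(1) p] that(2) by (auto simp: perms321_def)
    have "edges_in (same_class p) (?h R) = 4"
      using edges_in_same_class_iff(1)[where V = V and p = p, OF k V(1) p] P that(2) by blast
    then show ?thesis using k by simp
  qed
  define a where "a = real (card (cls ?V p 0))"
  define b where "b = real (card (cls ?V p 1))"
  define c where "c = real (card (cls ?V p 2))"
  have sz: "7/30 * n \<le> real (card (cls V p i))" "real (card (cls V p i)) \<le> 13/30 * n" if "i < 3" for i
    using sizes[OF that] by linarith+
  have cV: "card (profile ?V p (i, j, l)) = (card (cls ?V p 0) choose i) * (card (cls ?V p 1) choose j) * (card (cls ?V p 2) choose l)" for i j l
    by (rule card_profile_cls) (use V(1) p in auto)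
  have tot: "real (card (cls V p 0)) + real (card (cls V p 1)) + real (card (cls V p 2)) = n"
    using card_cls_sum[of V p, OF V(1) p] n(1) by simp
  have cls: "a = real (card (cls V p 0)) - of_bool (p x = 0) - of_bool (p y = 0)"
    "b = real (card (cls V p 1)) - of_bool (p x = 1) - of_bool (p y = 1)"
    "c = real (card (cls V p 2)) - of_bool (p x = 2) - of_bool (p y = 2)"
    unfolding a_def b_def c_def by (rule card_cls_Diff2[OF V xy])+
  have ge: "a \<ge> 23/100 * n" "b \<ge> 23/100 * n" "c \<ge> 23/100 * n"
  proof -
    have ob: "of_bool P \<le> (1 :: real)" for P by simp
    show "a \<ge> 23/100 * n" "b \<ge> 23/100 * n" "c \<ge> 23/100 * n"
      using cls sz(1)[of 0] sz(1)[of 1] sz(1)[of 2] n(2) ob[of "p x = 0"] ob[of "p y = 0"]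
        ob[of "p x = 1"] ob[of "p y = 1"] ob[of "p x = 2"] ob[of "p y = 2"] by linarith+
  qed
  have n0: "n > 0" using n(2) by simp
  have pos: "0 \<le> a" "0 \<le> b" "0 \<le> c" "0 \<le> b - 1" "22/100 * n \<le> b - 1" "0 \<le> n"
    using ge n(2) by linarith+
  have gain: "n ^ 4 / 2000 \<le> real (card ?A) - real (card ?B)"
  proof (cases "p y = 0")
    case True
    have "?h ` profile ?V p (1, 2, 1) \<subseteq> ?A"
      using inA[of _ 1 2 1] px True by (auto simp: perms321_def)
    then have "card (profile ?V p (1, 2, 1)) \<le> card ?A"
      by (rule card_inj_on_le[OF inj_on_subset[OF inj PV] _ fA])
    then have "real (card (profile ?V p (1, 2, 1))) \<le> real (card ?A)" by (rule of_nat_mono)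
    then have 1: "a * (b * (b - 1) / 2) * c \<le> real (card ?A)"
      unfolding cV a_def b_def c_def by (simp add: choose2_real)
    have B0: "?B = {}" using px True by auto
    have "(23/100 * n) * (23/100 * n * (22/100 * n) / 2) * (23/100 * n) \<le> a * (b * (b - 1) / 2) * c"
      by (intro mult_mono divide_right_mono mult_nonneg_nonneg divide_nonneg_nonneg) (use pos ge in simp_all)
    moreover have "(23/100 * n) * (23/100 * n * (22/100 * n) / 2) * (23/100 * n) = 133837 / 100000000 * n ^ 4"
      by (simp add: eval_nat_numeral)
    moreover have "n ^ 4 / 2000 \<le> 133837 / 100000000 * n ^ 4" using n0 by simp
    ultimately show ?thesis using 1 unfolding B0 by simp
  next
    case False
    then have py: "p y = 1" using px by simp
    have sub: "?h ` (profile ?V p (2, 1, 1) \<union> profile ?V p (1, 2, 1)) \<subseteq> ?A"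
      using inA[of _ 2 1 1] inA[of _ 1 2 1] px py by (auto simp: perms321_def)
    have "profile ?V p (2, 1, 1) \<inter> profile ?V p (1, 2, 1) = {}" by (auto simp: profile_def)
    then have "card (profile ?V p (2, 1, 1)) + card (profile ?V p (1, 2, 1)) = card (profile ?V p (2, 1, 1) \<union> profile ?V p (1, 2, 1))"
      using fPV by (simp add: card_Un_disjoint)
    also have "\<dots> \<le> card ?A"
      by (rule card_inj_on_le[OF inj_on_subset[OF inj Un_least[OF PV PV]] sub fA])
    finally have "real (card (profile ?V p (2, 1, 1)) + card (profile ?V p (1, 2, 1))) \<le> real (card ?A)" by (rule of_nat_mono)
    then have 1: "a * (a - 1) / 2 * b * c + a * (b * (b - 1) / 2) * c \<le> real (card ?A)"
      unfolding of_nat_add cV a_def b_def c_def by (simp add: choose2_real)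
    have "?B \<subseteq> ?h ` profile ?V p (1, 1, 2)"
    proof
      fix S assume S: "S \<in> ?B"
      then have "S \<in> profile V p (2, 2, 2)" using edges_in_same_class_iff(2)[of S V p, OF _ V(1) p] by simp
      then have "S - {x, y} \<in> profile ?V p (1, 1, 2)"
        using profile_Diff2[of S V p 2 2 2 x y] V(1) S xy px py by (simp add: numeral_2_eq_2)
      moreover have "S = ?h (S - {x, y})" using S by auto
      ultimately show "S \<in> ?h ` profile ?V p (1, 1, 2)" by blast
    qed
    then have "card ?B \<le> card (profile ?V p (1, 1, 2))"
      by (intro order_trans[OF card_mono card_image_le] finite_imageI fPV)
    then have "real (card ?B) \<le> real (card (profile ?V p (1, 1, 2)))" by (rule of_nat_mono)
    then have 2: "real (card ?B) \<le> a * b * (c * (c - 1) / 2)"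
      unfolding cV a_def b_def c_def by (simp add: choose2_real)
    have "a + b - c - 1 \<ge> 13/100 * n"
    proof -
      have "a = real (card (cls V p 0)) - 1" "b = real (card (cls V p 1)) - 1" "c = real (card (cls V p 2))"
        using cls px py by simp_all
      then show ?thesis using tot sz(2)[of 2] n(2) by linarith
    qed
    then have "(23/100 * n) * (23/100 * n) * (23/100 * n) / 2 * (13/100 * n) \<le> a * b * c / 2 * (a + b - c - 1)"
      by (intro mult_mono divide_right_mono mult_nonneg_nonneg divide_nonneg_nonneg) (use pos ge in simp_all)
    also have "\<dots> = a * (a - 1) / 2 * b * c + a * (b * (b - 1) / 2) * c - a * b * (c * (c - 1) / 2)"
      by (simp add: field_simps)
    finally have 3: "(23/100 * n) * (23/100 * n) * (23/100 * n) / 2 * (13/100 * n)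
       \<le> a * (a - 1) / 2 * b * c + a * (b * (b - 1) / 2) * c - a * b * (c * (c - 1) / 2)" .
    have "(23/100 * n) * (23/100 * n) * (23/100 * n) / 2 * (13/100 * n) = 158171 / 200000000 * n ^ 4"
      by (simp add: eval_nat_numeral)
    moreover have "n ^ 4 / 2000 \<le> 158171 / 200000000 * n ^ 4" using n0 by simp
    ultimately show ?thesis using 1 2 3 by linarith
  qed
  then show ?thesis using main by linarith
qed

text \<open>Permuting the classes reduces to the case where \<open>x\<close> is in class 0 and \<open>y\<close> in class 0 or 1.\<close>

lemma flip_gain:
  assumes r: "symp r" "irreflp r" and V: "finite V" "x \<in> V" "y \<in> V" and p: "\<And>x. p x < 3"
    and n: "n = real (card V)" "n \<ge> 10000" and w: "wrong r p x y"
    and sizes: "\<And>i. i < 3 \<Longrightarrow> \<bar>real (card (cls V p i)) - n / 3\<bar> \<le> n / 10"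
  shows "real (num4 (flip r x y) V) \<ge> real (num4 r V) + n ^ 4 / 2000 - 2 * real (card (unclean r V p x y))"
proof -
  define j where "j = (if p y \<noteq> p x then p y else if p x = 0 then 1 else 0)"
  define l where "l = 3 - p x - j"
  have lt: "p x < 3" "p y < 3" using p by auto
  have j: "j < 3" "j \<noteq> p x" using lt unfolding j_def by auto
  have l: "l < 3" "l \<noteq> p x" "l \<noteq> j" using lt j unfolding l_def by arith+
  have other: "i = l" if "i < 3" "i \<noteq> p x" "i \<noteq> j" for i
    using that lt j unfolding l_def by arith
  define q where "q u = (if p u = p x then 0 else if p u = j then 1 else (2 :: nat))" for u
  have qe: "q u = q v \<longleftrightarrow> p u = p v" for u v
    using other[of "p u"] other[of "p v"] p[of u] p[of v] j by (auto simp: q_def)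
  have wq: "wrong r q u v = wrong r p u v" for u v by (simp only: wrong_def qe)
  have c: "cls V q 0 = cls V p (p x)" "cls V q 1 = cls V p j" "cls V q 2 = cls V p l"
  proof -
    have o: "p u = p x \<or> p u = j \<or> p u = l" for u using other[of "p u"] p[of u] by blast
    have "q u = 0 \<longleftrightarrow> p u = p x" "q u = 1 \<longleftrightarrow> p u = j" "q u = 2 \<longleftrightarrow> p u = l" for u
      using o[of u] j(2) l(2,3) unfolding q_def by (elim disjE; simp)+
    then show "cls V q 0 = cls V p (p x)" "cls V q 1 = cls V p j" "cls V q 2 = cls V p l"
      unfolding cls_def by simp_all
  qed
  have sq: "\<bar>real (card (cls V q i)) - n / 3\<bar> \<le> n / 10" if "i < 3" for i
  proof -
    have "i = 0 \<or> i = 1 \<or> i = 2" using that by linarith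
    then show ?thesis using c sizes[OF lt(1)] sizes[OF j(1)] sizes[OF l(1)] by (elim disjE) simp_all
  qed
  have "real (num4 (flip r x y) V) \<ge> real (num4 r V) + n ^ 4 / 2000 - 2 * real (card (unclean r V q x y))"
  proof (rule flip_gain_normalised[OF r V _ n])
    show "q u < 3" for u by (simp add: q_def)
    show "wrong r q x y" using w wq by simp
    show "q x = 0" by (simp add: q_def)
    show "q y = 0 \<or> q y = 1" by (simp add: q_def j_def)
  qed (use sq in auto)
  then show ?thesis unfolding unclean_def wq .
qed

section \<open>The penalised extremal problem\<close>

text \<open>The distance from the blowups of three loops, counting ordered pairs.\<close>

definition part_dist :: "('a \<Rightarrow> 'a \<Rightarrow> bool) \<Rightarrow> 'a set \<Rightarrow> nat" where
  "part_dist r V = (LEAST d. \<exists>p. (\<forall>x. p x < 3) \<and> d = defects r V p)"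

lemma part_dist_attained: "\<exists>p. (\<forall>x. p x < 3) \<and> part_dist r V = defects r V p"
proof -
  have "\<exists>d p. (\<forall>x. p x < 3) \<and> d = defects r V p" by (intro exI[of _ "defects r V (\<lambda>_. 0)"] exI[of _ "\<lambda>_. 0"]) simp
  then show ?thesis unfolding part_dist_def by (rule LeastI_ex)
qed

lemma part_dist_le: "(\<And>x. p x < 3) \<Longrightarrow> part_dist r V \<le> defects r V p"
  unfolding part_dist_def by (intro Least_le) blast

text \<open>The relations vanish outside \<open>V\<close>, so that there are finitely many and a maximum over them exists.\<close>

definition rels :: "'a set \<Rightarrow> ('a \<Rightarrow> 'a \<Rightarrow> bool) set" where
  "rels V = {r. symp r \<and> irreflp r \<and> (\<forall>x y. r x y \<longrightarrow> x \<in> V \<and> y \<in> V)}"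

lemma finite_rels:
  assumes "finite V"
  shows "finite (rels V)"
proof (rule inj_on_finite[of "\<lambda>r. {(x, y). r x y}" _ "Pow (V \<times> V)"])
  show "inj_on (\<lambda>r. {(x, y). r x y}) (rels V)"
    by (rule inj_onI) (simp add: fun_eq_iff set_eq_iff)
  show "(\<lambda>r. {(x, y). r x y}) ` rels V \<subseteq> Pow (V \<times> V)" by (auto simp: rels_def)
  show "finite (Pow (V \<times> V))" using assms by simp
qed

lemma balanced_partition:
  assumes V: "finite V"
  obtains p where "\<And>x. p x < 3" "\<And>i. i < 3 \<Longrightarrow> card V div 3 \<le> card (cls V p i)"
proof -
  obtain h where h: "bij_betw h V {0..<card V}" using ex_bij_betw_finite_nat[OF V] by blast
  define p where "p x = h x mod 3" for x
  have "card V div 3 \<le> card (cls V p i)" if i: "i < 3" for i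
  proof -
    let ?K = "(\<lambda>k. 3 * k + i) ` {0..<card V div 3}"
    have K: "?K \<subseteq> h ` cls V p i"
    proof
      fix k assume "k \<in> ?K"
      then obtain m where m: "k = 3 * m + i" "m < card V div 3" by auto
      have "k < card V" using m i by linarith
      then have "k \<in> h ` V" using h by (simp add: bij_betw_def)
      then obtain x where x: "x \<in> V" "h x = k" by auto
      have "p x = i" using x(2) m(1) i by (simp add: p_def)
      then show "k \<in> h ` cls V p i" using x by (auto simp: cls_def)
    qed
    have fc: "finite (cls V p i)" using V by (simp add: cls_def)
    have "card ?K = card V div 3" by (subst card_image) (auto simp: inj_on_def)
    moreover have "card ?K \<le> card (h ` cls V p i)" using K fc by (intro card_mono) auto
    moreover have "card (h ` cls V p i) \<le> card (cls V p i)" using fc by (rule card_image_le)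
    ultimately show ?thesis by linarith
  qed
  moreover have "p x < 3" for x by (simp add: p_def)
  ultimately show thesis using that by blast
qed

lemma blowup_count_ge:
  assumes "q \<ge> 3" "q \<le> a" "q \<le> b" "q \<le> c"
  shows "real (blowup_count a b c) \<ge> (real q - 3) ^ 6 / 2"
proof -
  have mono: "q choose 3 \<le> m choose 3" "q choose 2 \<le> m choose 2" if "q \<le> m" for m
    using that by (rule binomial_right_mono)+
  have "blowup_count q q q \<le> blowup_count a b c"
    unfolding blowup_count_def using assms mono by (intro add_mono mult_le_mono) auto
  then have 1: "real (blowup_count q q q) \<le> real (blowup_count a b c)" by (rule of_nat_mono)
  have c3: "(real q - 3) ^ 3 / 6 \<le> real (q choose 3)" using choose_ge_real[of 3 q] assms by (simp add: fact_numeral)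
  have c2: "(real q - 3) ^ 2 / 2 \<le> real (q choose 2)"
  proof -
    have "(real q - 3) ^ 2 \<le> (real q) * (real q - 1)"
    proof -
      have "real q * (real q - 1) - (real q - 3) ^ 2 = 5 * real q - 9" by (simp add: power2_eq_square algebra_simps)
      then show ?thesis using assms(1) by linarith
    qed
    then show ?thesis unfolding choose2_real by simp
  qed
  have "(real q - 3) ^ 3 / 6 * ((real q - 3) ^ 2 / 2) * (real q - 3) \<le> real (q choose 3) * real (q choose 2) * real q"
    using assms(1) by (intro mult_mono c2 c3) auto
  then have "6 * ((real q - 3) ^ 3 / 6 * ((real q - 3) ^ 2 / 2) * (real q - 3)) \<le> real (blowup_count q q q)"
    unfolding blowup_count_def of_nat_add of_nat_mult by (simp add: mult_ac)
  moreover have "6 * ((real q - 3) ^ 3 / 6 * ((real q - 3) ^ 2 / 2) * (real q - 3)) = (real q - 3) ^ 6 / 2"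
    by (simp add: eval_nat_numeral)
  ultimately show ?thesis using 1 by linarith
qed

lemma balanced_count:
  assumes V: "finite V" and n: "n = real (card V)" "n \<ge> 100"
  obtains r where "r \<in> rels V" "97200 * real (num4 r V) \<ge> 48000 * real (card V choose 6) - 4800 * n ^ 5"
    "part_dist r V = 0"
proof -
  obtain p where p: "\<And>x. p x < 3" "\<And>i. i < 3 \<Longrightarrow> card V div 3 \<le> card (cls V p i)"
    using balanced_partition[OF V] by blast
  define r where "r x y \<longleftrightarrow> same_class p x y \<and> x \<in> V \<and> y \<in> V" for x y
  have rV: "r \<in> rels V" unfolding rels_def r_def same_class_def by (auto intro!: sympI irreflpI)
  define q where "q = card V div 3"
  have q: "real q \<ge> n / 3 - 1" "q \<ge> 3" using n by (auto simp: q_def)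
  have "num4 r V = num4 (same_class p) V" by (rule num4_cong) (simp add: r_def)
  also have "\<dots> = blowup_count (card (cls V p 0)) (card (cls V p 1)) (card (cls V p 2))"
    by (rule num4_same_class[OF V p(1)])
  finally have N: "real (num4 r V) \<ge> (real q - 3) ^ 6 / 2"
    using blowup_count_ge[OF q(2), of "card (cls V p 0)" "card (cls V p 1)" "card (cls V p 2)"] p(2)[of 0] p(2)[of 1] p(2)[of 2]
    by (simp add: q_def)
  have n0: "n > 0" using n by simp
  have "1 + real 6 * (- 12 / n) \<le> (1 + (- 12 / n)) ^ 6"
    using n by (intro Bernoulli_inequality) (simp add: field_simps)
  then have "(n / 3) ^ 6 * (1 + real 6 * (- 12 / n)) \<le> (n / 3) ^ 6 * (1 + (- 12 / n)) ^ 6"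
    by (intro mult_left_mono) auto
  also have "\<dots> = ((n / 3) * (1 + (- 12 / n))) ^ 6" by (rule power_mult_distrib[symmetric])
  also have "(n / 3) * (1 + (- 12 / n)) = n / 3 - 4" using n0 by (simp add: field_simps)
  also have "(n / 3 - 4) ^ 6 \<le> (real q - 3) ^ 6" using q n by (intro power_mono) auto
  finally have "(n / 3) ^ 6 * (1 + real 6 * (- 12 / n)) \<le> (real q - 3) ^ 6" .
  moreover have "(n / 3) ^ 6 * (1 + real 6 * (- 12 / n)) = (n ^ 6 - 72 * n ^ 5) / 729"
    using n0 by (simp add: eval_nat_numeral field_simps)
  ultimately have "97200 * real (num4 r V) \<ge> 200 / 3 * (n ^ 6 - 72 * n ^ 5)" using N by linarith
  moreover have "48000 * real (card V choose 6) \<le> 200 / 3 * n ^ 6"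
    using choose_le_real[of "card V" 6] n by (simp add: fact_numeral)
  ultimately have "97200 * real (num4 r V) \<ge> 48000 * real (card V choose 6) - 4800 * n ^ 5" by argo
  moreover have "part_dist r V = 0"
  proof -
    have "defects r V p = 0"
    proof -
      have "{(x, y). x \<in> V \<and> y \<in> V \<and> wrong r p x y} = {}" by (auto simp: wrong_def r_def same_class_def)
      then show ?thesis unfolding defects_def by (simp only: card.empty)
    qed
    then show ?thesis using part_dist_le[of p r V] p(1) by simp
  qed
  ultimately show thesis using that rV by blast
qed

lemma defects_le: "finite V \<Longrightarrow> real (defects r V p) \<le> real (card V) ^ 2"
proof -
  assume V: "finite V"
  have "defects r V p \<le> card (V \<times> V)" unfolding defects_def using V by (intro card_mono) auto
  then have "real (defects r V p) \<le> real (card (V \<times> V))" by (rule of_nat_mono)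
  then show ?thesis by (simp add: card_cartesian_product power2_eq_square)
qed

lemma flip_in_rels:
  assumes "r \<in> rels V" "x \<in> V" "y \<in> V" "x \<noteq> y"
  shows "flip r x y \<in> rels V"
proof -
  have r: "symp r" "irreflp r" "\<And>x y. r x y \<Longrightarrow> x \<in> V \<and> y \<in> V" using assms(1) by (auto simp: rels_def)
  have "u \<in> V \<and> v \<in> V" if f: "flip r x y u v" for u v
  proof (cases "{u, v} = {x, y}")
    case True
    then have "u \<in> {x, y}" "v \<in> {x, y}" by blast+
    then show ?thesis using assms(2,3) by blast
  next
    case False
    then have "r u v" using f by (simp add: flip_def)
    then show ?thesis by (rule r(3))
  qed
  then show ?thesis using symp_flip[OF r(1)] irreflp_flip[OF r(2) assms(4)] by (simp add: rels_def)
qed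

lemma clone_in_rels:
  assumes "r \<in> rels V" "x \<in> V" "w \<in> V"
  shows "clone r w x \<in> rels V"
proof -
  have r: "symp r" "irreflp r" "\<And>x y. r x y \<Longrightarrow> x \<in> V \<and> y \<in> V" using assms(1) by (auto simp: rels_def)
  have "symp (clone r w x)" 
  proof (rule sympI)
    fix u v assume "clone r w x u v"
    then show "clone r w x v u" unfolding clone_def Let_def by (rule sympD[OF r(1)])
  qed
  moreover have "irreflp (clone r w x)" 
    unfolding clone_def Let_def by (rule irreflpI) (rule irreflpD[OF r(2)])
  moreover have "clone r w x u v \<longrightarrow> u \<in> V \<and> v \<in> V" for u v
  proof
    assume c: "clone r w x u v"
    have "(if u = x then w else u) \<in> V" "(if v = x then w else v) \<in> V"
      using r(3) c unfolding clone_def Let_def by blast+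
    then show "u \<in> V \<and> v \<in> V" using assms(2) by (auto split: if_splits)
  qed
  ultimately show ?thesis by (simp add: rels_def)
qed

lemma defects_le_flip:
  assumes V: "finite V"
  shows "defects r V p \<le> defects (flip r x y) V p + 2"
proof -
  let ?W = "\<lambda>r. {(u, v). u \<in> V \<and> v \<in> V \<and> wrong r p u v}"
  have "(u, v) \<in> ?W (flip r x y) \<union> {(x, y), (y, x)}" if uv: "(u, v) \<in> ?W r" for u v
  proof (cases "{u, v} = {x, y}")
    case True
    then have "(u = x \<and> v = y) \<or> (u = y \<and> v = x)" by (simp add: doubleton_eq_iff)
    then have "(u, v) \<in> {(x, y), (y, x)}" by (elim disjE) simp_all
    then show ?thesis by (rule UnI2)
  next
    case False
    then have "wrong (flip r x y) p u v = wrong r p u v" by (simp only: wrong_def flip_def if_False)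
    then have "(u, v) \<in> ?W (flip r x y)" using uv by simp
    then show ?thesis by (rule UnI1)
  qed
  then have sub: "?W r \<subseteq> ?W (flip r x y) \<union> {(x, y), (y, x)}" by (rule subrelI)
  have fin0: "finite (?W s)" for s
  proof (rule finite_subset)
    show "?W s \<subseteq> V \<times> V" by blast
    show "finite (V \<times> V)" using V by simp
  qed
  have bound: "card A \<le> card B + 2" if "A \<subseteq> B \<union> {(x, y), (y, x)}" "finite B" for A B
  proof -
    have "card A \<le> card (insert (x, y) (insert (y, x) B))" using that by (intro card_mono) auto
    also have "\<dots> \<le> Suc (card (insert (y, x) B))" using that(2) by (simp add: card_insert_if)
    also have "\<dots> \<le> Suc (Suc (card B))" using that(2) by (simp add: card_insert_if)
    finally show ?thesis by simp
  qed
  show ?thesis unfolding defects_def by (rule bound[OF sub fin0])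
qed

lemma part_dist_le_shift:
  assumes "\<And>p. defects r V p \<le> defects s V p + k"
  shows "part_dist r V \<le> part_dist s V + k"
proof -
  obtain p where p': "\<forall>x. p x < 3" "part_dist s V = defects s V p" using part_dist_attained[of s V] by blast
  then have p: "p x < 3" "part_dist s V = defects s V p" for x by auto
  have "part_dist r V \<le> defects r V p" by (rule part_dist_le) (rule p(1))
  then show ?thesis using assms[of p] p(2) by linarith
qed

text \<open>The constants are chosen backwards: \<open>1/20000\<close> is the allowed fraction of wrong pairs at a vertex, small
  enough for the flip to pay; \<open>\<epsilon>\<close> and \<open>\<omega>\<close> are what \<open>wdeg_small\<close> needs for it; \<open>\<tau> n\<close> is the weight
  put on a vertex in \<open>local_bound\<close>, which balances its two error terms; \<open>\<delta>\<close> bounds the deficit, and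
  the penalty \<open>c\<close> is so small that it does not affect any comparison.\<close>

lemma penalised_maximum_is_partitioned:
  fixes r :: "'a \<Rightarrow> 'a \<Rightarrow> bool" and M \<delta> \<tau> \<epsilon> \<omega> c n :: real
  assumes rV: "r \<in> rels V" and V: "finite V" and n: "n = real (card V)" "n \<ge> 10000"
    and M: "M > 0" "\<And>T y z. card T = 4 \<Longrightarrow> \<bar>real_of_int (kernel r T y z)\<bar> \<le> M"
    and \<epsilon>: "\<epsilon> = (1 / 20000)\<^sup>2 / 32" and \<omega>: "\<omega> = (1 / 20000)\<^sup>2 / 13824"
    and \<tau>: "\<tau> > 0" "\<tau> * (M + 1) = \<omega> / 8"
    and \<delta>: "\<delta> > 0" "\<delta> \<le> \<tau>\<^sup>2" "\<delta> \<le> \<epsilon> / 1000000" "\<delta> \<le> \<omega> / 100"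
    and c: "c = \<delta> / 400000"
    and large: "2 * (M + 4800) \<le> \<delta> * n" "16 \<le> \<epsilon> * n" "8 * (3 * M + 97200) \<le> \<omega> * n"
    and opt: "\<And>s. s \<in> rels V \<Longrightarrow> real (num4 s V) + c * n ^ 4 * real (part_dist s V)
        \<le> real (num4 r V) + c * n ^ 4 * real (part_dist r V)"
  shows "part_dist r V = 0"
proof (rule ccontr)
  assume pos: "part_dist r V \<noteq> 0"
  have r: "symp r" "irreflp r" using rV by (auto simp: rels_def)
  have n0: "n > 0" "card V \<ge> 6" "V \<noteq> {}" using n by auto
  have c0: "c > 0" using c \<delta>(1) by simp
  have pow: "n ^ 5 * n = n ^ 6" "n ^ 4 * n = n ^ 5" "n ^ 3 * n = n ^ 4" "n ^ 4 * n ^ 2 = n ^ 6" "n ^ 2 * n ^ 2 = n ^ 4" "n * n = n ^ 2"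
    by (simp_all add: eval_nat_numeral)
  have npos: "n ^ 6 > 0" "n ^ 5 > 0" "n ^ 4 > 0" "n ^ 2 > 0" using n0 by simp_all
  obtain b where b: "b \<in> rels V" "97200 * real (num4 b V) \<ge> 48000 * real (card V choose 6) - 4800 * n ^ 5" "part_dist b V = 0"
    using balanced_count[OF V n(1)] n(2) by auto
  have "real (part_dist r V) \<le> n ^ 2"
  proof -
    have "part_dist r V \<le> defects r V (\<lambda>_. 0)" by (rule part_dist_le) simp
    then have "real (part_dist r V) \<le> real (defects r V (\<lambda>_. 0))" by (rule of_nat_mono)
    then show ?thesis using defects_le[OF V, of r "\<lambda>_. 0"] n(1) by simp
  qed
  then have "c * n ^ 4 * real (part_dist r V) \<le> c * n ^ 4 * n ^ 2" using c0 n0 by (intro mult_left_mono) auto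
  then have "c * n ^ 4 * real (part_dist r V) \<le> c * n ^ 6" by (simp only: mult.assoc pow)
  then have "real (num4 b V) \<le> real (num4 r V) + c * n ^ 6" using opt[OF b(1)] b(3) by simp
  moreover have "97200 * (c * n ^ 6) \<le> \<delta> / 4 * n ^ 6" unfolding c using \<delta>(1) npos(1) by simp
  ultimately have lower: "97200 * real (num4 r V) \<ge> 48000 * real (card V choose 6) - 4800 * n ^ 5 - \<delta> / 4 * n ^ 6"
    using b(2) by linarith
  have "2 * (M + 4800) * n ^ 5 \<le> \<delta> * n * n ^ 5" using large(1) npos(2) by (intro mult_right_mono) auto
  moreover have "\<delta> * n * n ^ 5 = \<delta> * n ^ 6" by (simp add: eval_nat_numeral)
  ultimately have big: "M * n ^ 5 + 4800 * n ^ 5 \<le> \<delta> / 2 * n ^ 6" by argo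
  have Mn: "M * n ^ 5 \<ge> 0" using M(1) npos(2) by simp
  have dn: "\<delta> * n ^ 6 > 0" using \<delta>(1) npos(1) by simp
  have low: "97200 * real (num4 r V) \<ge> 48000 * real (card V choose 6) - \<delta> * n ^ 6"
    using lower big Mn dn by linarith
  have glob: "97200 * real (num4 r V) + real (bad6 r V) + square_sum r V \<le> 48000 * real (card V choose 6) + M * n ^ 5"
    unfolding n(1) by (rule global_bound[OF r V M])
  have sq0: "square_sum r V \<ge> 0" by (rule square_sum_nonneg[OF V])
  have bad: "real (bad6 r V) \<le> \<delta> * n ^ 6" and sq: "square_sum r V \<le> \<delta> * n ^ 6"
    using glob lower big dn sq0 by linarith+
  have d1: "\<delta> \<le> 1 / 10000" "\<epsilon> > 0" "\<omega> > 0" using \<delta>(3) \<epsilon> \<omega> by (simp_all add: power2_eq_square)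
  obtain p where p': "\<forall>x. p x < 3" "part_dist r V = defects r V p" using part_dist_attained[of r V] by blast
  then have p: "p x < 3" "part_dist r V = defects r V p" for x by auto
  have W: "real (defects r V p) \<le> \<epsilon> * n ^ 2"
  proof -
    have "real (card V choose 6) \<ge> (n ^ 6 - 36 * n ^ 5) / 720" using choose6_ge[OF n0(2)] n(1) by simp
    moreover have "36 * n ^ 5 \<le> n ^ 6 / 100"
    proof -
      have "3600 * n ^ 5 \<le> n * n ^ 5" using n(2) npos(2) by (intro mult_right_mono) auto
      then show ?thesis using pow(1) by (simp add: mult.commute)
    qed
    moreover have "\<delta> * n ^ 6 \<le> 1 / 10000 * n ^ 6" using d1(1) npos(1) by (intro mult_right_mono) auto
    ultimately have C: "real (card V choose 6) \<ge> 99 / 72000 * n ^ 6" and D: "\<delta> * n ^ 6 \<le> n ^ 6 / 10000"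
      by argo+
    have "97200 * real (num4 r V) \<ge> 65 * n ^ 6" using low C D npos(1) by linarith
    moreover have "real (bad6 r V) \<le> n ^ 6 / 10000" using bad D by linarith
    ultimately have "1 / 10000 * n ^ 6 \<le> real (num4 r V) - real (bad6 r V)" using npos(1) by linarith
    then obtain q where q: "\<And>x. q x < 3"
      "real (defects r V q) \<le> 30 * real (bad6 r V) / (1 / 10000 * real (card V) ^ 4) + 8 * real (card V)"
      using partition_of_few_bad[OF r V n0(3), of "1 / 10000"] n(1) by auto
    have "30 * real (bad6 r V) / (1 / 10000 * n ^ 4) \<le> 30 * (\<delta> * n ^ 6) / (1 / 10000 * n ^ 4)"
      using bad npos(3) by (intro divide_right_mono mult_left_mono) auto
    also have "\<dots> = 300000 * \<delta> * n ^ 2" using n0(1) by (simp add: eval_nat_numeral)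
    also have "\<dots> \<le> \<epsilon> / 2 * n ^ 2" using \<delta>(3) npos(4) d1(2) by (intro mult_right_mono) auto
    finally have "30 * real (bad6 r V) / (1 / 10000 * n ^ 4) \<le> \<epsilon> / 2 * n ^ 2" .
    moreover have "8 * n \<le> \<epsilon> / 2 * n ^ 2"
    proof -
      have "16 * n \<le> \<epsilon> * n * n" using large(2) n0(1) by (intro mult_right_mono) auto
      then show ?thesis using pow(6) by (simp add: mult.assoc)
    qed
    ultimately have "real (defects r V q) \<le> \<epsilon> * n ^ 2" using q(2) n(1) by simp
    moreover have "part_dist r V \<le> defects r V q" by (rule part_dist_le) (rule q(1))
    ultimately show ?thesis using p(2) by linarith
  qed
  have sizes: "\<bar>real (card (cls V p i)) - n / 3\<bar> \<le> n / 10" if "i < 3" for i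
    by (rule class_sizes[OF r(2) V p(1) n low W _ that]) (use \<delta>(3) \<epsilon> in \<open>simp add: power2_eq_square\<close>)
  \<comment> \<open>a twin of w in place of x changes the distance by at most 2n, so maximality compares x and w\<close>
  have clone: "real (num4_at r V w) \<le> real (num4_at r V x) + n ^ 4 + 2 * c * n ^ 5" if xw: "x \<in> V" "w \<in> V" for x w
  proof (cases "x = w")
    case True
    then show ?thesis using npos c0 by simp
  next
    case False
    have "part_dist r V \<le> part_dist (clone r w x) V + 2 * card V"
      by (rule part_dist_le_shift) (rule defects_clone[OF r V xw(1)])
    then have "real (part_dist r V) \<le> real (part_dist (clone r w x) V + 2 * card V)" by (rule of_nat_mono)
    then have "real (part_dist r V) \<le> real (part_dist (clone r w x) V) + 2 * n" using n(1) by simp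
    then have "c * n ^ 4 * real (part_dist r V) \<le> c * n ^ 4 * (real (part_dist (clone r w x) V) + 2 * n)"
      using c0 npos(3) by (intro mult_left_mono) auto
    also have "\<dots> = c * n ^ 4 * real (part_dist (clone r w x) V) + 2 * c * n ^ 5" by (simp add: eval_nat_numeral algebra_simps)
    finally have "c * n ^ 4 * real (part_dist r V) \<le> c * n ^ 4 * real (part_dist (clone r w x) V) + 2 * c * n ^ 5" .
    then show ?thesis
      using opt[OF clone_in_rels[OF rV xw]] num4_clone[OF V xw False, of r] n(1) by simp
  qed
  obtain x0 where x0: "x0 \<in> V" "6 * real (num4 r V) \<le> n * real (num4_at r V x0)"
  proof -
    have "\<exists>x\<in>V. 6 * real (num4 r V) \<le> n * real (num4_at r V x)"
    proof (rule ccontr)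
      assume "\<not> ?thesis"
      then have "real (num4_at r V x) < 6 * real (num4 r V) / n" if "x \<in> V" for x
        using that n0(1) by (auto simp: field_simps not_le)
      then have "(\<Sum>x\<in>V. real (num4_at r V x)) < (\<Sum>x\<in>V. 6 * real (num4 r V) / n)"
        using V n0(3) by (intro sum_strict_mono) auto
      also have "\<dots> = real (6 * num4 r V)" using n(1) n0(1) by simp
      also have "\<dots> = (\<Sum>x\<in>V. real (num4_at r V x))" unfolding sum_num4_at[OF V, of r, symmetric] by simp
      finally show False by simp
    qed
    then show thesis using that by blast
  qed
  have absorb: "6 * real (card V choose 6) = n * real ((card V - 1) choose 5)"
  proof -
    have "6 * (card V choose 6) = card V * ((card V - 1) choose 5)"
      using binomial_absorption[of 5 "card V"] by simp
    then have "real (6 * (card V choose 6)) = real (card V * ((card V - 1) choose 5))" by (rule arg_cong)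
    then show ?thesis using n(1) by simp
  qed
  \<comment> \<open>a vertex x0 of at least average count inherits the global lower bound\<close>
  have at0: "97200 * real (num4_at r V x0) \<ge> 48000 * real ((card V - 1) choose 5) - 6 * \<delta> * n ^ 5"
  proof -
    have "n * (48000 * real ((card V - 1) choose 5) - 6 * \<delta> * n ^ 5)
      = 48000 * (6 * real (card V choose 6)) - 6 * (\<delta> * n ^ 6)"
      unfolding absorb by (simp add: algebra_simps eval_nat_numeral)
    also have "\<dots> \<le> 97200 * (6 * real (num4 r V))" using low by linarith
    also have "\<dots> \<le> n * (97200 * real (num4_at r V x0))" using x0(2) by linarith
    finally show ?thesis using n0(1) by (simp only: mult_le_cancel_left_pos)
  qed
  \<comment> \<open>by the comparison with x0 every vertex has nearly the average count\<close>
  have bad_at: "real (bad6_at r V x) < \<omega> * n ^ 5" if x: "x \<in> V" for x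
  proof -
    have t: "\<tau> * n > 0" using \<tau>(1) n0(1) by simp
    have L: "97200 * real (num4_at r V x) + real (bad6_at r V x)
       \<le> 48000 * real ((card V - 1) choose 5) + square_sum r V / (\<tau> * n) + (\<tau> * n + 3) * M * n ^ 4"
      unfolding n(1) by (rule local_bound[OF r V M x t[unfolded n(1)]])
    have "square_sum r V / (\<tau> * n) \<le> (\<tau>\<^sup>2 * n ^ 6) / (\<tau> * n)"
      using sq \<delta>(2) npos(1) t by (intro divide_right_mono order_trans[OF sq mult_right_mono]) auto
    also have "\<dots> = \<tau> * n ^ 5" using \<tau>(1) n0(1) by (simp add: eval_nat_numeral)
    finally have s1: "square_sum r V / (\<tau> * n) \<le> \<tau> * n ^ 5" .
    have s2: "(\<tau> * n + 3) * M * n ^ 4 = \<tau> * M * n ^ 5 + 3 * M * n ^ 4" by (simp add: algebra_simps eval_nat_numeral)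
    have s3: "\<tau> * n ^ 5 + \<tau> * M * n ^ 5 = \<omega> / 8 * n ^ 5" unfolding \<tau>(2)[symmetric] by (simp add: algebra_simps)
    have s4: "97200 * n ^ 4 + 3 * M * n ^ 4 \<le> \<omega> / 8 * n ^ 5"
    proof -
      have "8 * (3 * M + 97200) * n ^ 4 \<le> \<omega> * n * n ^ 4" using large(3) npos(3) by (intro mult_right_mono) auto
      moreover have "\<omega> * n * n ^ 4 = \<omega> * n ^ 5" by (simp add: eval_nat_numeral)
      ultimately show ?thesis by argo
    qed
    have s5: "194400 * c * n ^ 5 + 6 * \<delta> * n ^ 5 \<le> 7 * \<omega> / 100 * n ^ 5"
    proof -
      have "194400 * c + 6 * \<delta> \<le> 7 * \<omega> / 100" using c \<delta>(1,4) by linarith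
      then have "(194400 * c + 6 * \<delta>) * n ^ 5 \<le> 7 * \<omega> / 100 * n ^ 5" using npos(2) by (intro mult_right_mono) auto
      then show ?thesis by (simp add: algebra_simps)
    qed
    have s6: "\<omega> * n ^ 5 > 0" using d1(3) npos(2) by simp
    have s3': "\<tau> * n ^ 5 + \<tau> * M * n ^ 5 = (\<omega> * n ^ 5) / 8" using s3 by argo
    have s4': "97200 * n ^ 4 + 3 * M * n ^ 4 \<le> (\<omega> * n ^ 5) / 8" using s4 by argo
    have s5': "194400 * (c * n ^ 5) + 6 * (\<delta> * n ^ 5) \<le> 7 / 100 * (\<omega> * n ^ 5)" using s5 by argo
    have at: "97200 * real (num4_at r V x0) \<ge> 48000 * real ((card V - 1) choose 5) - 6 * (\<delta> * n ^ 5)" using at0 by argo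
    have cl: "97200 * real (num4_at r V x0) \<le> 97200 * real (num4_at r V x) + 97200 * n ^ 4 + 194400 * (c * n ^ 5)"
      using clone[OF x x0(1)] by argo
    show ?thesis using L[unfolded s2] s1 s3' s4' s5' s6 at cl by linarith
  qed
  have wd: "real (wdeg r V p x) \<le> 1 / 20000 * n" if x: "x \<in> V" for x
  proof (rule wdeg_small[OF r V x p(1) n _ sizes])
    fix j :: nat assume "j < 3"
    then have "part_dist r V \<le> defects r V (p(x := j))" using p(1) by (intro part_dist_le) simp
    then show "defects r V p \<le> defects r V (p(x := j))" using p(2) by simp
  qed (use W bad_at[OF x] in \<open>simp_all add: \<epsilon> \<omega>\<close>)
  obtain x y where xy: "x \<in> V" "y \<in> V" "wrong r p x y"
  proof -
    have "{(x, y). x \<in> V \<and> y \<in> V \<and> wrong r p x y} \<noteq> {}"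
    proof
      assume "{(x, y). x \<in> V \<and> y \<in> V \<and> wrong r p x y} = {}"
      then have "defects r V p = 0" unfolding defects_def by (simp only: card.empty)
      then show False using pos p(2) by simp
    qed
    then show thesis using that by blast
  qed
  have ne: "x \<noteq> y" using xy(3) by (simp add: wrong_def)
  have "real (card (unclean r V p x y)) \<le> (real (wdeg r V p x) + real (wdeg r V p y)) * n ^ 3 + real (defects r V p) * n ^ 2"
    unfolding n(1) by (rule card_unclean[OF r(1) V xy(1,2) ne])
  also have "\<dots> \<le> (1 / 20000 * n + 1 / 20000 * n) * n ^ 3 + (\<epsilon> * n ^ 2) * n ^ 2"
    using wd xy W n0(1) by (intro add_mono mult_right_mono) auto
  also have "\<dots> = (1 / 10000 + \<epsilon>) * n ^ 4" by (simp add: algebra_simps eval_nat_numeral)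
  also have "\<dots> \<le> (1 / 8000) * n ^ 4" using npos(3) \<epsilon> by (intro mult_right_mono) (auto simp: power2_eq_square)
  finally have U: "real (card (unclean r V p x y)) \<le> 1 / 8000 * n ^ 4" .
  have G: "real (num4 (flip r x y) V) \<ge> real (num4 r V) + n ^ 4 / 2000 - 2 * real (card (unclean r V p x y))"
    by (rule flip_gain[OF r V xy(1,2) p(1) n xy(3) sizes])
  have "part_dist r V \<le> part_dist (flip r x y) V + 2"
    by (rule part_dist_le_shift) (rule defects_le_flip[OF V])
  then have "real (part_dist r V) \<le> real (part_dist (flip r x y) V + 2)" by (rule of_nat_mono)
  then have "c * n ^ 4 * real (part_dist r V) \<le> c * n ^ 4 * (real (part_dist (flip r x y) V) + 2)"
    using c0 npos(3) by (intro mult_left_mono) auto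
  then have "c * n ^ 4 * real (part_dist r V) \<le> c * n ^ 4 * real (part_dist (flip r x y) V) + 2 * c * n ^ 4"
    by (simp add: algebra_simps)
  moreover have "2 * c * n ^ 4 \<le> 1 / 8000 * n ^ 4" using c d1(1) npos(3) by (intro mult_right_mono) auto
  ultimately show False using opt[OF flip_in_rels[OF rV xy(1,2) ne]] U G npos(3) by linarith
qed

text \<open>At the maximiser the penalty vanishes, so its count alone is at least the penalised count of any other relation.\<close>

lemma partitioned_beats_by_distance:
  obtains c :: real and n0 :: nat where "c > 0"
    "\<And>(V :: 'a set) r. finite V \<Longrightarrow> n0 \<le> card V \<Longrightarrow> r \<in> rels V \<Longrightarrow>
      \<exists>s\<in>rels V. real (num4 r V) + c * real (card V) ^ 4 * real (part_dist r V) \<le> real (num4 s V)"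
proof -
  obtain M :: real where M: "M > 0"
    "\<And>(r :: 'a \<Rightarrow> 'a \<Rightarrow> bool) T y z. symp r \<Longrightarrow> irreflp r \<Longrightarrow> card T = 4 \<Longrightarrow> \<bar>real_of_int (kernel r T y z)\<bar> \<le> M"
    using kernel_bounded by blast
  define \<epsilon> \<omega> :: real where \<epsilon>: "\<epsilon> = (1 / 20000)\<^sup>2 / 32" and \<omega>: "\<omega> = (1 / 20000)\<^sup>2 / 13824"
  have e0: "\<epsilon> > 0" "\<omega> > 0" by (simp_all add: \<epsilon> \<omega>)
  define \<tau> where "\<tau> = \<omega> / (8 * (M + 1))"
  have \<tau>: "\<tau> > 0" "\<tau> * (M + 1) = \<omega> / 8" 
  proof -
    show "\<tau> > 0" using M(1) e0 by (simp add: \<tau>_def)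
    have "M + 1 \<noteq> 0" using M(1) by simp
    then show "\<tau> * (M + 1) = \<omega> / 8" unfolding \<tau>_def by (simp add: field_simps)
  qed
  define \<delta> where "\<delta> = min (\<tau>\<^sup>2) (min (\<epsilon> / 1000000) (\<omega> / 100))"
  have \<delta>: "\<delta> > 0" "\<delta> \<le> \<tau>\<^sup>2" "\<delta> \<le> \<epsilon> / 1000000" "\<delta> \<le> \<omega> / 100"
    using \<tau>(1) e0 by (simp_all add: \<delta>_def min_le_iff_disj)
  define c where c: "c = \<delta> / 400000"
  define n0 where "n0 = nat \<lceil>10000 + 2 * (M + 4800) / \<delta> + 16 / \<epsilon> + 8 * (3 * M + 97200) / \<omega>\<rceil>"
  have "\<exists>s\<in>rels V. real (num4 r V) + c * real (card V) ^ 4 * real (part_dist r V) \<le> real (num4 s V)"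
    if V: "finite V" and big: "n0 \<le> card V" and r: "r \<in> rels V" for V :: "'a set" and r
  proof -
    define n where n: "n = real (card V)"
    have b: "10000 + 2 * (M + 4800) / \<delta> + 16 / \<epsilon> + 8 * (3 * M + 97200) / \<omega> \<le> n"
      using big unfolding n0_def n by linarith
    have t: "2 * (M + 4800) / \<delta> \<ge> 0" "16 / \<epsilon> \<ge> 0" "8 * (3 * M + 97200) / \<omega> \<ge> 0" using M(1) \<delta>(1) e0 by simp_all
    have n1: "n \<ge> 10000" "2 * (M + 4800) / \<delta> \<le> n" "16 / \<epsilon> \<le> n" "8 * (3 * M + 97200) / \<omega> \<le> n"
      using b t by linarith+
    have large: "2 * (M + 4800) \<le> \<delta> * n" "16 \<le> \<epsilon> * n" "8 * (3 * M + 97200) \<le> \<omega> * n"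
      using n1(2-4) \<delta>(1) e0 by (simp_all add: pos_divide_le_eq mult.commute)
    define \<Psi> where "\<Psi> s = real (num4 s V) + c * n ^ 4 * real (part_dist s V)" for s
    have fin: "finite (\<Psi> ` rels V)" using finite_rels[OF V] by simp
    have "Max (\<Psi> ` rels V) \<in> \<Psi> ` rels V" using fin r by (intro Max_in) auto
    then obtain s where s: "s \<in> rels V" "\<Psi> s = Max (\<Psi> ` rels V)" by auto
    have opt: "\<Psi> u \<le> \<Psi> s" if "u \<in> rels V" for u unfolding s(2) using fin that by (intro Max_ge) auto
    have ss: "symp s" "irreflp s" using s(1) by (auto simp: rels_def)
    have "part_dist s V = 0"
      by (rule penalised_maximum_is_partitioned[OF s(1) V n n1(1) M(1) M(2)[OF ss] \<epsilon> \<omega> \<tau> \<delta> c large opt[unfolded \<Psi>_def]])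
    then have "\<Psi> s = real (num4 s V)" by (simp add: \<Psi>_def)
    then have "real (num4 r V) + c * real (card V) ^ 4 * real (part_dist r V) \<le> real (num4 s V)"
      using opt[OF r] unfolding \<Psi>_def n by linarith
    then show ?thesis using s(1) by (rule bexI)
  qed
  moreover have "c > 0" using \<delta>(1) c by simp
  ultimately show thesis using that by blast
qed

section \<open>Graphs and their densities\<close>

definition adj :: "'a graph \<Rightarrow> 'a \<Rightarrow> 'a \<Rightarrow> bool" where
  "adj G x y \<longleftrightarrow> {x, y} \<in> snd G"

definition graph_of :: "'a set \<Rightarrow> ('a \<Rightarrow> 'a \<Rightarrow> bool) \<Rightarrow> 'a graph" where
  "graph_of V r = (V, {{x, y} | x y. r x y})"

lemma adj_rels:
  assumes "graph G"
  shows "adj G \<in> rels (fst G)"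
proof -
  have *: "x \<in> fst G \<and> y \<in> fst G \<and> x \<noteq> y" if "{x, y} \<in> snd G" for x y
  proof -
    from that assms have "{x, y} \<in> {{x, y} | x y. x \<in> fst G \<and> y \<in> fst G \<and> x \<noteq> y}"
      unfolding graph_def by (elim conjE) (rule subsetD)
    then obtain u v where uv: "{x, y} = {u, v}" "u \<in> fst G" "v \<in> fst G" "u \<noteq> v" by blast
    then consider "x = u" "y = v" | "x = v" "y = u" by (auto simp: doubleton_eq_iff)
    then show ?thesis by cases (use uv in simp_all)
  qed
  have "symp (adj G)" by (rule sympI) (simp add: adj_def insert_commute)
  moreover have "irreflp (adj G)" 
  proof (rule irreflpI)
    show "\<not> adj G x x" for x using *[of x x] by (auto simp: adj_def)
  qed
  ultimately show ?thesis using * by (simp add: rels_def adj_def)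
qed

lemma edges_eq:
  assumes "graph G"
  shows "snd G = {{x, y} | x y. adj G x y}"
proof -
  have "\<exists>x y. e = {x, y} \<and> {x, y} \<in> snd G" if "e \<in> snd G" for e
  proof -
    have "e \<in> {{x, y} | x y. x \<in> fst G \<and> y \<in> fst G \<and> x \<noteq> y}"
      using that assms unfolding graph_def by (elim conjE) (rule subsetD)
    then obtain x y where "e = {x, y}" by blast
    then show ?thesis using that by blast
  qed
  then show ?thesis unfolding adj_def by blast
qed

lemma graph_graph_of:
  assumes "r \<in> rels V" "finite V"
  shows "graph (graph_of V r)"
proof -
  have "x \<in> V \<and> y \<in> V \<and> x \<noteq> y" if "r x y" for x y
    using assms(1) that by (auto simp: rels_def irreflp_def)
  then have "{{x, y} | x y. r x y} \<subseteq> {{x, y} | x y. x \<in> V \<and> y \<in> V \<and> x \<noteq> y}" by blast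
  then show ?thesis unfolding graph_def graph_of_def using assms(2) by simp
qed

lemma adj_graph_of:
  assumes "r \<in> rels V"
  shows "adj (graph_of V r) = r"
proof (intro ext)
  fix x y
  have "symp r" using assms by (simp add: rels_def)
  then have s: "r u v \<Longrightarrow> r v u" for u v by (rule sympD)
  show "adj (graph_of V r) x y = r x y"
  proof
    assume "adj (graph_of V r) x y"
    then obtain u v where uv: "{x, y} = {u, v}" "r u v" unfolding adj_def graph_of_def by auto
    then consider "x = u" "y = v" | "x = v" "y = u" by (auto simp: doubleton_eq_iff)
    then show "r x y" by cases (use uv s in simp_all)
  next
    assume "r x y"
    then show "adj (graph_of V r) x y" unfolding adj_def graph_of_def by auto
  qed
qed

lemma edge_density_num4:
  assumes "graph G"
  shows "edge_density 6 4 G = real (num4 (adj G) (fst G)) / real (card (fst G) choose 6)"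
proof -
  have "{e \<in> snd G. e \<subseteq> A} = {{x, y} | x y. x \<in> A \<and> y \<in> A \<and> adj G x y}" for A
    unfolding edges_eq[OF assms] by auto
  then have "card {e \<in> snd G. e \<subseteq> A} = edges_in (adj G) A" for A by (simp only: edges_in_def)
  then show ?thesis unfolding edge_density_def graph_order_def num4_def ksub_def by (simp add: conj_assoc)
qed

lemma num4_le_choose: "finite V \<Longrightarrow> num4 r V \<le> card V choose 6"
proof -
  assume V: "finite V"
  have "num4 r V \<le> card (ksub 6 V)" unfolding num4_def by (rule card_mono) (use V in \<open>auto simp: finite_ksub\<close>)
  then show ?thesis using card_ksub[OF V, of 6] by simp
qed

definition densities :: "nat \<Rightarrow> real set" where
  "densities n = {edge_density 6 4 G | G :: nat graph. graph G \<and> graph_order G = n}"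

lemma finite_densities: "finite (densities n)"
proof (rule finite_subset)
  show "densities n \<subseteq> (\<lambda>k. real k / real (n choose 6)) ` {..n choose 6}"
  proof
    fix d assume "d \<in> densities n"
    then obtain G :: "nat graph" where G: "d = edge_density 6 4 G" "graph G" "card (fst G) = n"
      by (auto simp: densities_def graph_order_def)
    then have "num4 (adj G) (fst G) \<le> n choose 6" using num4_le_choose[of "fst G"] by (auto simp: graph_def)
    then show "d \<in> (\<lambda>k. real k / real (n choose 6)) ` {..n choose 6}" using G edge_density_num4[OF G(2)] by auto
  qed
qed simp

lemma edge_density_le_max:
  fixes G :: "nat graph"
  assumes "graph G"
  shows "edge_density 6 4 G \<le> max_edge_density 6 4 (graph_order G)"
proof -
  have "edge_density 6 4 G \<in> densities (graph_order G)" using assms unfolding densities_def by blast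
  then show ?thesis unfolding max_edge_density_def densities_def[symmetric] using finite_densities by (intro Max_ge)
qed

lemma num4_le_max:
  fixes V :: "nat set"
  assumes "r \<in> rels V" "finite V"
  shows "real (num4 r V) / real (card V choose 6) \<le> max_edge_density 6 4 (card V)"
  using edge_density_le_max[OF graph_graph_of[OF assms]] edge_density_num4[OF graph_graph_of[OF assms]]
  unfolding adj_graph_of[OF assms(1)] by (simp add: graph_of_def graph_order_def)

lemma max_edge_density_attained:
  obtains G :: "nat graph" where "graph G" "card (fst G) = n" "max_edge_density 6 4 n = edge_density 6 4 G"
proof -
  have "graph ({..<n}, {} :: nat set set)" by (simp add: graph_def)
  then have "edge_density 6 4 ({..<n}, {} :: nat set set) \<in> densities n"
    unfolding densities_def graph_order_def by (intro CollectI exI[of _ "({..<n}, {})"]) simp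
  then have "Max (densities n) \<in> densities n" using finite_densities by (intro Max_in) auto
  then have "max_edge_density 6 4 n \<in> densities n" unfolding max_edge_density_def densities_def[symmetric] .
  then show thesis using that unfolding densities_def graph_order_def by auto
qed

lemma over_choose_tendsto_0: "(\<lambda>n. K * real n ^ 5 / real (n choose 6)) \<longlonglongrightarrow> 0"
proof -
  have "(\<lambda>n. \<bar>K\<bar> * 46080 * (1 / real n)) \<longlonglongrightarrow> \<bar>K\<bar> * 46080 * 0"
    by (intro tendsto_mult tendsto_const lim_1_over_n)
  then have lim: "(\<lambda>n. \<bar>K\<bar> * 46080 * (1 / real n)) \<longlonglongrightarrow> 0" by simp
  show ?thesis
  proof (rule tendsto_0_le[OF lim, where K = 1])
    show "\<forall>\<^sub>F n in sequentially. norm (K * real n ^ 5 / real (n choose 6)) \<le> norm (\<bar>K\<bar> * 46080 * (1 / real n)) * 1"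
    proof (rule eventually_sequentiallyI[of 12])
      fix n :: nat assume n: "12 \<le> n"
      have "(real n / 2) ^ 6 \<le> (real n - 6) ^ 6" using n by (intro power_mono) auto
      then have c: "real n ^ 6 / 46080 \<le> real (n choose 6)"
        using choose_ge_real[of 6 n] n by (simp add: fact_numeral power_divide)
      have "norm (K * real n ^ 5 / real (n choose 6)) = \<bar>K\<bar> * real n ^ 5 / real (n choose 6)"
        by (simp add: abs_mult)
      also have "\<dots> \<le> \<bar>K\<bar> * real n ^ 5 / (real n ^ 6 / 46080)"
        using n c by (intro divide_left_mono) auto
      also have "\<dots> = \<bar>K\<bar> * 46080 * (1 / real n)" using n by (simp add: eval_nat_numeral)
      also have "\<dots> \<le> norm (\<bar>K\<bar> * 46080 * (1 / real n)) * 1" by simp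
      finally show "norm (K * real n ^ 5 / real (n choose 6)) \<le> norm (\<bar>K\<bar> * 46080 * (1 / real n)) * 1" .
    qed
  qed
qed

lemma max_edge_density_tendsto: "max_edge_density 6 4 \<longlonglongrightarrow> 40 / 81"
proof -
  obtain M :: real where M: "M > 0"
    "\<And>(r :: nat \<Rightarrow> nat \<Rightarrow> bool) T y z. symp r \<Longrightarrow> irreflp r \<Longrightarrow> card T = 4 \<Longrightarrow> \<bar>real_of_int (kernel r T y z)\<bar> \<le> M"
    using kernel_bounded by blast
  have upper: "max_edge_density 6 4 n \<le> 40 / 81 + M / 97200 * real n ^ 5 / real (n choose 6)" if n: "n \<ge> 6" for n
  proof -
    obtain G :: "nat graph" where G: "graph G" "card (fst G) = n" "max_edge_density 6 4 n = edge_density 6 4 G"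
      by (rule max_edge_density_attained)
    have r: "symp (adj G)" "irreflp (adj G)" and V: "finite (fst G)"
      using adj_rels[OF G(1)] G(1) by (auto simp: rels_def graph_def)
    have "97200 * real (num4 (adj G) (fst G)) + real (bad6 (adj G) (fst G)) + square_sum (adj G) (fst G)
      \<le> 48000 * real (card (fst G) choose 6) + M * real (card (fst G)) ^ 5"
      by (rule global_bound[OF r V M(1) M(2)[OF r]])
    then have "real (num4 (adj G) (fst G)) \<le> 40 / 81 * real (n choose 6) + M / 97200 * real n ^ 5"
      using square_sum_nonneg[OF V, of "adj G"] unfolding G(2) by linarith
    then have "real (num4 (adj G) (fst G)) / real (n choose 6) \<le> (40 / 81 * real (n choose 6) + M / 97200 * real n ^ 5) / real (n choose 6)"
      by (rule divide_right_mono) simp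
    also have "\<dots> = 40 / 81 + M / 97200 * real n ^ 5 / real (n choose 6)" using n by (simp add: add_divide_distrib)
    finally show ?thesis unfolding G(3) edge_density_num4[OF G(1)] G(2) .
  qed
  have lower: "40 / 81 + (- 4800 / 97200) * real n ^ 5 / real (n choose 6) \<le> max_edge_density 6 4 n" if n: "n \<ge> 100" for n
  proof -
    obtain r where r: "r \<in> rels {..<n}" "97200 * real (num4 r {..<n}) \<ge> 48000 * real (card {..<n} choose 6) - 4800 * real n ^ 5"
      using balanced_count[of "{..<n}" "real n"] n by auto
    have "40 / 81 * real (n choose 6) + (- 4800 / 97200) * real n ^ 5 \<le> real (num4 r {..<n})" using r(2) unfolding card_lessThan by linarith
    then have "(40 / 81 * real (n choose 6) + (- 4800 / 97200) * real n ^ 5) / real (n choose 6) \<le> real (num4 r {..<n}) / real (n choose 6)"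
      by (rule divide_right_mono) simp
    moreover have "(40 / 81 * real (n choose 6) + (- 4800 / 97200) * real n ^ 5) / real (n choose 6)
      = 40 / 81 + (- 4800 / 97200) * real n ^ 5 / real (n choose 6)" using n by (simp add: add_divide_distrib diff_divide_distrib)
    ultimately show ?thesis using num4_le_max[OF r(1)] by simp
  qed
  have l: "(\<lambda>n. 40 / 81 + K * real n ^ 5 / real (n choose 6)) \<longlonglongrightarrow> 40 / 81" for K
    using tendsto_add[OF tendsto_const over_choose_tendsto_0[of K], of "40 / 81"] by simp
  show ?thesis
  proof (rule tendsto_sandwich[OF _ _ l l])
    show "\<forall>\<^sub>F n in sequentially. 40 / 81 + (- 4800 / 97200) * real n ^ 5 / real (n choose 6) \<le> max_edge_density 6 4 n"
      by (rule eventually_sequentiallyI[of 100]) (rule lower)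
    show "\<forall>\<^sub>F n in sequentially. max_edge_density 6 4 n \<le> 40 / 81 + M / 97200 * real n ^ 5 / real (n choose 6)"
      by (rule eventually_sequentiallyI[of 6]) (rule upper)
  qed
qed

lemma three_loops_edge: "{i, j} \<in> snd three_loops \<longleftrightarrow> i = j \<and> i < 3"
proof
  assume "{i, j} \<in> snd three_loops"
  then obtain k where "{i, j} = {k}" "k < 3" unfolding three_loops_def by auto
  then show "i = j \<and> i < 3" by (auto simp: doubleton_eq_iff)
next
  assume "i = j \<and> i < 3"
  moreover then have "i = 0 \<or> i = 1 \<or> i = 2" by linarith
  ultimately show "{i, j} \<in> snd three_loops" unfolding three_loops_def by auto
qed

lemma blowup_three_loops:
  "blowup three_loops V = (\<Union>i<3. V i, {{x, y} | x y i. i < 3 \<and> x \<in> V i \<and> y \<in> V i \<and> x \<noteq> y})"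
proof -
  have "(\<exists>x y i j. e = {x, y} \<and> i < 3 \<and> j < 3 \<and> x \<in> V i \<and> y \<in> V j \<and> x \<noteq> y \<and> i = j \<and> i < 3)
    \<longleftrightarrow> (\<exists>x y i. e = {x, y} \<and> i < 3 \<and> x \<in> V i \<and> y \<in> V i \<and> x \<noteq> y)" for e :: "'a set" by blast
  moreover have "fst three_loops = 3" by (simp add: three_loops_def)
  ultimately show ?thesis unfolding blowup_def three_loops_edge by simp
qed

text \<open>The classes of \<open>p\<close> are the parts of a blowup on the same vertex set, and the identity is an admissible bijection.\<close>

lemma edit_distance_le_defects:
  fixes G :: "nat graph"
  assumes G: "graph G" and p: "\<And>x. p x < 3"
  shows "edit_distance_blowups G three_loops \<le> defects (adj G) (fst G) p"
proof -
  let ?V = "cls (fst G) p"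
  let ?H = "blowup three_loops ?V"
  have U: "(\<Union>i<3. ?V i) = fst G" using p by (auto simp: cls_def)
  have fin: "finite (fst G)" using G by (simp add: graph_def)
  have "blowup_parts three_loops ?V"
    unfolding blowup_parts_def disjoint_family_on_def using fin by (auto simp: cls_def)
  then have H: "?H \<in> blowups three_loops" unfolding blowups_def by blast
  have fst: "fst ?H = fst G" by (simp only: blowup_three_loops fst_conv U)
  have mem: "e \<in> snd ?H \<longleftrightarrow> (\<exists>x y. e = {x, y} \<and> x \<in> fst G \<and> y \<in> fst G \<and> x \<noteq> y \<and> p x = p y)" for e
    unfolding blowup_three_loops using p by (auto simp: cls_def)
  let ?W = "{(x, y). x \<in> fst G \<and> y \<in> fst G \<and> wrong (adj G) p x y}"
  have fW: "finite ?W" by (rule finite_subset[of _ "fst G \<times> fst G"]) (use fin in auto)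
  have r: "irreflp (adj G)" "\<And>x y. adj G x y \<Longrightarrow> x \<in> fst G \<and> y \<in> fst G"
    using adj_rels[OF G] by (auto simp: rels_def)
  have sub: "sym_diff (snd G) (snd ?H) \<subseteq> (\<lambda>(x, y). {x, y}) ` ?W"
  proof
    fix e assume e: "e \<in> sym_diff (snd G) (snd ?H)"
    have "\<exists>x y. e = {x, y} \<and> x \<in> fst G \<and> y \<in> fst G \<and> wrong (adj G) p x y"
    proof (cases "e \<in> snd G")
      case True
      then obtain x y where xy: "e = {x, y}" "adj G x y" using edges_eq[OF G] by blast
      have m: "x \<in> fst G" "y \<in> fst G" "x \<noteq> y" using r xy(2) irreflpD by metis+
      have "p x \<noteq> p y"
      proof
        assume "p x = p y"
        then have "e \<in> snd ?H" unfolding mem using xy(1) m by blast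
        then show False using e True by blast
      qed
      then show ?thesis using xy m unfolding wrong_def by blast
    next
      case False
      then have "e \<in> snd ?H" using e by blast
      then obtain x y where xy: "e = {x, y}" "x \<in> fst G" "y \<in> fst G" "x \<noteq> y" "p x = p y" unfolding mem by blast
      then show ?thesis using False unfolding wrong_def adj_def by blast
    qed
    then show "e \<in> (\<lambda>(x, y). {x, y}) ` ?W" by force
  qed
  have "card (sym_diff (snd G) (snd ?H)) \<le> card ((\<lambda>(x, y). {x, y}) ` ?W)"
    using fW by (intro card_mono[OF _ sub] finite_imageI)
  also have "\<dots> \<le> card ?W" by (rule card_image_le[OF fW])
  finally have D: "card (sym_diff (snd G) (snd ?H)) \<le> defects (adj G) (fst G) p" unfolding defects_def .
  have "(`) id ` snd ?H = snd ?H" by simp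
  moreover have "bij_betw id (fst ?H) (fst G)" unfolding fst by (rule bij_betw_id)
  ultimately have "card (sym_diff (snd G) (snd ?H)) \<in> {card (sym_diff (snd G) ((`) f ` snd ?H)) | f. bij_betw f (fst ?H) (fst G)}"
    by (intro CollectI exI[of _ id]) simp
  then have "edit_distance G ?H \<le> card (sym_diff (snd G) (snd ?H))"
    unfolding edit_distance_def by (rule cInf_lower) simp
  moreover have "edit_distance G ?H \<in> {edit_distance G H | H :: nat graph. H \<in> blowups three_loops \<and> graph_order H = graph_order G}"
    using H fst by (intro CollectI exI[of _ ?H]) (simp add: graph_order_def)
  then have "edit_distance_blowups G three_loops \<le> edit_distance G ?H"
    unfolding edit_distance_blowups_def by (rule cInf_lower) simp
  ultimately show ?thesis using D by linarith
qed

lemma perfectly_stable_three_loops: "perfectly_stable 6 4 three_loops"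
proof -
  obtain c :: real and n0 :: nat where c: "c > 0" and core:
    "\<And>(V :: nat set) r. finite V \<Longrightarrow> n0 \<le> card V \<Longrightarrow> r \<in> rels V \<Longrightarrow>
      \<exists>s\<in>rels V. real (num4 r V) + c * real (card V) ^ 4 * real (part_dist r V) \<le> real (num4 s V)"
    using partitioned_beats_by_distance by blast
  define C where "C = max (1 / c) (real n0 + 6)"
  have "real (edit_distance_blowups G three_loops) \<le> C * (max_edge_density 6 4 (graph_order G) - edge_density 6 4 G) * (real (graph_order G))\<^sup>2"
    if G: "graph G" and big: "real (graph_order G) \<ge> C" for G :: "nat graph"
  proof -
    let ?V = "fst G" and ?r = "adj G"
    define n where "n = real (card ?V)"
    define m where "m = max_edge_density 6 4 (card ?V)"
    define d where "d = edge_density 6 4 G"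
    have V: "finite ?V" and rV: "?r \<in> rels ?V" using G adj_rels[OF G] by (auto simp: graph_def)
    have n: "n \<ge> real n0 + 6" using big unfolding C_def n_def graph_order_def by simp
    have n6: "card ?V \<ge> 6" "n0 \<le> card ?V" "n > 0" using n unfolding n_def by linarith+
    obtain s where s: "s \<in> rels ?V" "real (num4 ?r ?V) + c * n ^ 4 * real (part_dist ?r ?V) \<le> real (num4 s ?V)"
      using core[OF V n6(2) rV] unfolding n_def by blast
    have ch: "real (card ?V choose 6) > 0" using n6(1) by simp
    have "real (num4 s ?V) \<le> m * real (card ?V choose 6)"
      using num4_le_max[OF s(1) V] ch unfolding m_def by (simp add: pos_divide_le_eq)
    moreover have "real (num4 ?r ?V) = d * real (card ?V choose 6)"
      using edge_density_num4[OF G] ch unfolding d_def by simp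
    ultimately have "c * n ^ 4 * real (part_dist ?r ?V) \<le> (m - d) * real (card ?V choose 6)"
      using s(2) by (simp add: left_diff_distrib)
    also have "\<dots> \<le> (m - d) * n ^ 6"
    proof (rule mult_left_mono)
      have "n ^ 6 / 720 \<le> n ^ 6" using n6(3) by simp
      moreover have "real (card ?V choose 6) \<le> n ^ 6 / 720"
        using choose_le_real[of "card ?V" 6] unfolding n_def by (simp add: fact_numeral)
      ultimately show "real (card ?V choose 6) \<le> n ^ 6" by linarith
      show "0 \<le> m - d" using edge_density_le_max[OF G] by (simp add: m_def d_def graph_order_def)
    qed
    also have "\<dots> = n ^ 4 * ((m - d) * n\<^sup>2)" by (simp add: eval_nat_numeral)
    finally have "n ^ 4 * (c * real (part_dist ?r ?V)) \<le> n ^ 4 * ((m - d) * n\<^sup>2)" by (simp add: mult_ac)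
    then have "c * real (part_dist ?r ?V) \<le> (m - d) * n\<^sup>2" using n6(3) by simp
    then have "real (part_dist ?r ?V) \<le> 1 / c * ((m - d) * n\<^sup>2)" using c by (simp add: field_simps)
    also have "\<dots> \<le> C * ((m - d) * n\<^sup>2)"
    proof (rule mult_right_mono)
      show "1 / c \<le> C" by (simp add: C_def)
      have "0 \<le> m - d" using edge_density_le_max[OF G] by (simp add: m_def d_def graph_order_def)
      then show "0 \<le> (m - d) * n\<^sup>2" by simp
    qed
    finally have "real (part_dist ?r ?V) \<le> C * (m - d) * n\<^sup>2" by simp
    moreover obtain p where "\<forall>x. p x < 3" "part_dist ?r ?V = defects ?r ?V p" using part_dist_attained[of ?r ?V] by blast
    then have "edit_distance_blowups G three_loops \<le> part_dist ?r ?V" using edit_distance_le_defects[OF G, of p] by simp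
    then have "real (edit_distance_blowups G three_loops) \<le> real (part_dist ?r ?V)" by (rule of_nat_mono)
    ultimately show ?thesis unfolding m_def d_def n_def graph_order_def by linarith
  qed
  moreover have "C > 0" using c by (simp add: C_def less_max_iff_disj)
  ultimately show ?thesis unfolding perfectly_stable_def by blast
qed

lemma edge_density_blowup:
  fixes V :: "nat \<Rightarrow> nat set"
  assumes "blowup_parts three_loops V"
  shows "edge_density 6 4 (blowup three_loops V) = real (blowup_count (card (V 0)) (card (V 1)) (card (V 2)))
    / real ((card (V 0) + card (V 1) + card (V 2)) choose 6)"
proof -
  let ?G = "blowup three_loops V"
  have fin: "finite (V i)" if "i < 3" for i
    using assms that by (simp add: blowup_parts_def three_loops_def)
  have dis: "i = j" if "i < 3" "j < 3" "x \<in> V i" "x \<in> V j" for i j x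
    using assms that by (auto simp: blowup_parts_def three_loops_def disjoint_family_on_def)
  have fst: "fst ?G = (\<Union>i<3. V i)" by (simp add: blowup_three_loops)
  define p where "p x = (if x \<in> V 0 then 0 else if x \<in> V 1 then 1 else (2 :: nat))" for x
  have p3: "p x < 3" for x by (simp add: p_def)
  have pV: "p x = i" if "i < 3" "x \<in> V i" for x i
  proof -
    have "i = 0 \<or> i = 1 \<or> i = 2" using that(1) by linarith
    then show ?thesis using that dis[of 0 i x] dis[of 1 i x] by (auto simp: p_def)
  qed
  have Vp: "x \<in> V (p x)" if "x \<in> fst ?G" for x
  proof -
    obtain i where "i < 3" "x \<in> V i" using \<open>x \<in> fst ?G\<close> unfolding fst by blast
    then show ?thesis using pV by simp
  qed
  have cls: "cls (fst ?G) p i = V i" if "i < 3" for i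
    using that pV Vp unfolding cls_def fst by blast
  have g: "graph ?G"
    unfolding graph_def fst using fin by (auto simp: blowup_three_loops)
  have "adj ?G x y = same_class p x y" if "x \<in> fst ?G" "y \<in> fst ?G" for x y
  proof
    assume "adj ?G x y"
    then obtain u v i where uv: "{x, y} = {u, v}" "i < 3" "u \<in> V i" "v \<in> V i" "u \<noteq> v"
      unfolding adj_def blowup_three_loops by auto
    then have "x \<in> V i" "y \<in> V i" "x \<noteq> y" by (auto simp: doubleton_eq_iff)
    then show "same_class p x y" using uv(2) pV by (simp add: same_class_def)
  next
    assume "same_class p x y"
    then have "x \<noteq> y" "p x = p y" by (simp_all add: same_class_def)
    moreover have "x \<in> V (p x)" "y \<in> V (p y)" using Vp that by blast+
    ultimately show "adj ?G x y" using p3[of x] unfolding adj_def blowup_three_loops by auto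
  qed
  then have "num4 (adj ?G) (fst ?G) = num4 (same_class p) (fst ?G)" by (rule num4_cong)
  moreover have fG: "finite (fst ?G)" using g by (simp add: graph_def)
  then have "num4 (same_class p) (fst ?G) = blowup_count (card (V 0)) (card (V 1)) (card (V 2))"
    using num4_same_class[of "fst ?G" p, OF _ p3] by (simp add: cls)
  moreover have "card (fst ?G) = card (V 0) + card (V 1) + card (V 2)"
    using card_cls_sum[of "fst ?G" p, OF fG p3] by (simp add: cls)
  ultimately show ?thesis unfolding edge_density_num4[OF g] by simp
qed

section \<open>Densities of blowups\<close>

lemma choose_tendsto:
  assumes "(\<lambda>n. real (v n) / real n) \<longlonglongrightarrow> a"
  shows "(\<lambda>n. real (v n choose k) / real n ^ k) \<longlonglongrightarrow> a ^ k / fact k"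
proof -
  have eq: "real (v n choose k) / real n ^ k = (\<Prod>i = 0..<k. real (v n) / real n - real i / real n) / fact k" for n
  proof -
    have "real (v n choose k) = (\<Prod>i = 0..<k. real (v n) - real i) / fact k"
      unfolding binomial_gbinomial gbinomial_prod_rev ..
    moreover have "(\<Prod>i = 0..<k. real (v n) / real n - real i / real n) = (\<Prod>i = 0..<k. real (v n) - real i) / real n ^ k"
      by (simp add: diff_divide_distrib[symmetric] prod_dividef)
    ultimately show ?thesis by simp
  qed
  have "(\<lambda>n. (\<Prod>i = 0..<k. real (v n) / real n - real i / real n) / fact k) \<longlonglongrightarrow> (\<Prod>i = 0..<k. a - 0) / fact k"
    by (intro tendsto_divide tendsto_prod tendsto_diff assms lim_const_over_n tendsto_const) simp
  then show ?thesis unfolding eq by simp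
qed

definition limit_density :: "real \<Rightarrow> real \<Rightarrow> real \<Rightarrow> real" where
  "limit_density x y z = 60 * (x^3*y^2*z + x^3*y*z^2 + x^2*y^3*z + x^2*y*z^3 + x*y^3*z^2 + x*y^2*z^3)"

lemma blowup_count_tendsto:
  assumes "(\<lambda>n. real (u n) / real n) \<longlonglongrightarrow> x" "(\<lambda>n. real (v n) / real n) \<longlonglongrightarrow> y" "(\<lambda>n. real (w n) / real n) \<longlonglongrightarrow> z"
    and "x + y + z = 1"
  shows "(\<lambda>n. real (blowup_count (u n) (v n) (w n)) / real ((u n + v n + w n) choose 6)) \<longlonglongrightarrow> limit_density x y z"
proof -
  note c = choose_tendsto[OF assms(1), of 2] choose_tendsto[OF assms(1), of 3]
    choose_tendsto[OF assms(2), of 2] choose_tendsto[OF assms(2), of 3]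
    choose_tendsto[OF assms(3), of 2] choose_tendsto[OF assms(3), of 3]
  let ?u = "\<lambda>k n. real (u n choose k) / real n ^ k" and ?v = "\<lambda>k n. real (v n choose k) / real n ^ k"
    and ?w = "\<lambda>k n. real (w n choose k) / real n ^ k"
  let ?N = "\<lambda>n. ?u 3 n * ?v 2 n * (real (w n) / real n) + ?u 3 n * (real (v n) / real n) * ?w 2 n
    + ?u 2 n * ?v 3 n * (real (w n) / real n) + ?u 2 n * (real (v n) / real n) * ?w 3 n
    + (real (u n) / real n) * ?v 3 n * ?w 2 n + (real (u n) / real n) * ?v 2 n * ?w 3 n"
  let ?L = "x^3 / fact 3 * (y^2 / fact 2) * z + x^3 / fact 3 * y * (z^2 / fact 2)
    + x^2 / fact 2 * (y^3 / fact 3) * z + x^2 / fact 2 * y * (z^3 / fact 3)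
    + x * (y^3 / fact 3) * (z^2 / fact 2) + x * (y^2 / fact 2) * (z^3 / fact 3)"
  have N: "?N \<longlonglongrightarrow> ?L" by (intro tendsto_add tendsto_mult c assms(1-3))
  have "(\<lambda>n. real (u n) / real n + real (v n) / real n + real (w n) / real n) \<longlonglongrightarrow> x + y + z"
    by (intro tendsto_add assms(1-3))
  then have s: "(\<lambda>n. real (u n + v n + w n) / real n) \<longlonglongrightarrow> 1" by (simp add: add_divide_distrib assms(4))
  have D: "(\<lambda>n. real ((u n + v n + w n) choose 6) / real n ^ 6) \<longlonglongrightarrow> 1 ^ 6 / fact 6"
    by (rule choose_tendsto[OF s])
  have q: "(\<lambda>n. ?N n / (real ((u n + v n + w n) choose 6) / real n ^ 6)) \<longlonglongrightarrow> ?L / (1 ^ 6 / fact 6)"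
    by (rule tendsto_divide[OF N D]) simp
  have e: "?N n = real (blowup_count (u n) (v n) (w n)) / real n ^ 6" for n
  proof -
    have six: "real n ^ 6 = real n ^ 3 * real n ^ 2 * real n" by (simp add: eval_nat_numeral)
    show ?thesis unfolding blowup_count_def six of_nat_add of_nat_mult add_divide_distrib
      by (simp add: mult_ac)
  qed
  have l: "?L / (1 ^ 6 / fact 6) = limit_density x y z"
    unfolding limit_density_def by (simp add: fact_numeral algebra_simps)
  show ?thesis
  proof (rule Lim_transform_eventually[OF q[unfolded l e]])
    show "\<forall>\<^sub>F n in sequentially. real (blowup_count (u n) (v n) (w n)) / real n ^ 6 / (real ((u n + v n + w n) choose 6) / real n ^ 6)
      = real (blowup_count (u n) (v n) (w n)) / real ((u n + v n + w n) choose 6)"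
      by (rule eventually_sequentiallyI[of 1]) simp
  qed
qed

lemma sum_lessThan_3: "(\<Sum>i<3. f i) = f 0 + f 1 + f (2 :: nat)"
  by (simp add: numeral_3_eq_3 numeral_2_eq_2)

lemma has_blowup_density_three_loops:
  assumes "a \<in> simplex 3"
  shows "has_blowup_density 6 4 three_loops a (limit_density (a ! 0) (a ! 1) (a ! 2))"
  unfolding has_blowup_density_def
proof (intro allI impI)
  fix V :: "nat \<Rightarrow> nat \<Rightarrow> nat set"
  assume V: "\<forall>n. blowup_parts three_loops (V n)"
    and lim: "\<forall>i<fst three_loops. (\<lambda>n. real (card (V n i)) / real n) \<longlonglongrightarrow> a ! i"
  have l: "(\<lambda>n. real (card (V n i)) / real n) \<longlonglongrightarrow> a ! i" if "i < 3" for i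
    using lim that by (simp add: three_loops_def)
  have "a ! 0 + a ! 1 + a ! 2 = 1" using assms by (simp only: simplex_def sum_lessThan_3 mem_Collect_eq)
  then have "(\<lambda>n. real (blowup_count (card (V n 0)) (card (V n 1)) (card (V n 2)))
    / real ((card (V n 0) + card (V n 1) + card (V n 2)) choose 6)) \<longlonglongrightarrow> limit_density (a ! 0) (a ! 1) (a ! 2)"
    by (intro blowup_count_tendsto l) simp_all
  moreover have "edge_density 6 4 (blowup three_loops (V n)) = real (blowup_count (card (V n 0)) (card (V n 1)) (card (V n 2)))
    / real ((card (V n 0) + card (V n 1) + card (V n 2)) choose 6)" for n
    using V by (intro edge_density_blowup) simp
  ultimately show "(\<lambda>n. edge_density 6 4 (blowup three_loops (V n))) \<longlonglongrightarrow> limit_density (a ! 0) (a ! 1) (a ! 2)"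
    by simp
qed

lemma floor_mult_tendsto:
  assumes "a \<ge> 0"
  shows "(\<lambda>n. real (nat \<lfloor>a * real n\<rfloor>) / real n) \<longlonglongrightarrow> a"
proof (rule LIM_zero_cancel, rule tendsto_0_le[OF lim_1_over_n, where K = 1])
  show "\<forall>\<^sub>F n in sequentially. norm (real (nat \<lfloor>a * real n\<rfloor>) / real n - a) \<le> norm (1 / real n :: real) * 1"
  proof (rule eventually_sequentiallyI[of 1])
    fix n :: nat assume n: "1 \<le> n"
    have "0 \<le> a * real n" using assms by simp
    then have "\<bar>real (nat \<lfloor>a * real n\<rfloor>) - a * real n\<bar> \<le> 1" by linarith
    then have "\<bar>real (nat \<lfloor>a * real n\<rfloor>) - a * real n\<bar> / real n \<le> 1 / real n" by (rule divide_right_mono) simp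
    moreover have "norm (real (nat \<lfloor>a * real n\<rfloor>) / real n - a) = \<bar>real (nat \<lfloor>a * real n\<rfloor>) - a * real n\<bar> / real n"
    proof -
      have "real (nat \<lfloor>a * real n\<rfloor>) / real n - a = (real (nat \<lfloor>a * real n\<rfloor>) - a * real n) / real n"
        using n by (simp add: diff_divide_distrib)
      then show ?thesis by (simp add: abs_divide)
    qed
    ultimately show "norm (real (nat \<lfloor>a * real n\<rfloor>) / real n - a) \<le> norm (1 / real n :: real) * 1" by simp
  qed
qed

text \<open>The limit is unique because a sequence of blowups with the prescribed proportions exists: part \<open>i\<close> consists of
  numbers congruent to \<open>i\<close> modulo 3.\<close>

lemma blowup_density_three_loops:
  assumes a: "a \<in> simplex 3"
  shows "blowup_density 6 4 three_loops a = limit_density (a ! 0) (a ! 1) (a ! 2)"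
  unfolding blowup_density_def
proof (rule the_equality)
  show h: "has_blowup_density 6 4 three_loops a (limit_density (a ! 0) (a ! 1) (a ! 2))"
    by (rule has_blowup_density_three_loops[OF a])
  fix L assume L: "has_blowup_density 6 4 three_loops a L"
  define V where "V n i = (\<lambda>k. 3 * k + i) ` {..<nat \<lfloor>a ! i * real n\<rfloor>}" for n i :: nat
  have parts: "\<forall>n. blowup_parts three_loops (V n)"
  proof
    fix n
    have "V n i \<inter> V n j = {}" if ij: "i < 3" "j < 3" "i \<noteq> j" for i j
    proof -
      have "m mod 3 = i" if "m \<in> V n i" for m using that ij by (auto simp: V_def)
      moreover have "m mod 3 = j" if "m \<in> V n j" for m using that ij by (auto simp: V_def)
      ultimately show ?thesis using ij(3) by blast
    qed
    then show "blowup_parts three_loops (V n)"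
      by (simp add: blowup_parts_def three_loops_def disjoint_family_on_def V_def)
  qed
  have "card (V n i) = nat \<lfloor>a ! i * real n\<rfloor>" for n i
    unfolding V_def by (subst card_image) (auto simp: inj_on_def)
  then have lim: "\<forall>i<fst three_loops. (\<lambda>n. real (card (V n i)) / real n) \<longlonglongrightarrow> a ! i"
    using a floor_mult_tendsto by (simp add: simplex_def three_loops_def)
  show "L = limit_density (a ! 0) (a ! 1) (a ! 2)"
    using L h parts lim unfolding has_blowup_density_def by (blast intro: LIMSEQ_unique)
qed

lemma maximizer_three_loops: "maximizer 6 4 three_loops a \<longleftrightarrow> a = [1/3, 1/3, 1/3]"
proof -
  let ?b = "[1/3, 1/3, 1/3 :: real]"
  have f: "fst three_loops = 3" by (simp add: three_loops_def)
  have b: "?b \<in> simplex 3" unfolding simplex_def sum_lessThan_3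
    by (auto simp: less_Suc_eq numeral_3_eq_3)
  have db: "blowup_density 6 4 three_loops ?b = 40 / 81"
    unfolding blowup_density_three_loops[OF b] limit_density_def by (simp add: eval_nat_numeral)
  have bound: "blowup_density 6 4 three_loops y \<le> 40 / 81 - 20 / 27 * ((y ! 0 - 1/3)^2 + (y ! 1 - 1/3)^2 + (y ! 2 - 1/3)^2)"
    if y: "y \<in> simplex 3" for y
  proof -
    have s: "y ! 0 + y ! 1 + y ! 2 = 1" using y by (simp only: simplex_def sum_lessThan_3 mem_Collect_eq)
    have p: "0 \<le> y ! 0" "0 \<le> y ! 1" "0 \<le> y ! 2" using y by (simp_all add: simplex_def)
    have scale: "60 * P \<le> 40 / 81 - 20 / 27 * Q" if "P \<le> 2 / 243 - Q / 81" for P Q :: real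
      using that by linarith
    show ?thesis
      unfolding blowup_density_three_loops[OF y] limit_density_def by (rule scale[OF sym_poly_bound[OF p s]])
  qed
  show ?thesis
  proof
    assume m: "maximizer 6 4 three_loops a"
    then have a: "a \<in> simplex 3" and "blowup_density 6 4 three_loops ?b \<le> blowup_density 6 4 three_loops a"
      using b by (auto simp: maximizer_def f)
    then have ge: "40 / 81 \<le> blowup_density 6 4 three_loops a" unfolding db by (simp only:)
    have no_gap: "Q \<le> 0" if "40 / 81 \<le> D" "D \<le> 40 / 81 - 20 / 27 * Q" for D Q :: real
      using that by linarith
    have le0: "(a ! 0 - 1/3)^2 + (a ! 1 - 1/3)^2 + (a ! 2 - 1/3)^2 \<le> 0" by (rule no_gap[OF ge bound[OF a]])
    have zero: "u = 0 \<and> v = 0 \<and> w = 0" if "u^2 + v^2 + w^2 \<le> 0" for u v w :: real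
    proof -
      have "u^2 = 0" "v^2 = 0" "w^2 = 0"
        using that zero_le_power2[of u] zero_le_power2[of v] zero_le_power2[of w] by linarith+
      then show ?thesis by simp
    qed
    have e: "a ! 0 = 1/3" "a ! 1 = 1/3" "a ! 2 = 1/3" using zero[OF le0] by simp_all
    have len: "length a = 3" using a by (simp add: simplex_def)
    show "a = ?b"
    proof (rule nth_equalityI)
      show "length a = length ?b" using len by simp
      fix i assume "i < length a"
      then have "i = 0 \<or> i = 1 \<or> i = 2" using len by linarith
      then show "a ! i = ?b ! i" using e by auto
    qed
  next
    assume a: "a = ?b"
    have "blowup_density 6 4 three_loops y \<le> 40 / 81" if "y \<in> simplex 3" for y
    proof -
      have "0 \<le> (y ! 0 - 1/3)^2 + (y ! 1 - 1/3)^2 + (y ! 2 - 1/3)^2" by (intro add_nonneg_nonneg) simp_all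
      moreover have "D \<le> 40 / 81" if "0 \<le> Q" "D \<le> 40 / 81 - 20 / 27 * Q" for D Q :: real
        using that by linarith
      ultimately show ?thesis using bound[OF that] by blast
    qed
    then show "maximizer 6 4 three_loops a" unfolding maximizer_def f a db using b by blast
  qed
qed

theorem theorem3p7:
  shows "convergent (max_edge_density 6 4) \<and> edge_inducibility 6 4 = 40 / 3 ^ 4 \<and>
    perfectly_stable 6 4 three_loops \<and>
    (\<forall>a\<in>simplex 3. \<exists>L. has_blowup_density 6 4 three_loops a L) \<and>
    (\<forall>a. maximizer 6 4 three_loops a \<longleftrightarrow> a = [1/3, 1/3, 1/3])"
proof (intro conjI)
  show "convergent (max_edge_density 6 4)"
    using max_edge_density_tendsto by (rule convergentI)
  show "edge_inducibility 6 4 = 40 / 3 ^ 4"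
    unfolding edge_inducibility_def using max_edge_density_tendsto[THEN limI] by simp
  show "perfectly_stable 6 4 three_loops" by (rule perfectly_stable_three_loops)
  show "\<forall>a\<in>simplex 3. \<exists>L. has_blowup_density 6 4 three_loops a L"
    using has_blowup_density_three_loops by blast
  show "\<forall>a. maximizer 6 4 three_loops a \<longleftrightarrow> a = [1/3, 1/3, 1/3]"
    using maximizer_three_loops by blast
qed


end
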